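(* Let $M$ be a connected closed Riemannian manifold. Let $A$ be a real $C^*$-subring. For any projection $p\in C(M,A)$ and any $\varepsilon>0$, there exists a projection $q\in C^{\infty}(M,A)$ such that $\|p-q\|_{\infty}<\varepsilon$ and $L(q)<L(p)+\varepsilon$.
   Context: A real $C^*$-subring is a norm-closed $*$-subring of a (complex) $C^*$-algebra which is closed under multiplication by scalars in $\mathbb{R}$ (for example $M_n(\mathbb{R})\subset M_n(\mathbb{C})$, or any $C^*$-algebra); it carries the norm and involution of the ambient $C^*$-algebra. For a compact manifold $M$ and a real $C^*$-subring $A$, $C(M,A)$ denotes the real $C^*$-subring of all continuous $A$-valued functions on $M$ (pointwise operations, supremum norm), and $C^{\infty}(M,A)$ denotes the subalgebra of all smooth ($C^\infty$) $A$-valued functions on $M$, where $A$ is regarded as a real Banach space. A projection is a self-adjoint idempotent element ($p=p^*=p^2$); thus a projection in $C(M,A)$ is a continuous function on $M$ whose values are projections of $A$. "Closed manifold" means compact without boundary. $\|f\|_{\infty}=\sup_{x\in M}\|f(x)\|$ is the supremum norm, and $L(f)\in[0,+\infty]$ is the Lipschitz constant $$L(f)=\sup_{x,y\in M,\ x\neq y}\frac{\|f(x)-f(y)\|}{\rho(x,y)},$$ where $\rho$ is the geodesic distance on $M$. If $L(p)=+\infty$, the inequality $L(q)<L(p)+\varepsilon$ is read as $L(q)<+\infty$. *)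

theory Defs
  imports "HOL-Analysis.Analysis"
begin

section \<open>C*-algebras and real C*-subrings\<close>

text \<open>Complex C*-algebras, not necessarily unital.  The real Banach algebra structure is
  the one underlying the complex structure, by \<open>scaleC_of_real\<close>.\<close>

class cstar_algebra = banach + real_normed_algebra +
  fixes scaleC :: "complex \<Rightarrow> 'a \<Rightarrow> 'a"
    and star :: "'a \<Rightarrow> 'a"
  assumes scaleC_add_right: "scaleC c (x + y) = scaleC c x + scaleC c y"
    and scaleC_add_left: "scaleC (c + d) x = scaleC c x + scaleC d x"
    and scaleC_scaleC: "scaleC c (scaleC d x) = scaleC (c * d) x"
    and scaleC_of_real: "scaleC (complex_of_real r) x = scaleR r x"
    and mult_scaleC_left: "scaleC c x * y = scaleC c (x * y)"
    and mult_scaleC_right: "x * scaleC c y = scaleC c (x * y)"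
    and norm_scaleC: "norm (scaleC c x) = cmod c * norm x"
    and star_add: "star (x + y) = star x + star y"
    and star_scaleC: "star (scaleC c x) = scaleC (cnj c) (star x)"
    and star_mult: "star (x * y) = star y * star x"
    and star_star: "star (star x) = x"
    and cstar_identity: "norm (star x * x) = (norm x)\<^sup>2"

definition real_cstar_subring :: "'a::cstar_algebra set \<Rightarrow> bool" where
  "real_cstar_subring A \<longleftrightarrow>
     subspace A \<and> (\<forall>x\<in>A. \<forall>y\<in>A. x * y \<in> A) \<and> (\<forall>x\<in>A. star x \<in> A) \<and> closed A"

definition is_projection :: "'a::cstar_algebra \<Rightarrow> bool" where
  "is_projection a \<longleftrightarrow> star a = a \<and> a * a = a"


section \<open>Smooth manifolds\<close>

text \<open>For open \<open>S\<close> in a Euclidean space this is the class \<open>C\<^sup>k\<close>: since the domain is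
  finite-dimensional, \<open>f\<close> is \<open>C\<^sup>k\<close> iff all iterated directional derivatives up to order \<open>k\<close>
  exist and are continuous.\<close>

fun Ck_on :: "nat \<Rightarrow> 'e::euclidean_space set \<Rightarrow> ('e \<Rightarrow> 'b::real_normed_vector) \<Rightarrow> bool" where
  "Ck_on 0 S f \<longleftrightarrow> continuous_on S f"
| "Ck_on (Suc k) S f \<longleftrightarrow>
     (\<forall>x\<in>S. f differentiable (at x)) \<and>
     (\<forall>v. Ck_on k S (\<lambda>x. frechet_derivative f (at x) v))"

definition smooth_on :: "'e::euclidean_space set \<Rightarrow> ('e \<Rightarrow> 'b::real_normed_vector) \<Rightarrow> bool" where
  "smooth_on S f \<longleftrightarrow> (\<forall>k. Ck_on k S f)"

text \<open>A chart \<open>(U, \<phi>)\<close> consists of its domain and its coordinate map; the values of \<open>\<phi>\<close>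
  outside \<open>U\<close> are irrelevant.  The manifold is a subset \<open>M\<close> of a Hausdorff space, with the
  subspace topology.\<close>

type_synonym ('m, 'e) chart = "'m set \<times> ('m \<Rightarrow> 'e)"

definition is_chart :: "'m::t2_space set \<Rightarrow> ('m, 'e::euclidean_space) chart \<Rightarrow> bool" where
  "is_chart M = (\<lambda>(U, \<phi>).
     openin (top_of_set M) U \<and> open (\<phi> ` U) \<and> homeomorphism U (\<phi> ` U) \<phi> (inv_into U \<phi>))"

definition transition :: "('m, 'e) chart \<Rightarrow> ('m, 'e) chart \<Rightarrow> 'e \<Rightarrow> 'e" where
  "transition c d = snd d \<circ> inv_into (fst c) (snd c)"

text \<open>The charts take values in open subsets of \<open>'e\<close>, so there is no boundary.  Since
  types of class \<open>euclidean_space\<close> have positive dimension, zero-dimensional manifolds, i.e.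
  discrete spaces, are admitted separately, with an empty atlas.  Second countability is not
  required here; it is automatic for compact manifolds.\<close>

definition smooth_manifold ::
  "'m::t2_space set \<Rightarrow> ('m, 'e::euclidean_space) chart set \<Rightarrow> bool" where
  "smooth_manifold M \<A> \<longleftrightarrow>
     (\<forall>c\<in>\<A>. is_chart M c) \<and>
     (\<forall>c\<in>\<A>. \<forall>d\<in>\<A>. smooth_on (snd c ` (fst c \<inter> fst d)) (transition c d)) \<and>
     (M \<subseteq> (\<Union>c\<in>\<A>. fst c) \<or> (\<A> = {} \<and> (\<forall>x\<in>M. openin (top_of_set M) {x})))"


section \<open>Riemannian metrics and the geodesic distance\<close>

text \<open>A Riemannian metric is given by its local coordinate expressions: for a chart \<open>c\<close> around
  \<open>x\<close>, \<open>g c x\<close> is the inner product on the tangent space at \<open>x\<close>, which is identified with \<open>'e\<close>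
  by the chart.  The last condition is the transformation law under changes of
  coordinates.\<close>

definition riemannian_metric ::
  "('m::t2_space, 'e::euclidean_space) chart set \<Rightarrow>
   (('m, 'e) chart \<Rightarrow> 'm \<Rightarrow> 'e \<Rightarrow> 'e \<Rightarrow> real) \<Rightarrow> bool" where
  "riemannian_metric \<A> g \<longleftrightarrow>
     (\<forall>c\<in>\<A>. \<forall>x\<in>fst c.
        bilinear (g c x) \<and> (\<forall>u v. g c x u v = g c x v u) \<and> (\<forall>u. u \<noteq> 0 \<longrightarrow> g c x u u > 0)) \<and>
     (\<forall>c\<in>\<A>. \<forall>u v. smooth_on (snd c ` fst c) (\<lambda>y. g c (inv_into (fst c) (snd c) y) u v)) \<and>
     (\<forall>c\<in>\<A>. \<forall>d\<in>\<A>. \<forall>x\<in>fst c \<inter> fst d. \<forall>u v.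
        let D = frechet_derivative (transition c d) (at (snd c x))
        in g c x u v = g d x (D u) (D v))"

definition riemannian_manifold ::
  "'m::t2_space set \<Rightarrow> ('m, 'e::euclidean_space) chart set \<Rightarrow>
   (('m, 'e) chart \<Rightarrow> 'm \<Rightarrow> 'e \<Rightarrow> 'e \<Rightarrow> real) \<Rightarrow> bool" where
  "riemannian_manifold M \<A> g \<longleftrightarrow> smooth_manifold M \<A> \<and> riemannian_metric \<A> g"

definition C1_curve ::
  "'m::t2_space set \<Rightarrow> ('m, 'e::euclidean_space) chart set \<Rightarrow> real \<Rightarrow> real \<Rightarrow> (real \<Rightarrow> 'm) \<Rightarrow> bool"
  where
  "C1_curve M \<A> a b \<gamma> \<longleftrightarrow>
     continuous_on {a..b} \<gamma> \<and> \<gamma> ` {a..b} \<subseteq> M \<and>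
     (\<forall>(U, \<phi>)\<in>\<A>. \<exists>D. continuous_on {t\<in>{a..b}. \<gamma> t \<in> U} D \<and>
        (\<forall>t\<in>{a..b}. \<gamma> t \<in> U \<longrightarrow> ((\<phi> \<circ> \<gamma>) has_vector_derivative D t) (at t within {a..b})))"

definition piecewise_C1_curve ::
  "'m::t2_space set \<Rightarrow> ('m, 'e::euclidean_space) chart set \<Rightarrow> (real \<Rightarrow> 'm) \<Rightarrow> bool" where
  "piecewise_C1_curve M \<A> \<gamma> \<longleftrightarrow>
     (\<exists>(n::nat) \<tau>. \<tau> 0 = 0 \<and> \<tau> n = 1 \<and>
        (\<forall>i<n. \<tau> i < \<tau> (Suc i) \<and> C1_curve M \<A> (\<tau> i) (\<tau> (Suc i)) \<gamma>))"

text \<open>The norm of the velocity vector of \<open>\<gamma>\<close> at time \<open>t\<close>.  By the transformation law the value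
  does not depend on the chosen chart; it is meaningful only where \<open>\<gamma>\<close> is differentiable,
  which for piecewise \<open>C\<^sup>1\<close> curves excludes finitely many times and does not affect the
  length.\<close>

definition speed ::
  "('m::t2_space, 'e::euclidean_space) chart set \<Rightarrow>
   (('m, 'e) chart \<Rightarrow> 'm \<Rightarrow> 'e \<Rightarrow> 'e \<Rightarrow> real) \<Rightarrow> (real \<Rightarrow> 'm) \<Rightarrow> real \<Rightarrow> real" where
  "speed \<A> g \<gamma> t =
     (let c = (SOME c. c \<in> \<A> \<and> \<gamma> t \<in> fst c);
          v = vector_derivative (snd c \<circ> \<gamma>) (at t)
      in sqrt (g c (\<gamma> t) v v))"

definition curve_length ::
  "('m::t2_space, 'e::euclidean_space) chart set \<Rightarrow>
   (('m, 'e) chart \<Rightarrow> 'm \<Rightarrow> 'e \<Rightarrow> 'e \<Rightarrow> real) \<Rightarrow> (real \<Rightarrow> 'm) \<Rightarrow> real" where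
  "curve_length \<A> g \<gamma> = integral {0..1} (speed \<A> g \<gamma>)"

definition geodesic_dist ::
  "'m::t2_space set \<Rightarrow> ('m, 'e::euclidean_space) chart set \<Rightarrow>
   (('m, 'e) chart \<Rightarrow> 'm \<Rightarrow> 'e \<Rightarrow> 'e \<Rightarrow> real) \<Rightarrow> 'm \<Rightarrow> 'm \<Rightarrow> real" where
  "geodesic_dist M \<A> g x y =
     Inf {curve_length \<A> g \<gamma> | \<gamma>. piecewise_C1_curve M \<A> \<gamma> \<and> \<gamma> 0 = x \<and> \<gamma> 1 = y}"


section \<open>Spaces of algebra-valued functions\<close>

text \<open>Only the values on \<open>M\<close> of the functions below are relevant.\<close>

definition continuous_maps :: "'m::t2_space set \<Rightarrow> 'a::cstar_algebra set \<Rightarrow> ('m \<Rightarrow> 'a) set" where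
  "continuous_maps M A = {f. continuous_on M f \<and> f ` M \<subseteq> A}"

text \<open>Smoothness is expressed in the ambient algebra: when \<open>A\<close> is a closed real subspace, the
  derivatives of an \<open>A\<close>-valued function are limits of elements of \<open>A\<close>, so this is smoothness
  as a map into the real Banach space \<open>A\<close>.\<close>

definition smooth_maps ::
  "'m::t2_space set \<Rightarrow> ('m, 'e::euclidean_space) chart set \<Rightarrow> 'a::cstar_algebra set \<Rightarrow>
   ('m \<Rightarrow> 'a) set" where
  "smooth_maps M \<A> A =
     {f \<in> continuous_maps M A. \<forall>(U, \<phi>)\<in>\<A>. smooth_on (\<phi> ` U) (f \<circ> inv_into U \<phi>)}"

definition projection_on :: "'m set \<Rightarrow> ('m \<Rightarrow> 'a::cstar_algebra) \<Rightarrow> bool" where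
  "projection_on M f \<longleftrightarrow> (\<forall>x\<in>M. is_projection (f x))"

definition sup_norm :: "'m set \<Rightarrow> ('m \<Rightarrow> 'a::real_normed_vector) \<Rightarrow> ennreal" where
  "sup_norm M f = (SUP x\<in>M. ennreal (norm (f x)))"

definition lipschitz_const ::
  "'m::t2_space set \<Rightarrow> ('m, 'e::euclidean_space) chart set \<Rightarrow>
   (('m, 'e) chart \<Rightarrow> 'm \<Rightarrow> 'e \<Rightarrow> 'e \<Rightarrow> real) \<Rightarrow> ('m \<Rightarrow> 'a::real_normed_vector) \<Rightarrow> ennreal" where
  "lipschitz_const M \<A> g f =
     (SUP (x, y)\<in>{(x, y). x \<in> M \<and> y \<in> M \<and> x \<noteq> y}.
        ennreal (norm (f x - f y) / geodesic_dist M \<A> g x y))"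

end

theory Submission imports Defs begin

text \<open>The projection \<open>p\<close> is first approximated by a smooth self-adjoint \<open>A\<close>-valued function
  \<open>f\<close>: mollify \<open>p\<close> in finitely many charts and glue with a partition of unity.  In a small chart
  ball the metric is almost constant, so mollification increases the Lipschitz constant only
  slightly, and the derivatives of the partition of unity are multiplied by the uniformly small
  differences between the local mollifications and \<open>f\<close>.  Integrating along curves gives
  \<open>L(f) < L(p) + \<epsilon>\<close>.

  Newton's iteration \<open>a \<mapsto> 3 a\<^sup>2 - 2 a\<^sup>3\<close> turns every value of \<open>f\<close> into a projection
  \<open>q\<close> that commutes with it.  Put \<open>m = q + f - 2 f q = (q - f)\<^sup>2 - (f\<^sup>2 - f)\<close>, which is small.  For
  two points with values \<open>(q, f)\<close> and \<open>(r, h)\<close>, the difference \<open>d = r - q\<close> solves the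
  Sylvester equation
  \<open>d - m\<^sub>r d - d m\<^sub>q = r (h - f) + (h - f) q - 2 r (h - f) q\<close>, whose right-hand side is
  \<open>((h - f) - (2 r - 1) (h - f) (2 q - 1)) / 2\<close> and hence has norm at most \<open>\<parallel>h - f\<parallel>\<close>, as
  \<open>2 r - 1\<close> and \<open>2 q - 1\<close> are unitary.  So
  \<open>f \<mapsto> q\<close> is almost contractive, for arbitrarily distant points.  Differentiating the same
  equation expresses the derivatives of \<open>q\<close> by solutions of Sylvester equations with data of the
  same regularity as \<open>q\<close>, so \<open>q\<close> is as smooth as \<open>f\<close>.\<close>

section \<open>Functional calculus near projections\<close>

text \<open>The Lipschitz constant must be met up to an additive \<epsilon>, so every step after the
  mollification may cost only a factor close to 1; a generic bound for a smooth functional calculus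
  would lose a fixed factor. The two-sided form of the equation for \<open>r - q\<close> is chosen
  for this: its right-hand side keeps only off-diagonal corners of \<open>h - f\<close>.
  \<open>A\<close> is merely real and may lack a unit, so real polynomials without constant term
  replace contour integrals, and \<open>2 q - 1\<close> enters only through the maps
  \<open>z \<mapsto> 2 q z - z\<close> and \<open>z \<mapsto> 2 z q - z\<close>. The projection is
  chosen separately at each point; its regularity follows from commutation with \<open>f\<close> and
  smallness of \<open>m\<close> alone. A single parameter \<eta> controls the mollification error
  and all later losses. The condition that ties it to \<epsilon> is
  \<open>L + \<eta> \<le> (1 - 24 \<eta>) (L + \<epsilon>)\<close>. If \<open>p\<close> is not
  Lipschitz, the same construction applies, since a smooth function on a compact manifold has
  bounded slope.\<close>

lemma star_scaleR: "star (r *\<^sub>R x) = r *\<^sub>R star (x::'a::cstar_algebra)"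
  by (metis complex_cnj_complex_of_real scaleC_of_real star_scaleC)

text \<open>The C*-identity gives \<open>(norm y)^2 \<le> norm (star y) * norm y\<close>; taking
  \<open>y\<close> to be \<open>x\<close> and \<open>star x\<close> yields both
  inequalities.\<close>

lemma norm_star: "norm (star x) = norm (x::'a::cstar_algebra)"
proof -
  have le: "norm y \<le> norm (star y)" for y :: 'a
  proof (cases "y = 0")
    case False
    have "norm y * norm y \<le> norm (star y) * norm y"
      using cstar_identity[of y] norm_mult_ineq[of "star y" y] by (simp add: power2_eq_square)
    then show ?thesis using False by simp
  qed simp
  show ?thesis using le[of x] le[of "star x"] by (simp add: star_star)
qed

lemma bounded_linear_star: "bounded_linear (star :: 'a::cstar_algebra \<Rightarrow> 'a)"
  by (rule bounded_linear_intro[where K=1]) (simp_all add: star_add star_scaleR norm_star)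

lemma star_diff: "star (x - y) = star x - star (y::'a::cstar_algebra)"
  using bounded_linear.linear[OF bounded_linear_star] linear_diff by blast

lemma closed_selfadjoint: "closed {a::'a::cstar_algebra. star a = a}"
  by (intro closed_Collect_eq linear_continuous_on bounded_linear_star continuous_on_id)

text \<open>By the C*-identity \<open>(norm q)^2 = norm q\<close>, so the norm is 0 or 1.\<close>

lemma norm_projection_le_1:
  assumes "is_projection (q::'a::cstar_algebra)"
  shows "norm q \<le> 1"
proof -
  have "norm q * norm q = norm q"
    using cstar_identity[of q] assms by (simp add: is_projection_def power2_eq_square)
  then show ?thesis by auto
qed

text \<open>\<open>2q - 1\<close> is unitary, also when there is no unit: multiplying by it is isometric.\<close>

lemma norm_symmetry_left:
  assumes "is_projection (q::'a::cstar_algebra)"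
  shows "norm (2 *\<^sub>R (q * z) - z) = norm z"
proof -
  have q: "star q = q" "q * q = q" "\<And>z. q * (q * z) = q * z"
    using assms by (simp_all add: is_projection_def mult.assoc[symmetric])
  have "star (2 *\<^sub>R (q * z) - z) * (2 *\<^sub>R (q * z) - z) = star z * z"
    by (simp add: star_diff star_scaleR star_mult q algebra_simps flip: scaleR_add_left)
  then have "(norm (2 *\<^sub>R (q * z) - z))\<^sup>2 = (norm z)\<^sup>2"
    using cstar_identity by metis
  then show ?thesis by simp
qed

lemma norm_symmetry_right:
  assumes "is_projection (q::'a::cstar_algebra)"
  shows "norm (2 *\<^sub>R (z * q) - z) = norm z"
proof -
  have "star (2 *\<^sub>R (z * q) - z) = 2 *\<^sub>R (q * star z) - star z"
    using assms by (simp add: star_diff star_scaleR star_mult is_projection_def)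
  then show ?thesis
    using norm_symmetry_left[OF assms, of "star z"] norm_star by metis
qed

text \<open>The expression is the sum of the corners \<open>r D (1 - q)\<close> and
  \<open>(1 - r) D q\<close>. Bounding the two corners separately would give the factor 2; the
  symmetries give 1.\<close>

lemma norm_offdiag_le:
  assumes "is_projection (q::'a::cstar_algebra)" "is_projection r"
  shows "norm (r * D + D * q - 2 *\<^sub>R (r * D * q)) \<le> norm D"
proof -
  define E where "E = 2 *\<^sub>R (r * D) - D"
  have "2 *\<^sub>R (r * D + D * q - 2 *\<^sub>R (r * D * q)) = D - (2 *\<^sub>R (E * q) - E)"
    by (simp add: E_def algebra_simps flip: scaleR_add_left)
  then have "2 * norm (r * D + D * q - 2 *\<^sub>R (r * D * q)) \<le> norm D + norm (2 *\<^sub>R (E * q) - E)"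
    by (metis norm_scaleR norm_triangle_ineq4 abs_numeral)
  also have "norm (2 *\<^sub>R (E * q) - E) = norm D"
    using norm_symmetry_left norm_symmetry_right assms E_def by metis
  finally show ?thesis by simp
qed

text \<open>Multiplying \<open>q + f - 2 f q\<close> by \<open>q\<close> leaves
  \<open>q - f q\<close>, and similarly for \<open>r\<close> and \<open>h\<close>; hence the terms
  \<open>r\<close> and \<open>q\<close> on the left cancel, and what survives is linear in
  \<open>h - f\<close>. Only the commutation of each idempotent with its own partner enters, not any
  relation between the two points.\<close>

lemma projection_diff_identity:
  fixes q r f h :: "'a::real_normed_algebra"
  assumes "q * q = q" "r * r = r" "q * f = f * q" "r * h = h * r"
  shows "(r - q) - (r + h - 2 *\<^sub>R (h * r)) * (r - q) - (r - q) * (q + f - 2 *\<^sub>R (f * q))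
    = r * (h - f) + (h - f) * q - 2 *\<^sub>R (r * (h - f) * q)"
proof -
  have r: "r * (r * z) = r * z" "q * (q * z) = q * z" "q * (f * z) = f * (q * z)"
    "r * (h * z) = h * (r * z)" for z
    using assms by (metis mult.assoc)+
  show ?thesis
    by (simp add: algebra_simps assms r scaleR_2)
qed

lemma sylvester_norm_le:
  fixes z :: "'a::real_normed_algebra"
  shows "(1 - norm m - norm n) * norm z \<le> norm (z - m * z - z * n)"
proof -
  have "norm z \<le> norm (z - m * z - z * n) + norm (m * z + z * n)"
    using norm_triangle_ineq[of "z - m * z - z * n" "m * z + z * n"] by simp
  moreover have "norm (m * z + z * n) \<le> norm m * norm z + norm z * norm n"
    by (meson add_mono norm_mult_ineq norm_triangle_le)
  ultimately show ?thesis by (simp add: algebra_simps)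
qed

text \<open>The estimate is global: the factor \<open>1 - 2 * \<mu>\<close> depends on the defects
  only, however far apart \<open>f\<close> and \<open>h\<close> are, and tends to 1 with
  them.\<close>

lemma norm_projection_diff_le:
  fixes q r f h :: "'a::cstar_algebra"
  assumes "is_projection q" "is_projection r" "q * f = f * q" "r * h = h * r"
    and "norm (q + f - 2 *\<^sub>R (f * q)) \<le> \<mu>" "norm (r + h - 2 *\<^sub>R (h * r)) \<le> \<mu>"
  shows "(1 - 2 * \<mu>) * norm (r - q) \<le> norm (h - f)"
proof -
  let ?m = "r + h - 2 *\<^sub>R (h * r)" and ?n = "q + f - 2 *\<^sub>R (f * q)"
  have "(1 - 2 * \<mu>) * norm (r - q) \<le> (1 - norm ?m - norm ?n) * norm (r - q)"
    using assms(5,6) by (intro mult_right_mono) auto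
  also have "\<dots> \<le> norm ((r - q) - ?m * (r - q) - (r - q) * ?n)"
    by (rule sylvester_norm_le)
  also have "\<dots> \<le> norm (h - f)"
    using assms projection_diff_identity[of q r f h] norm_offdiag_le[of q r "h - f"]
    by (simp add: is_projection_def)
  finally show ?thesis .
qed

text \<open>Newton's step for \<open>t^2 - t = 0\<close> divides by \<open>2 t - 1\<close>. Since
  \<open>(2 t - 1)^2 = 1 + 4 (t^2 - t)\<close> is nearly 1 close to an idempotent, dividing may be
  replaced by multiplying, and \<open>t - (2 t - 1) (t^2 - t)\<close> is this cubic. Without a
  constant term it maps a non-unital algebra into itself.\<close>

definition newton :: "'a::real_normed_algebra \<Rightarrow> 'a" where
  "newton a = 3 *\<^sub>R (a * a) - 2 *\<^sub>R (a * (a * a))"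

lemma newton_diff:
  fixes a :: "'a::real_normed_algebra"
  shows "newton a - a = (a * a - a) - 2 *\<^sub>R (a * (a * a - a))"
proof -
  have "3 *\<^sub>R (a * a) = 2 *\<^sub>R (a * a) + a * a"
    by (simp add: scaleR_left_distrib[of 2 1, simplified])
  then show ?thesis
    by (simp add: newton_def algebra_simps)
qed

text \<open>All factors are polynomials in \<open>a\<close>, so this is a polynomial identity in one
  variable. The absence of a term linear in \<open>e\<close> makes the defect shrink
  quadratically.\<close>

lemma newton_defect:
  fixes a :: "'a::real_normed_algebra"
  assumes "e = a * a - a"
  shows "newton a * newton a - newton a = 4 *\<^sub>R (e * (e * e)) - 3 *\<^sub>R (e * e)"
  unfolding newton_def assms
  by (simp add: algebra_simps flip: scaleR_add_left)

text \<open>The bounds 5/4 and 1/16 keep all iterates in the ball of radius 2, where one step moves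
  by at most 5 times the defect. The displacements sum to at most
  \<open>5 / (1 - 1/4) = 20/3\<close> times the initial defect, which explains the factor 7.
  Membership in \<open>A\<close>, self-adjointness and commutation with \<open>f\<close> are closed
  conditions and pass to the limit.\<close>

lemma near_projection:
  fixes f :: "'a::cstar_algebra"
  assumes A: "real_cstar_subring A" and f: "f \<in> A" "star f = f" "norm f \<le> 5/4"
    and E: "norm (f * f - f) \<le> 1/16"
  obtains q where "q \<in> A" "is_projection q" "q * f = f * q" "norm (q - f) \<le> 7 * norm (f * f - f)"
proof -
  define a where "a n = (newton ^^ n) f" for n
  define e where "e n = a n * a n - a n" for n
  define E where "E = norm (f * f - f)"
  have aS: "a (Suc n) = newton (a n)" for n by (simp add: a_def)
  have sub: "subspace A" and mul: "\<And>x y. x \<in> A \<Longrightarrow> y \<in> A \<Longrightarrow> x * y \<in> A" and cl: "closed A"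
    using A by (auto simp: real_cstar_subring_def)
  have aA: "a n \<in> A \<and> star (a n) = a n \<and> a n * f = f * a n" for n
  proof (induction n)
    case 0 then show ?case using f by (simp add: a_def)
  next
    case (Suc n)
    then have "newton (a n) \<in> A" unfolding newton_def
      by (intro subspace_diff sub subspace_mul mul) auto
    moreover have "star (newton (a n)) = newton (a n)"
      using Suc by (simp add: newton_def star_diff star_scaleR star_mult mult.assoc)
    moreover have "newton (a n) * f = f * newton (a n)"
    proof -
      have *: "a n * (f * z) = f * (a n * z)" for z using Suc by (metis mult.assoc)
      show ?thesis using Suc by (simp add: newton_def algebra_simps *)
    qed
    ultimately show ?case by (simp add: aS)
  qed
  have E01: "0 \<le> E" "E \<le> 1/16" using E by (auto simp: E_def)
  have ne: "norm (e n) \<le> E * (1/4)^n" for n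
  proof (induction n)
    case 0 then show ?case by (simp add: e_def a_def E_def)
  next
    case (Suc n)
    have p1: "(1/4::real)^n \<le> 1" by (simp add: power_le_one)
    have "norm (e n) \<le> E * 1" using Suc p1 E01 by (meson mult_left_mono order_trans)
    then have le: "norm (e n) \<le> 1/16" using E01 by linarith
    have "norm (e (Suc n)) \<le> norm (4 *\<^sub>R (e n * (e n * e n))) + norm (3 *\<^sub>R (e n * e n))"
      unfolding e_def[of "Suc n"] aS newton_defect[OF e_def] by (rule norm_triangle_ineq4)
    also have "\<dots> \<le> 4 * (norm (e n) * (norm (e n) * norm (e n))) + 3 * (norm (e n) * norm (e n))"
      by (intro add_mono) (auto intro!: norm_mult_ineq order_trans[OF norm_mult_ineq] mult_left_mono)
    also have "\<dots> = norm (e n) * ((4 * norm (e n) + 3) * norm (e n))" by (simp add: algebra_simps)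
    \<comment> \<open>The quadratic smallness is spent on a geometric rate:
      \<open>(4/16 + 3)/16\<close> is below 1/4.\<close>
    also have "\<dots> \<le> norm (e n) * ((4 * (1/16) + 3) * (1/16))"
      using le by (intro mult_left_mono mult_mono) auto
    also have "\<dots> \<le> norm (e n) * (1/4)" by (intro mult_left_mono) auto
    also have "\<dots> \<le> E * (1/4)^Suc n" using Suc by simp
    finally show ?case .
  qed
  have step: "norm (a (Suc n) - a n) \<le> (1 + 2 * norm (a n)) * norm (e n)" for n
  proof -
    have "a (Suc n) - a n = e n - 2 *\<^sub>R (a n * e n)"
      unfolding aS e_def by (rule newton_diff)
    then have "norm (a (Suc n) - a n) \<le> norm (e n) + norm (2 *\<^sub>R (a n * e n))"
      by (metis norm_triangle_ineq4)
    also have "\<dots> \<le> norm (e n) + 2 * (norm (a n) * norm (e n))"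
      by (intro add_mono) (auto intro: norm_mult_ineq)
    finally show ?thesis by (simp add: algebra_simps)
  qed
  \<comment> \<open>The bound grows by \<open>7 * 3/4 = 21/4\<close> times
    \<open>E * (1/4)^n\<close> at each step, which covers the displacement of 5 times that quantity;
    a constant bound would not survive the induction.\<close>
  have close: "norm (a n - f) \<le> 7 * E * (1 - (1/4)^n)" for n
  proof (induction n)
    case 0 then show ?case by (simp add: a_def)
  next
    case (Suc n)
    have "7 * E * (1 - (1/4)^n) \<le> 7 * E * 1" using E01 by (intro mult_left_mono) auto
    with Suc have "norm (a n - f) \<le> 7/16" using E01 by linarith
    then have "norm (a n) \<le> 2" using f(3) norm_triangle_sub[of "a n" f] by linarith
    then have st: "norm (a (Suc n) - a n) \<le> (1 + 2 * 2) * (E * (1/4)^n)"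
      by (intro order_trans[OF step mult_mono] ne) auto
    have "norm (a (Suc n) - f) \<le> norm (a (Suc n) - a n) + norm (a n - f)"
      using norm_triangle_ineq[of "a (Suc n) - a n" "a n - f"] by simp
    also have "\<dots> \<le> (1 + 2 * 2) * (E * (1/4)^n) + 7 * E * (1 - (1/4)^n)"
      by (rule add_mono[OF st Suc])
    also have "(1 + 2 * 2) * (E * (1/4)^n) + 7 * E * (1 - (1/4)^n) \<le> 7 * E * (1 - (1/4)^Suc n)"
    proof -
      have "0 \<le> E * (1/4)^n" using E01 by simp
      then show ?thesis by (simp add: algebra_simps)
    qed
    finally show ?case .
  qed
  have close': "norm (a n - f) \<le> 7 * E" for n
  proof -
    have "7 * E * (1 - (1/4)^n) \<le> 7 * E * 1" using E01 by (intro mult_left_mono) auto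
    then show ?thesis using close[of n] by simp
  qed
  have "summable (\<lambda>n. a (Suc n) - a n)"
  proof (rule summable_comparison_test)
    have "norm (a (Suc n) - a n) \<le> 5 * E * (1/4)^n" for n
    proof -
      have "norm (a n) \<le> 2" using close'[of n] f(3) E01 norm_triangle_sub[of "a n" f] by linarith
      then have "norm (a (Suc n) - a n) \<le> (1 + 2 * 2) * (E * (1/4)^n)"
        by (intro order_trans[OF step mult_mono] ne) auto
      then show ?thesis by simp
    qed
    then show "\<exists>N. \<forall>n\<ge>N. norm (a (Suc n) - a n) \<le> 5 * E * (1/4)^n" by blast
    show "summable (\<lambda>n. 5 * E * (1/4)^n)" by (intro summable_mult summable_geometric) auto
  qed
  then have "(\<lambda>n. \<Sum>i<n. a (Suc i) - a i) \<longlonglongrightarrow> (\<Sum>i. a (Suc i) - a i)"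
    by (rule summable_LIMSEQ)
  then have "(\<lambda>n. (a n - a 0) + a 0) \<longlonglongrightarrow> (\<Sum>i. a (Suc i) - a i) + a 0"
    unfolding sum_lessThan_telescope by (intro tendsto_intros)
  then obtain q where q: "a \<longlonglongrightarrow> q" by auto
  show ?thesis
  proof
    show "q \<in> A" using closed_sequentially[OF cl, of a q] aA q by blast
    have "star q = q"
      using closed_sequentially[OF closed_selfadjoint, of a q] aA q by blast
    moreover have "q * q = q"
    proof -
      have "(\<lambda>n. E * (1/4)^n) \<longlonglongrightarrow> E * 0" by (intro tendsto_intros LIMSEQ_power_zero) auto
      then have "(\<lambda>n. E * (1/4)^n) \<longlonglongrightarrow> 0" by simp
      then have "e \<longlonglongrightarrow> 0" by (rule Lim_null_comparison[rotated]) (simp add: ne)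
      moreover have "e \<longlonglongrightarrow> q * q - q" unfolding e_def by (intro tendsto_intros q)
      ultimately show ?thesis using LIMSEQ_unique by force
    qed
    ultimately show "is_projection q" by (simp add: is_projection_def)
    have "(\<lambda>n. a n * f) \<longlonglongrightarrow> q * f" "(\<lambda>n. f * a n) \<longlonglongrightarrow> f * q" by (intro tendsto_intros q)+
    then show "q * f = f * q" using aA LIMSEQ_unique by fastforce
    have "(\<lambda>n. norm (a n - f)) \<longlonglongrightarrow> norm (q - f)" by (intro tendsto_intros q)
    then show "norm (q - f) \<le> 7 * norm (f * f - f)"
      using close' by (intro LIMSEQ_le_const2) (auto simp: E_def)
  qed
qed

lemma symmetry_defect_norm_le:
  fixes q f :: "'a::cstar_algebra"
  assumes "is_projection q" "q * f = f * q"
  shows "norm (q + f - 2 *\<^sub>R (f * q)) \<le> (norm (q - f))\<^sup>2 + norm (f * f - f)"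
proof -
  have "q + f - 2 *\<^sub>R (f * q) = (q - f) * (q - f) - (f * f - f)"
    using assms by (simp add: is_projection_def algebra_simps flip: scaleR_add_left)
      (metis scaleR_2)
  then have "norm (q + f - 2 *\<^sub>R (f * q)) \<le> norm ((q - f) * (q - f)) + norm (f * f - f)"
    by (metis norm_triangle_ineq4)
  also have "norm ((q - f) * (q - f)) \<le> (norm (q - f))\<^sup>2"
    by (metis norm_mult_ineq power2_eq_square)
  finally show ?thesis by simp
qed

section \<open>Calculus of \<open>C\<^sup>k\<close> functions\<close>

text \<open>\<open>Ck_on\<close> speaks about total functions, and \<open>frechet_derivative\<close>
  is a choice operator. Openness makes the derivative at a point of \<open>S\<close> independent of
  values off \<open>S\<close>, and uniqueness identifies the chosen derivatives.\<close>

lemma Ck_on_cong: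
  assumes "open S" "\<And>x. x \<in> S \<Longrightarrow> f x = g x" "Ck_on k S f"
  shows "Ck_on k S g"
  using assms(2,3)
proof (induction k arbitrary: f g)
  case 0
  then show ?case by (auto cong: continuous_on_cong)
next
  case (Suc k)
  have der: "(g has_derivative frechet_derivative f (at x)) (at x)" if "x \<in> S" for x
    using Suc.prems that \<open>open S\<close> has_derivative_transform_within_open[of f _ x UNIV S g]
    by (auto simp: frechet_derivative_works)
  have eq: "frechet_derivative f (at x) = frechet_derivative g (at x)" if "x \<in> S" for x
    using der[OF that] by (rule frechet_derivative_at)
  have "Ck_on k S (\<lambda>x. frechet_derivative g (at x) v)" for v
    by (rule Suc.IH[of "\<lambda>x. frechet_derivative f (at x) v"]) (use Suc.prems eq in auto)
  then show ?case using der by (auto simp: differentiable_def)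
qed

lemma Ck_on_subset: "Ck_on k S f \<Longrightarrow> T \<subseteq> S \<Longrightarrow> Ck_on k T f"
  by (induction k arbitrary: f) (auto intro: continuous_on_subset)

lemma Ck_on_local:
  assumes "\<And>x. x \<in> S \<Longrightarrow> \<exists>T. open T \<and> x \<in> T \<and> Ck_on k T f"
  shows "Ck_on k S f"
  using assms
proof (induction k arbitrary: f)
  case 0
  then show ?case
    by (auto intro!: continuous_at_imp_continuous_on) (meson continuous_on_eq_continuous_at)
next
  case (Suc k)
  have "Ck_on k S (\<lambda>x. frechet_derivative f (at x) v)" for v
    using Suc.prems by (intro Suc.IH) fastforce
  then show ?case using Suc.prems by fastforce
qed

text \<open>The introduction rule for all the calculus below: any formula for the derivative will
  do, because it must agree with \<open>frechet_derivative\<close> on the open set.\<close>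

lemma Ck_on_SucI:
  assumes "open S" "\<And>x. x \<in> S \<Longrightarrow> (f has_derivative D x) (at x)" "\<And>v. Ck_on k S (\<lambda>x. D x v)"
  shows "Ck_on (Suc k) S f"
proof -
  have "D x = frechet_derivative f (at x)" if "x \<in> S" for x
    using assms(2)[OF that] by (rule frechet_derivative_at)
  then have "Ck_on k S (\<lambda>x. frechet_derivative f (at x) v)" for v
    by (intro Ck_on_cong[OF assms(1) _ assms(3)[of v]]) simp
  then show ?thesis using assms(2) by (auto simp: differentiable_def)
qed

lemma Ck_on_SucD:
  assumes "Ck_on (Suc k) S f"
  shows "x \<in> S \<Longrightarrow> (f has_derivative frechet_derivative f (at x)) (at x)"
    and "Ck_on k S (\<lambda>x. frechet_derivative f (at x) v)"
  using assms by (auto simp: frechet_derivative_works)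

lemma Ck_on_Suc_imp: "Ck_on (Suc k) S f \<Longrightarrow> Ck_on k S f"
proof (induction k arbitrary: f)
  case 0
  then show ?case
    by (auto intro!: continuous_at_imp_continuous_on differentiable_imp_continuous_within)
next
  case (Suc k)
  have "Ck_on k S (\<lambda>x. frechet_derivative f (at x) v)" for v
    by (rule Suc.IH) (use Suc.prems in simp)
  then show ?case using Suc.prems by simp
qed

lemma Ck_on_imp_continuous_on: "Ck_on k S f \<Longrightarrow> continuous_on S f"
  by (induction k) (auto dest: Ck_on_Suc_imp simp del: Ck_on.simps(2))

lemma Ck_on_const: "Ck_on k S (\<lambda>x. c)"
  by (induction k arbitrary: c) auto

lemma Ck_on_bounded_linear:
  assumes "open S" "bounded_linear h" "Ck_on k S f"
  shows "Ck_on k S (\<lambda>x. h (f x))"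
  using assms(3)
proof (induction k arbitrary: f)
  case 0
  then show ?case by (auto intro: bounded_linear.continuous_on[OF assms(2)])
next
  case (Suc k)
  show ?case
    by (rule Ck_on_SucI[OF assms(1) bounded_linear.has_derivative[OF assms(2) Ck_on_SucD(1)[OF Suc.prems]]])
      (auto intro: Suc.IH Ck_on_SucD(2)[OF Suc.prems])
qed

lemma Ck_on_id: "Ck_on k S (\<lambda>x. x)"
  by (cases k) (auto intro: continuous_on_id Ck_on_const)

lemma Ck_on_add:
  assumes "open S" "Ck_on k S f" "Ck_on k S g"
  shows "Ck_on k S (\<lambda>x. f x + g x)"
  using assms(2,3)
proof (induction k arbitrary: f g)
  case 0
  then show ?case by (auto intro: continuous_on_add)
next
  case (Suc k)
  show ?case
    by (rule Ck_on_SucI[OF assms(1) has_derivative_add[OF Ck_on_SucD(1)[OF Suc.prems(1)] Ck_on_SucD(1)[OF Suc.prems(2)]]])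
      (auto intro: Suc.IH Ck_on_SucD(2)[OF Suc.prems(1)] Ck_on_SucD(2)[OF Suc.prems(2)])
qed

text \<open>The product rule gives a sum of two expressions of the same bilinear form, one order
  lower; multiplication, scaling and the inner product are covered at once.\<close>

lemma Ck_on_bounded_bilinear:
  assumes "open S" "bounded_bilinear b" "Ck_on k S f" "Ck_on k S g"
  shows "Ck_on k S (\<lambda>x. b (f x) (g x))"
  using assms(3,4)
proof (induction k arbitrary: f g)
  case 0
  then show ?case by (auto intro: bounded_bilinear.continuous_on[OF assms(2)])
next
  case (Suc k)
  show ?case
    by (rule Ck_on_SucI[OF assms(1) bounded_bilinear.FDERIV[OF assms(2) Ck_on_SucD(1)[OF Suc.prems(1)] Ck_on_SucD(1)[OF Suc.prems(2)]]])
      (auto intro!: Ck_on_add[OF assms(1)] Suc.IH Ck_on_SucD(2)[OF Suc.prems(1)] Ck_on_SucD(2)[OF Suc.prems(2)]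
          Ck_on_Suc_imp[OF Suc.prems(1)] Ck_on_Suc_imp[OF Suc.prems(2)])
qed

lemmas Ck_on_mult = Ck_on_bounded_bilinear[OF _ bounded_bilinear_mult]
lemmas Ck_on_scaleR = Ck_on_bounded_bilinear[OF _ bounded_bilinear_scaleR]
lemmas Ck_on_inner = Ck_on_bounded_bilinear[OF _ bounded_bilinear_inner]

lemma Ck_on_scaleR_const: "open S \<Longrightarrow> Ck_on k S f \<Longrightarrow> Ck_on k S (\<lambda>x. c *\<^sub>R f x)"
  by (rule Ck_on_bounded_linear[OF _ bounded_linear_scaleR_right])

lemma Ck_on_minus: "open S \<Longrightarrow> Ck_on k S f \<Longrightarrow> Ck_on k S (\<lambda>x. - f x)"
  using Ck_on_bounded_linear[OF _ bounded_linear_minus[OF bounded_linear_ident]] .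

lemma Ck_on_diff: "open S \<Longrightarrow> Ck_on k S f \<Longrightarrow> Ck_on k S g \<Longrightarrow> Ck_on k S (\<lambda>x. f x - g x)"
  using Ck_on_add[of S k f "\<lambda>x. - g x"] Ck_on_minus by fastforce

lemma Ck_on_sum:
  assumes "open S" "\<And>i. i \<in> I \<Longrightarrow> Ck_on k S (f i)"
  shows "Ck_on k S (\<lambda>x. \<Sum>i\<in>I. f i x)"
  using assms(2)
  by (induction I rule: infinite_finite_induct) (auto intro: Ck_on_const Ck_on_add[OF assms(1)])

text \<open>A bootstrap: the derivative is a product of \<open>f'\<close> and the inverse itself,
  which the induction hypothesis already knows to be of class k. The Sylvester solution and the
  projection are treated by the same pattern.\<close>

lemma Ck_on_inverse:
  fixes f :: "'e::euclidean_space \<Rightarrow> real"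
  assumes "open S" "\<And>x. x \<in> S \<Longrightarrow> f x \<noteq> 0" "Ck_on k S f"
  shows "Ck_on k S (\<lambda>x. inverse (f x))"
  using assms(3)
proof (induction k)
  case 0
  then show ?case using assms(2) by (auto intro: continuous_on_inverse)
next
  case (Suc k)
  have 1: "Ck_on k S (\<lambda>x. inverse (f x))" using Suc Ck_on_Suc_imp by blast
  show ?case
    by (rule Ck_on_SucI[OF assms(1) Deriv.has_derivative_inverse[OF assms(2) Ck_on_SucD(1)[OF Suc.prems]]])
      (use 1 in \<open>auto intro!: Ck_on_minus Ck_on_mult Ck_on_SucD(2)[OF Suc.prems] assms(1)\<close>)
qed

text \<open>\<open>Ck_on\<close> controls derivatives in fixed directions, whereas the chain rule
  evaluates \<open>h'\<close> on the moving vector \<open>f'(x) v\<close>. Expanding that vector in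
  the basis leaves fixed directions for \<open>h\<close> and scalar coefficients of class k.\<close>

lemma Ck_on_compose:
  fixes f :: "'e::euclidean_space \<Rightarrow> 'f::euclidean_space"
  assumes "open S" "open T" "f ` S \<subseteq> T" "Ck_on k S f" "Ck_on k T h"
  shows "Ck_on k S (\<lambda>x. h (f x))"
  using assms(4,5)
proof (induction k arbitrary: h)
  case 0
  then show ?case using assms(3) by (auto intro: continuous_on_compose2)
next
  case (Suc k)
  have f: "Ck_on k S f" by (rule Ck_on_Suc_imp[OF Suc.prems(1)])
  have D: "((\<lambda>x. h (f x)) has_derivative
      (\<lambda>v. \<Sum>b\<in>Basis. (frechet_derivative f (at x) v \<bullet> b) *\<^sub>R frechet_derivative h (at (f x)) b)) (at x)"
    if "x \<in> S" for x
  proof -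
    have h: "(h has_derivative frechet_derivative h (at (f x))) (at (f x))"
      using that assms(3) by (intro Ck_on_SucD(1)[OF Suc.prems(2)]) auto
    then have lin: "linear (frechet_derivative h (at (f x)))" by (rule has_derivative_linear)
    have comp: "((\<lambda>x. h (f x)) has_derivative (\<lambda>v. frechet_derivative h (at (f x)) (frechet_derivative f (at x) v))) (at x)"
      using diff_chain_at[OF Ck_on_SucD(1)[OF Suc.prems(1) that] h] by (simp add: o_def)
    have rep: "frechet_derivative h (at (f x)) w = (\<Sum>b\<in>Basis. (w \<bullet> b) *\<^sub>R frechet_derivative h (at (f x)) b)" for w
      using euclidean_representation[of w] linear_sum[OF lin] linear_scale[OF lin]
      by (metis (mono_tags, lifting) sum.cong)
    show ?thesis using comp by (simp only: rep[symmetric])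
  qed
  show ?case
    by (rule Ck_on_SucI[OF assms(1) D])
      (auto intro!: Ck_on_sum Ck_on_scaleR Ck_on_inner Ck_on_const assms(1) Suc.IH f
        Ck_on_SucD(2)[OF Suc.prems(1)] Ck_on_SucD(2)[OF Suc.prems(2)])
qed

section \<open>Smoothness of the projection\<close>

text \<open>The solution \<open>z\<close> of \<open>z - m z - z m = h\<close>; it is unique when \<open>m\<close> is small.\<close>

definition sylvester_inv :: "'a::{real_normed_algebra,banach} \<Rightarrow> 'a \<Rightarrow> 'a" where
  "sylvester_inv m h = (THE z. h + m * z + z * m = z)"

text \<open>The map is a contraction with factor \<open>1/8 + 1/8\<close>, one summand for each side
  on which \<open>m\<close> multiplies.\<close>

lemma sylvester_unique:
  fixes m h :: "'a::{real_normed_algebra,banach}"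
  assumes "norm m \<le> 1/8"
  shows "\<exists>!z. h + m * z + z * m = z"
proof (rule banach_fix_type[of "1/4"])
  show "\<forall>x y. dist (h + m * x + x * m) (h + m * y + y * m) \<le> 1/4 * dist x y"
  proof (intro allI)
    fix x y
    have "norm (m * (x - y) + (x - y) * m) \<le> norm m * norm (x - y) + norm (x - y) * norm m"
      by (meson add_mono norm_mult_ineq norm_triangle_le)
    also have "\<dots> \<le> (1/8) * norm (x - y) + norm (x - y) * (1/8)"
      by (intro add_mono mult_mono assms) auto
    also have "m * (x - y) + (x - y) * m = (h + m * x + x * m) - (h + m * y + y * m)"
      by (simp add: algebra_simps)
    finally show "dist (h + m * x + x * m) (h + m * y + y * m) \<le> 1/4 * dist x y"
      by (simp add: dist_norm)
  qed
qed auto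

lemma sylvester_inv_eq:
  assumes "norm m \<le> 1/8"
  shows "sylvester_inv m h - m * sylvester_inv m h - sylvester_inv m h * m = h"
proof -
  have "h + m * sylvester_inv m h + sylvester_inv m h * m = sylvester_inv m h"
    unfolding sylvester_inv_def by (rule theI'[OF sylvester_unique[OF assms]])
  then show ?thesis by (simp add: algebra_simps)
qed

lemma sylvester_inv_eqI:
  assumes "norm m \<le> 1/8" "z - m * z - z * m = h"
  shows "sylvester_inv m h = z"
  unfolding sylvester_inv_def
  by (rule the1_equality[OF sylvester_unique[OF assms(1)]])
    (use assms(2) in \<open>simp add: algebra_simps\<close>)

lemma sylvester_norm_le2:
  fixes z :: "'a::real_normed_algebra"
  assumes "norm m \<le> 1/8" "norm n \<le> 1/8"
  shows "norm z \<le> 2 * norm (z - m * z - z * n)"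
proof -
  have "(1/2) * norm z \<le> (1 - norm m - norm n) * norm z"
    using assms by (intro mult_right_mono) auto
  also have "\<dots> \<le> norm (z - m * z - z * n)" by (rule sylvester_norm_le)
  finally show ?thesis by simp
qed

lemma bounded_linear_sylvester_inv:
  assumes m: "norm m \<le> 1/8"
  shows "bounded_linear (sylvester_inv m)"
proof (rule bounded_linear_intro[where K=2])
  note e = sylvester_inv_eq[OF m]
  fix x y r
  show "sylvester_inv m (x + y) = sylvester_inv m x + sylvester_inv m y"
  proof (rule sylvester_inv_eqI[OF m])
    let ?X = "sylvester_inv m x" and ?Y = "sylvester_inv m y"
    have "?X + ?Y - m * (?X + ?Y) - (?X + ?Y) * m = (?X - m * ?X - ?X * m) + (?Y - m * ?Y - ?Y * m)"
      by (simp add: algebra_simps)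
    then show "?X + ?Y - m * (?X + ?Y) - (?X + ?Y) * m = x + y" by (simp only: e)
  qed
  show "sylvester_inv m (r *\<^sub>R x) = r *\<^sub>R sylvester_inv m x"
    by (rule sylvester_inv_eqI[OF m]) (metis e mult_scaleR_left mult_scaleR_right scaleR_diff_right)
  show "norm (sylvester_inv m x) \<le> norm x * 2"
    using sylvester_norm_le2[OF m m, of "sylvester_inv m x"] e[of x] by simp
qed

text \<open>A product of a null function and a function of linear growth; the projections \<open>q\<close> are only
  known to be Lipschitz when their differentiability is shown.\<close>

lemma has_derivative_mult_vanishing:
  fixes f :: "'e::real_normed_vector \<Rightarrow> 'b::real_normed_vector" and c d :: "'e \<Rightarrow> 'a::real_normed_algebra"
  assumes f: "(f has_derivative f') (at x)" "f x = 0"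
    and d: "\<And>y. norm (d y) \<le> K * norm (f y)"
    and c: "(c \<longlongrightarrow> 0) (at x)"
  shows "((\<lambda>y. c y * d y) has_derivative (\<lambda>v. 0)) (at x)"
    and "((\<lambda>y. d y * c y) has_derivative (\<lambda>v. 0)) (at x)"
proof -
  have bl: "bounded_linear f'" and lim: "((\<lambda>y. norm ((f y - f x) - f' (y - x)) / norm (y - x)) \<longlongrightarrow> 0) (at x)"
    using f(1) by (auto simp: has_derivative_iff_norm)
  obtain B where B: "\<And>v. norm (f' v) \<le> norm v * B" using bounded_linear.bounded[OF bl] by blast
  have dx: "d x = 0" using d[of x] f(2) by simp
  define H where "H y = norm (c y) * (\<bar>K\<bar> * (norm ((f y - f x) - f' (y - x)) / norm (y - x) + B))" for y
  have le: "norm (c y) * norm (d y) / norm (y - x) \<le> H y" if "y \<noteq> x" for y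
  proof -
    have "norm (d y) \<le> \<bar>K\<bar> * norm (f y)" by (rule order_trans[OF d]) (simp add: mult_right_mono)
    also have "norm (f y) \<le> norm ((f y - f x) - f' (y - x)) + norm (y - x) * B"
      using norm_triangle_sub[of "f y" "f' (y - x)"] B[of "y - x"] by (simp add: f(2))
    finally have "norm (d y) \<le> \<bar>K\<bar> * (norm ((f y - f x) - f' (y - x)) + norm (y - x) * B)"
      by (simp add: mult_left_mono)
    then have "norm (d y) / norm (y - x) \<le> \<bar>K\<bar> * (norm ((f y - f x) - f' (y - x)) + norm (y - x) * B) / norm (y - x)"
      by (simp add: divide_right_mono)
    also have "\<dots> = \<bar>K\<bar> * (norm ((f y - f x) - f' (y - x)) / norm (y - x) + B)"
      using that by (simp add: field_simps)
    finally show ?thesis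
      unfolding H_def times_divide_eq_right[symmetric] by (rule mult_left_mono) simp
  qed
  have H0: "(H \<longlongrightarrow> 0) (at x)"
  proof -
    have "(H \<longlongrightarrow> norm (0::'a) * (\<bar>K\<bar> * (0 + B))) (at x)"
      unfolding H_def by (intro tendsto_intros c lim)
    then show ?thesis by simp
  qed
  show "((\<lambda>y. c y * d y) has_derivative (\<lambda>v. 0)) (at x)"
  proof (rule has_derivativeI_sandwich[of 1, OF _ _ _ H0])
    fix y assume "y \<noteq> x"
    have "norm (c y * d y) / norm (y - x) \<le> norm (c y) * norm (d y) / norm (y - x)"
      by (intro divide_right_mono norm_mult_ineq) auto
    with le[OF \<open>y \<noteq> x\<close>] show "norm (c y * d y - c x * d x - 0) / norm (y - x) \<le> H y" by (simp add: dx)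
  qed auto
  show "((\<lambda>y. d y * c y) has_derivative (\<lambda>v. 0)) (at x)"
  proof (rule has_derivativeI_sandwich[of 1, OF _ _ _ H0])
    fix y assume "y \<noteq> x"
    have "norm (d y * c y) / norm (y - x) \<le> norm (c y) * norm (d y) / norm (y - x)"
      using norm_mult_ineq[of "d y" "c y"] by (intro divide_right_mono) (auto simp: mult.commute)
    with le[OF \<open>y \<noteq> x\<close>] show "norm (d y * c y - d x * c x - 0) / norm (y - x) \<le> H y" by (simp add: dx)
  qed auto
qed

text \<open>A product rule in which one factor is merely continuous: as \<open>f\<close> vanishes at
  \<open>x\<close>, the remainder \<open>(c y - c x) * f y\<close> is of higher order.\<close>

lemma has_derivative_mult_zero:
  fixes f c :: "'e::real_normed_vector \<Rightarrow> 'a::real_normed_algebra"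
  assumes f: "(f has_derivative f') (at x)" "f x = 0" and c: "isCont c x"
  shows "((\<lambda>y. c y * f y) has_derivative (\<lambda>v. c x * f' v)) (at x)"
    and "((\<lambda>y. f y * c y) has_derivative (\<lambda>v. f' v * c x)) (at x)"
proof -
  have c0: "((\<lambda>y. c y - c x) \<longlongrightarrow> 0) (at x)"
    using c by (simp add: isCont_def LIM_zero)
  note z = has_derivative_mult_vanishing[OF f, of f 1, simplified, OF c0]
  show "((\<lambda>y. c y * f y) has_derivative (\<lambda>v. c x * f' v)) (at x)"
    using has_derivative_add[OF z(1) has_derivative_mult_right[OF f(1), of "c x"]]
    by (simp add: algebra_simps)
  show "((\<lambda>y. f y * c y) has_derivative (\<lambda>v. f' v * c x)) (at x)"
    using has_derivative_add[OF z(2) has_derivative_mult_left[OF f(1), of "c x"]]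
    by (simp add: algebra_simps)
qed

text \<open>The difference \<open>z y - z x\<close> solves the equation with coefficient
  \<open>m y\<close> and right-hand side \<open>R y\<close>, which tends to 0; the norm bound with
  factor 2 is uniform in the coefficient.\<close>

lemma isCont_sylvester_inv:
  fixes m h :: "'e::real_normed_vector \<Rightarrow> 'a::{real_normed_algebra,banach}"
  assumes S: "open S" "x \<in> S" and m: "\<And>y. y \<in> S \<Longrightarrow> norm (m y) \<le> 1/8"
    and cont: "isCont m x" "isCont h x"
  shows "isCont (\<lambda>y. sylvester_inv (m y) (h y)) x"
proof -
  define z where "z y = sylvester_inv (m y) (h y)" for y
  define R where "R y = (h y - h x) + (m y - m x) * z x + z x * (m y - m x)" for y
  have le: "norm (z y - z x) \<le> 2 * norm (R y)" if "y \<in> S" for y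
  proof -
    have "(z y - z x) - m y * (z y - z x) - (z y - z x) * m y = (z y - m y * z y - z y * m y)
        - (z x - m x * z x - z x * m x) + (m y - m x) * z x + z x * (m y - m x)"
      by (simp add: algebra_simps)
    also have "\<dots> = R y"
      unfolding R_def z_def by (simp only: sylvester_inv_eq[OF m[OF that]] sylvester_inv_eq[OF m[OF S(2)]])
    finally have "(z y - z x) - m y * (z y - z x) - (z y - z x) * m y = R y" .
    then show ?thesis using sylvester_norm_le2[OF m[OF that] m[OF that]] by metis
  qed
  have "isCont R x" unfolding R_def by (intro continuous_intros cont)
  then have "((\<lambda>y. 2 * norm (R y)) \<longlongrightarrow> 2 * norm (R x)) (at x)"
    unfolding isCont_def by (intro tendsto_intros)
  then have "((\<lambda>y. 2 * norm (R y)) \<longlongrightarrow> 0) (at x)" by (simp add: R_def)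
  then have "((\<lambda>y. z y - z x) \<longlongrightarrow> 0) (at x)"
    by (rule Lim_null_comparison[rotated])
      (use le S in \<open>auto simp: eventually_at_topological\<close>)
  then show ?thesis unfolding z_def isCont_def by (rule LIM_zero_cancel)
qed

text \<open>Here the coefficient is frozen at \<open>x\<close>, so that one fixed bounded linear map
  is applied to \<open>R\<close>. The unknown \<open>z y\<close> then occurs in \<open>R\<close>
  only next to \<open>m y - m x\<close>, which vanishes at \<open>x\<close>, so continuity of
  \<open>z\<close> is enough to differentiate \<open>R\<close>.\<close>

lemma has_derivative_sylvester_inv:
  fixes m h :: "'e::real_normed_vector \<Rightarrow> 'a::{real_normed_algebra,banach}"
  assumes S: "open S" "x \<in> S" and m: "\<And>y. y \<in> S \<Longrightarrow> norm (m y) \<le> 1/8"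
    and der: "(m has_derivative m') (at x)" "(h has_derivative h') (at x)"
  defines "z \<equiv> \<lambda>y. sylvester_inv (m y) (h y)"
  shows "(z has_derivative (\<lambda>v. sylvester_inv (m x) (h' v + m' v * z x + z x * m' v))) (at x)"
proof -
  have cz: "isCont z x"
    unfolding z_def using der by (intro isCont_sylvester_inv[OF S m] has_derivative_continuous)
  have m0: "((\<lambda>y. m y - m x) has_derivative m') (at x)"
    using has_derivative_diff[OF der(1) has_derivative_const] by simp
  have h0: "((\<lambda>y. h y - h x) has_derivative h') (at x)"
    using has_derivative_diff[OF der(2) has_derivative_const] by simp
  define R where "R y = (h y - h x) + (m y - m x) * z y + z y * (m y - m x)" for y
  have "(R has_derivative (\<lambda>v. h' v + m' v * z x + z x * m' v)) (at x)"
    unfolding R_def by (intro has_derivative_add h0 has_derivative_mult_zero m0 cz) auto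
  from bounded_linear.has_derivative[OF bounded_linear_sylvester_inv[OF m[OF S(2)]] this]
  have "((\<lambda>y. z x + sylvester_inv (m x) (R y)) has_derivative
      (\<lambda>v. 0 + sylvester_inv (m x) (h' v + m' v * z x + z x * m' v))) (at x)"
    by (intro has_derivative_add has_derivative_const)
  moreover have "z x + sylvester_inv (m x) (R y) = z y" if "y \<in> S" for y
  proof -
    have "(z y - z x) - m x * (z y - z x) - (z y - z x) * m x = (z y - m y * z y - z y * m y)
        - (z x - m x * z x - z x * m x) + (m y - m x) * z y + z y * (m y - m x)"
      by (simp add: algebra_simps)
    also have "\<dots> = R y"
      unfolding R_def z_def by (simp only: sylvester_inv_eq[OF m[OF that]] sylvester_inv_eq[OF m[OF S(2)]])
    finally have "sylvester_inv (m x) (R y) = z y - z x"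
      by (rule sylvester_inv_eqI[OF m[OF S(2)]])
    then show ?thesis by simp
  qed
  ultimately show ?thesis
    using has_derivative_transform_within_open[OF _ S] by fastforce
qed

text \<open>The derivative is again \<open>sylvester_inv (m x)\<close>, applied to data built from
  \<open>h'\<close>, \<open>m'\<close> and the solution. The solution is of class k by the induction
  hypothesis, which is why \<open>h\<close> must be arbitrary there.\<close>

lemma Ck_on_sylvester_inv:
  fixes m h :: "'e::euclidean_space \<Rightarrow> 'a::{real_normed_algebra,banach}"
  assumes S: "open S" and m: "\<And>y. y \<in> S \<Longrightarrow> norm (m y) \<le> 1/8"
    and "Ck_on k S m" "Ck_on k S h"
  shows "Ck_on k S (\<lambda>y. sylvester_inv (m y) (h y))"
  using assms(3,4)
proof (induction k arbitrary: h)
  case 0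
  then have "isCont (\<lambda>y. sylvester_inv (m y) (h y)) x" if "x \<in> S" for x
    using that S by (intro isCont_sylvester_inv[OF S that m]) (auto simp: continuous_on_eq_continuous_at)
  then show ?case by (simp add: continuous_at_imp_continuous_on)
next
  case (Suc k)
  note m' = Ck_on_Suc_imp[OF Suc.prems(1)] and h' = Ck_on_Suc_imp[OF Suc.prems(2)]
  show ?case
    by (rule Ck_on_SucI[OF S has_derivative_sylvester_inv[OF S _ m Ck_on_SucD(1)[OF Suc.prems(1)] Ck_on_SucD(1)[OF Suc.prems(2)]]])
      (auto intro!: Suc.IH m' Ck_on_add Ck_on_mult S h' Ck_on_SucD(2)[OF Suc.prems(1)] Ck_on_SucD(2)[OF Suc.prems(2)])
qed

lemma norm_projection_diff_le2:
  fixes q r f h :: "'a::cstar_algebra"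
  assumes "is_projection q" "is_projection r" "q * f = f * q" "r * h = h * r"
    and "norm (q + f - 2 *\<^sub>R (f * q)) \<le> 1/8" "norm (r + h - 2 *\<^sub>R (h * r)) \<le> 1/8"
  shows "norm (r - q) \<le> 2 * norm (h - f)"
proof -
  have "3 * norm (r - q) \<le> 4 * norm (h - f)" using norm_projection_diff_le[OF assms] by simp
  then show ?thesis using norm_ge_zero[of "h - f"] by linarith
qed

text \<open>Continuity comes from the Lipschitz dependence of \<open>q\<close> on \<open>f\<close>.
  From then on the argument is a bootstrap: if \<open>q\<close> is of class k, so is
  \<open>M\<close>, and the derivative of \<open>q\<close> is a Sylvester solution whose data are of
  class k.\<close>

lemma Ck_on_commuting_projection:
  fixes f q :: "'e::euclidean_space \<Rightarrow> 'a::cstar_algebra"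
  assumes S: "open S" and q: "\<And>y. y \<in> S \<Longrightarrow> is_projection (q y)" "\<And>y. y \<in> S \<Longrightarrow> q y * f y = f y * q y"
    and m: "\<And>y. y \<in> S \<Longrightarrow> norm (q y + f y - 2 *\<^sub>R (f y * q y)) \<le> 1/8"
    and "Ck_on k S f"
  shows "Ck_on k S q"
  using assms(5)
proof (induction k)
  case 0
  have "isCont q x" if "x \<in> S" for x
  proof -
    have cf: "isCont f x" using 0 that S by (simp add: continuous_on_eq_continuous_at)
    have "((\<lambda>y. q y - q x) \<longlongrightarrow> 0) (at x)"
    proof (rule Lim_null_comparison)
      have "norm (q y - q x) \<le> 2 * norm (f y - f x)" if "y \<in> S" for y
        using q m that \<open>x \<in> S\<close> by (intro norm_projection_diff_le2)
      then show "\<forall>\<^sub>F y in at x. norm (q y - q x) \<le> 2 * norm (f y - f x)"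
        using S that unfolding eventually_at_topological by blast
      show "((\<lambda>y. 2 * norm (f y - f x)) \<longlongrightarrow> 0) (at x)"
        using cf by (intro tendsto_mult_right_zero tendsto_norm_zero LIM_zero) (simp add: isCont_def)
    qed
    then show ?thesis unfolding isCont_def by (rule LIM_zero_cancel)
  qed
  then show ?case by (simp add: continuous_at_imp_continuous_on)
next
  case (Suc k)
  define M where "M y = q y + f y - 2 *\<^sub>R (f y * q y)" for y
  have f: "Ck_on k S f" by (rule Ck_on_Suc_imp[OF Suc.prems])
  then have qk: "Ck_on k S q" by (rule Suc.IH)
  have Mk: "Ck_on k S M" unfolding M_def
    by (intro Ck_on_add Ck_on_diff Ck_on_scaleR_const Ck_on_mult S f qk)
  have der: "(q has_derivative (\<lambda>v. sylvester_inv (M x) (q x * frechet_derivative f (at x) v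
      + frechet_derivative f (at x) v * q x - 2 *\<^sub>R (q x * frechet_derivative f (at x) v * q x)))) (at x)"
    (is "(q has_derivative (\<lambda>v. sylvester_inv _ (?h v))) _") if x: "x \<in> S" for x
  proof -
    define D where "D y = f y - f x" for y
    \<comment> \<open>The equation for \<open>q y - q x\<close> has the coefficient
      \<open>M y\<close> on the left and \<open>M x\<close> on the right. Freezing both at
      \<open>x\<close> moves \<open>(M y - M x) * (q y - q x)\<close> to the right-hand side: a null
      function times one bounded by \<open>2 * norm (D y)\<close>. The conditional is there because
      nothing is known about \<open>q\<close> off \<open>S\<close>, while that bound is required at
      every \<open>y\<close>.\<close>
    define R where "R y = (q y * D y + D y * q x - 2 *\<^sub>R (q y * (D y * q x))) + (if y \<in> S then (M y - M x) * (q y - q x) else 0)" for y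
    have D: "(D has_derivative frechet_derivative f (at x)) (at x)" "D x = 0"
      using has_derivative_diff[OF Ck_on_SucD(1)[OF Suc.prems x] has_derivative_const]
      by (auto simp: D_def[abs_def])
    have cq: "isCont q x" and cM: "isCont M x"
      using Ck_on_imp_continuous_on[OF qk] Ck_on_imp_continuous_on[OF Mk] S x
      by (auto simp: continuous_on_eq_continuous_at)
    have "((\<lambda>y. (M y - M x) * (if y \<in> S then q y - q x else 0)) has_derivative (\<lambda>v. 0)) (at x)"
    proof (rule has_derivative_mult_vanishing(1)[OF D, where K=2])
      show "norm (if y \<in> S then q y - q x else 0) \<le> 2 * norm (D y)" for y
        using norm_projection_diff_le2[of "q x" "q y" "f x" "f y"] q m x by (simp add: D_def)
      show "((\<lambda>y. M y - M x) \<longlongrightarrow> 0) (at x)" using cM by (intro LIM_zero) (simp add: isCont_def)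
    qed
    moreover have "((\<lambda>y. q y * D y + D y * q x - 2 *\<^sub>R (q y * (D y * q x))) has_derivative ?h) (at x)"
    proof -
      have "((\<lambda>y. D y * q x) has_derivative (\<lambda>v. frechet_derivative f (at x) v * q x)) (at x)"
        by (intro has_derivative_mult_left D)
      then have prod: "((\<lambda>y. q y * (D y * q x)) has_derivative (\<lambda>v. q x * (frechet_derivative f (at x) v * q x))) (at x)"
        by (rule has_derivative_mult_zero(1)[OF _ _ cq]) (insert D(2), simp only: D_def mult_zero_left diff_self)
      show ?thesis
        unfolding mult.assoc
        by (intro has_derivative_diff has_derivative_add has_derivative_mult_zero(1)[OF D cq]
          has_derivative_mult_left D has_derivative_scaleR_right prod)
    qed
    ultimately have "(R has_derivative (\<lambda>v. ?h v + 0)) (at x)"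
      unfolding R_def by (intro has_derivative_add) (auto simp: if_distrib cong: if_cong)
    then have "((\<lambda>y. q x + sylvester_inv (M x) (R y)) has_derivative (\<lambda>v. 0 + sylvester_inv (M x) (?h v + 0))) (at x)"
      by (intro has_derivative_add has_derivative_const bounded_linear.has_derivative[OF bounded_linear_sylvester_inv])
        (use m[OF x] in \<open>simp_all add: M_def\<close>)
    moreover have "q x + sylvester_inv (M x) (R y) = q y" if y: "y \<in> S" for y
    proof -
      have "(q y - q x) - M y * (q y - q x) - (q y - q x) * M x = q y * D y + D y * q x - 2 *\<^sub>R (q y * D y * q x)"
        unfolding M_def D_def using q[OF x] q[OF y]
        by (intro projection_diff_identity) (auto simp: is_projection_def)
      then have "sylvester_inv (M x) (R y) = q y - q x"
        using m[OF x] y by (intro sylvester_inv_eqI) (auto simp: R_def M_def[of x] algebra_simps)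
      then show ?thesis by simp
    qed
    ultimately show ?thesis
      using has_derivative_transform_within_open[OF _ S x] by fastforce
  qed
  show ?case
    by (rule Ck_on_SucI[OF S der])
      (use m in \<open>auto intro!: Ck_on_sylvester_inv Ck_on_add Ck_on_diff Ck_on_scaleR_const Ck_on_mult S f qk Mk Ck_on_SucD(2)[OF Suc.prems]
        simp: M_def[symmetric]\<close>)
qed

section \<open>Mollification\<close>

definition flat :: "nat \<Rightarrow> real \<Rightarrow> real" where
  "flat n t = (if 0 < t then inverse t ^ n * exp (- inverse t) else 0)"

lemma flat_nonneg: "0 \<le> flat n t"
  by (simp add: flat_def)

lemma flat_pos: "0 < t \<Longrightarrow> 0 < flat n t"
  by (simp add: flat_def)

lemma tendsto_flat: "(flat n \<longlongrightarrow> 0) (at 0)"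
proof (rule filterlim_split_at)
  show "(flat n \<longlongrightarrow> 0) (at_left 0)"
    by (rule tendsto_eventually) (auto simp: eventually_at_filter flat_def)
  have "((\<lambda>t. inverse t ^ n / exp (inverse t)) \<longlongrightarrow> (0::real)) (at_right 0)"
    by (rule filterlim_compose[OF tendsto_power_div_exp_0 filterlim_inverse_at_top_right])
  then show "(flat n \<longlongrightarrow> 0) (at_right 0)"
    by (rule Lim_transform_eventually)
      (auto simp: eventually_at_filter flat_def exp_minus divide_inverse intro!: always_eventually)
qed

text \<open>The powers of \<open>1/t\<close> in front of the exponential make the family closed
  under differentiation, up to linear combinations; smoothness of every member then follows by one
  induction.\<close>

lemma flat_has_derivative:
  "(flat n has_derivative (\<lambda>v. v * (flat (n + 2) t - real n * flat (n + 1) t))) (at t)"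
proof -
  consider "t < 0" | "t = 0" | "0 < t" by linarith
  then show ?thesis
  proof cases
    case 1
    have "((\<lambda>t. 0::real) has_derivative (\<lambda>v. v * 0)) (at t)" by simp
    then have "(flat n has_derivative (\<lambda>v. v * 0)) (at t)"
      by (rule has_derivative_transform_within_open[where s="{..<0}"]) (use 1 in \<open>auto simp: flat_def\<close>)
    then show ?thesis using 1 by (simp add: flat_def)
  next
    case 2
    \<comment> \<open>The difference quotient at 0 is the next member of the family.\<close>
    have "((\<lambda>h. (flat n (0 + h) - flat n 0) / h) \<longlongrightarrow> 0) (at 0)"
      by (rule Lim_transform_eventually[OF tendsto_flat[of "Suc n"]])
        (auto simp: eventually_at_filter flat_def divide_inverse intro!: always_eventually)
    then have "(flat n has_real_derivative 0) (at 0)"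
      by (simp only: DERIV_def)
    then have "(flat n has_derivative (\<lambda>v. v * (flat (n + 2) 0 - real n * flat (n + 1) 0))) (at 0)"
      unfolding has_field_derivative_def by (rule has_derivative_eq_rhs) (auto simp: flat_def)
    then show ?thesis unfolding 2 .
  next
    case 3
    have "((\<lambda>t. inverse t ^ n * exp (- inverse t)) has_real_derivative
        (flat (n + 2) t - real n * flat (n + 1) t)) (at t)"
      using 3 by (auto intro!: derivative_eq_intros)
        (cases n; simp add: flat_def field_simps power2_eq_square)
    then have "(flat n has_real_derivative (flat (n + 2) t - real n * flat (n + 1) t)) (at t)"
      by (rule DERIV_cong_ev[THEN iffD1, rotated -1])
        (use 3 in \<open>auto simp: flat_def eventually_nhds intro!: exI[of _ "{0<..}"]\<close>)
    then show ?thesis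
      unfolding has_field_derivative_def by (rule has_derivative_eq_rhs) (simp add: fun_eq_iff mult.commute)
  qed
qed

lemma Ck_on_flat: "Ck_on k UNIV (flat n)"
proof (induction k arbitrary: n)
  case 0
  have "isCont (flat n) t" for t
    using flat_has_derivative by (rule has_derivative_continuous)
  then show ?case by (simp add: continuous_at_imp_continuous_on)
next
  case (Suc k)
  show ?case
    by (rule Ck_on_SucI[OF open_UNIV flat_has_derivative])
      (intro Ck_on_mult Ck_on_diff Ck_on_const Suc open_UNIV)
qed

text \<open>Riemann sums lie in the subspace and the integral is their limit. This keeps mollified
  functions self-adjoint and \<open>A\<close>-valued.\<close>

lemma integral_in_closed_subspace:
  fixes f :: "'e::euclidean_space \<Rightarrow> 'b::real_normed_vector"
  assumes "subspace B" "closed B" "\<And>x. x \<in> cbox a b \<Longrightarrow> f x \<in> B" "f integrable_on cbox a b"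
  shows "integral (cbox a b) f \<in> B"
proof (rule Lim_in_closed_set[OF assms(2) _ division_filter_not_empty])
  show "((\<lambda>p. \<Sum>(x,k)\<in>p. measure lborel k *\<^sub>R f x) \<longlongrightarrow> integral (cbox a b) f) (division_filter (cbox a b))"
    using assms(4) unfolding has_integral_cbox[symmetric] by (rule integrable_integral)
  show "\<forall>\<^sub>F p in division_filter (cbox a b). (\<Sum>(x,k)\<in>p. measure lborel k *\<^sub>R f x) \<in> B"
    using eventually_division_filter_tagged_division[of "cbox a b"]
    by eventually_elim
      (auto intro!: subspace_sum[OF assms(1)] subspace_mul[OF assms(1)] assms(3) dest: tag_in_interval)
qed

text \<open>All derivatives fall on the kernel, so \<open>P\<close> need only be continuous. The
  domain of integration does not depend on \<open>u\<close>, which permits differentiation under the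
  integral.\<close>

lemma Ck_on_convolution:
  fixes \<eta> :: "'e::euclidean_space \<Rightarrow> real" and P :: "'e \<Rightarrow> 'b::banach"
  assumes "continuous_on (cbox a b) P" "Ck_on k UNIV \<eta>"
  shows "Ck_on k UNIV (\<lambda>u. integral (cbox a b) (\<lambda>z. \<eta> (u - z) *\<^sub>R P z))"
  using assms(2)
proof (induction k arbitrary: \<eta>)
  case 0
  have "continuous_on (UNIV \<times> cbox a b) (\<lambda>(u, z). \<eta> (u - z) *\<^sub>R P z)"
    unfolding split_beta using 0 assms(1)
    by (auto intro!: continuous_intros continuous_on_compose2[of UNIV \<eta>] continuous_on_compose2[of "cbox a b" P])
  then show ?case by (auto intro: integral_continuous_on_param)
next
  case (Suc k)
  let ?D = "\<lambda>x. frechet_derivative \<eta> (at x)"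
  have cD: "continuous_on UNIV (\<lambda>x. ?D x v)" for v
    by (rule Ck_on_imp_continuous_on[OF Ck_on_SucD(2)[OF Suc.prems]])
  \<comment> \<open>\<open>leibniz_rule\<close> asks for the derivative as a bounded linear map that
    is continuous in operator norm; in this basis expansion the continuity reduces to that of the
    partial derivatives of \<eta>.\<close>
  define J :: "'e \<Rightarrow> 'e \<Rightarrow> 'e \<Rightarrow>\<^sub>L 'b" where
    "J u z = (\<Sum>i\<in>Basis. ?D (u - z) i *\<^sub>R (blinfun_scaleR_left (P z) o\<^sub>L blinfun_inner_left i))" for u z
  have D: "(\<eta> has_derivative ?D x) (at x)" for x by (rule Ck_on_SucD(1)[OF Suc.prems]) simp
  have Jv: "blinfun_apply (J u z) v = ?D (u - z) v *\<^sub>R P z" for u z v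
  proof -
    have lin: "linear (?D (u - z))" using D by (rule has_derivative_linear)
    have "?D (u - z) v = ?D (u - z) (\<Sum>i\<in>Basis. (v \<bullet> i) *\<^sub>R i)" by (simp only: euclidean_representation)
    also have "\<dots> = (\<Sum>i\<in>Basis. (v \<bullet> i) * ?D (u - z) i)"
      by (simp only: linear_sum[OF lin] linear_scale[OF lin] real_scaleR_def)
    finally have "?D (u - z) v *\<^sub>R P z = (\<Sum>i\<in>Basis. (v \<bullet> i) * ?D (u - z) i) *\<^sub>R P z" by simp
    then show ?thesis
      by (simp add: J_def blinfun.sum_left blinfun.scaleR_left scaleR_sum_left mult.commute inner_commute)
  qed
  have cJ: "continuous_on (UNIV \<times> cbox a b) (\<lambda>(u, z). J u z)"
  proof -
    have 1: "continuous_on (UNIV \<times> cbox a b) (\<lambda>p. ?D (fst p - snd p) i)" for i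
      by (rule continuous_on_compose2[OF cD]) (auto intro!: continuous_intros)
    have 2: "continuous_on (UNIV \<times> cbox a b) (\<lambda>p. P (snd p))"
      by (rule continuous_on_compose2[OF assms(1)]) (auto intro: continuous_intros)
    show ?thesis
      unfolding split_beta J_def
      by (intro continuous_on_sum continuous_on_scaleR 1 continuous_on_const 2
          bounded_bilinear.continuous_on[OF bounded_bilinear_blinfun_compose]
          bounded_linear.continuous_on[OF bounded_linear_blinfun_scaleR_left])
  qed
  have c\<eta>: "continuous_on UNIV \<eta>" by (rule Ck_on_imp_continuous_on[OF Suc.prems])
  have "((\<lambda>u. integral (cbox a b) (\<lambda>z. \<eta> (u - z) *\<^sub>R P z)) has_derivative
      blinfun_apply (integral (cbox a b) (J u))) (at u within UNIV)" for u
  proof (rule leibniz_rule[OF _ _ cJ])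
    fix x z :: 'e
    have "((\<lambda>u. u - z) has_derivative (\<lambda>v. v)) (at x)" by (auto intro!: derivative_eq_intros)
    then have "((\<lambda>u. \<eta> (u - z)) has_derivative ?D (x - z)) (at x)"
      by (rule has_derivative_compose) (rule D)
    from has_derivative_scaleR_left[OF this, of "P z"]
    show "((\<lambda>x. \<eta> (x - z) *\<^sub>R P z) has_derivative blinfun_apply (J x z)) (at x within UNIV)"
      by (simp add: Jv[abs_def])
  next
    fix x show "(\<lambda>z. \<eta> (x - z) *\<^sub>R P z) integrable_on cbox a b"
      by (intro integrable_continuous continuous_intros assms(1) continuous_on_compose2[OF c\<eta>]) auto
  qed auto
  moreover have "blinfun_apply (integral (cbox a b) (J u)) v
      = integral (cbox a b) (\<lambda>z. ?D (u - z) v *\<^sub>R P z)" for u v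
  proof -
    have "continuous_on (cbox a b) (J u)"
    proof -
      have "continuous_on (cbox a b) (\<lambda>z. (u, z))"
        by (intro continuous_on_Pair continuous_on_const continuous_on_id)
      from continuous_on_compose2[OF cJ this] show ?thesis by auto
    qed
    then show ?thesis
      by (subst blinfun_apply_integral) (auto intro: integrable_continuous simp: Jv)
  qed
  ultimately have der: "((\<lambda>u. integral (cbox a b) (\<lambda>z. \<eta> (u - z) *\<^sub>R P z)) has_derivative
      (\<lambda>v. integral (cbox a b) (\<lambda>z. ?D (u - z) v *\<^sub>R P z))) (at u)" for u
    by (metis (no_types, lifting) has_derivative_eq_rhs ext)
  show ?case
    by (rule Ck_on_SucI[OF open_UNIV der]) (rule Suc.IH[OF Ck_on_SucD(2)[OF Suc.prems]])
qed

text \<open>The closed ball of the maximum norm. Integrals are taken over boxes and estimates are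
  made on Euclidean balls; the two inclusions below translate between them.\<close>

definition cube :: "'e::euclidean_space \<Rightarrow> real \<Rightarrow> 'e set" where
  "cube c r = cbox (c - r *\<^sub>R One) (c + r *\<^sub>R One)"

lemma mem_cube: "x \<in> cube c r \<longleftrightarrow> (\<forall>i\<in>Basis. \<bar>(x - c) \<bullet> i\<bar> \<le> r)"
  by (auto simp: cube_def mem_box inner_diff_left inner_add_left abs_le_iff; smt (verit))

lemma ball_subset_cube: "cball c r \<subseteq> cube c r"
  by (auto simp: mem_cube dist_norm norm_minus_commute intro: order_trans[OF Basis_le_norm])

lemma cube_subset_cball: "cube (c::'e::euclidean_space) r \<subseteq> cball c (real DIM('e) * r)"
proof
  fix x assume "x \<in> cube c r"
  then have "norm (x - c) \<le> (\<Sum>i\<in>(Basis::'e set). r)"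
    by (intro order_trans[OF norm_le_l1 sum_mono]) (auto simp: mem_cube)
  then show "x \<in> cball c (real DIM('e) * r)" by (simp add: dist_norm norm_minus_commute)
qed

lemma compact_cube: "compact (cube c r)"
  by (simp add: cube_def)

text \<open>\<open>flat 0\<close> composed with the polynomial
  \<open>\<delta>^2 - norm w ^ 2\<close> is smooth and supported in the ball; its integral is
  positive because the function is continuous, nonnegative and positive at 0.\<close>

lemma exists_mollifier:
  assumes "0 < \<delta>"
  obtains \<eta> :: "'e::euclidean_space \<Rightarrow> real"
  where "\<And>k. Ck_on k UNIV \<eta>" "\<And>w. 0 \<le> \<eta> w" "\<And>w. \<delta> \<le> norm w \<Longrightarrow> \<eta> w = 0"
    "integral (cube 0 \<delta>) \<eta> = 1"
proof -
  define \<zeta> :: "'e \<Rightarrow> real" where "\<zeta> w = flat 0 (\<delta>\<^sup>2 - w \<bullet> w)" for w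
  have sm: "Ck_on k UNIV \<zeta>" for k
    unfolding \<zeta>_def
    by (rule Ck_on_compose[OF _ _ _ _ Ck_on_flat]) (auto intro!: Ck_on_diff Ck_on_const Ck_on_inner Ck_on_id)
  have cont: "continuous_on (cube 0 \<delta>) \<zeta>"
    using Ck_on_imp_continuous_on[OF sm] continuous_on_subset by blast
  have int: "\<zeta> integrable_on cube 0 \<delta>"
    using cont unfolding cube_def by (rule integrable_continuous)
  have nn: "0 \<le> \<zeta> w" for w by (simp add: \<zeta>_def flat_nonneg)
  define I where "I = integral (cube 0 \<delta>) \<zeta>"
  have "I \<noteq> 0"
  proof
    assume "I = 0"
    then have "\<forall>x\<in>cube 0 \<delta>. \<zeta> x = 0"
      using integral_cbox_eq_0_iff[of "0 - \<delta> *\<^sub>R One" "0 + \<delta> *\<^sub>R One" \<zeta>] cont nn assms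
      by (simp add: I_def cube_def box_ne_empty)
    moreover have "(0::'e) \<in> cube 0 \<delta>" using assms by (simp add: mem_cube)
    moreover have "\<zeta> 0 > 0" using assms by (simp add: \<zeta>_def flat_pos)
    ultimately show False by force
  qed
  moreover have "0 \<le> I" unfolding I_def by (rule integral_nonneg[OF int]) (rule nn)
  ultimately have I: "0 < I" by simp
  show ?thesis
  proof
    show "Ck_on k UNIV (\<lambda>w. \<zeta> w / I)" for k
      unfolding divide_inverse by (intro Ck_on_mult Ck_on_const sm open_UNIV)
    show "0 \<le> \<zeta> w / I" for w using nn I by simp
    show "\<zeta> w / I = 0" if "\<delta> \<le> norm w" for w
    proof -
      have "\<delta>\<^sup>2 \<le> w \<bullet> w"
        using power_mono[OF that, of 2] assms by (simp add: power2_norm_eq_inner)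
      then show ?thesis by (simp add: \<zeta>_def flat_def)
    qed
    show "integral (cube 0 \<delta>) (\<lambda>w. \<zeta> w / I) = 1"
      using I by (simp add: I_def)
  qed
qed

text \<open>The left form averages translates of \<open>P\<close> with weights of total mass 1 and
  gives the estimates; the right form has a fixed domain and gives smoothness. The substitution is
  \<open>z = u - w\<close>.\<close>

lemma convolution_commute:
  fixes \<eta> :: "'e::euclidean_space \<Rightarrow> real" and P :: "'e \<Rightarrow> 'b::banach"
  assumes "continuous_on UNIV \<eta>" "continuous_on UNIV P"
    and supp: "\<And>w. \<delta> \<le> norm w \<Longrightarrow> \<eta> w = 0" and sub: "cube u \<delta> \<subseteq> cbox a b"
  shows "integral (cube 0 \<delta>) (\<lambda>w. \<eta> w *\<^sub>R P (u - w)) = integral (cbox a b) (\<lambda>z. \<eta> (u - z) *\<^sub>R P z)"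
proof -
  let ?f = "\<lambda>w. \<eta> w *\<^sub>R P (u - w)" and ?S = "(\<lambda>x. u - x) ` cube 0 \<delta>"
  have "?f integrable_on cube 0 \<delta>"
    unfolding cube_def using assms(1,2)
    by (intro integrable_continuous continuous_intros)
      (auto intro: continuous_on_subset intro!: continuous_on_compose2[of UNIV P] continuous_intros)
  then have "(?f has_integral integral (cube 0 \<delta>) ?f) (cube 0 \<delta>)" by (rule integrable_integral)
  from has_integral_affinity[OF this[unfolded cube_def[of 0 \<delta>]], of "-1" u]
  have "((\<lambda>z. \<eta> (u - z) *\<^sub>R P z) has_integral integral (cube 0 \<delta>) ?f) ?S"
    by (simp add: cube_def)
  moreover have "\<eta> (u - z) *\<^sub>R P z = 0" if "z \<notin> ?S" for z
  proof -
    have "u - z \<notin> cube 0 \<delta>" using that by (metis diff_diff_eq2 add_diff_cancel_left' image_eqI add.commute)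
    then have "\<delta> \<le> norm (u - z)" using ball_subset_cube[of 0 \<delta>] by (force simp: not_le)
    then show ?thesis by (simp add: supp)
  qed
  moreover have "?S \<subseteq> cbox a b"
  proof -
    have "?S \<subseteq> cube u \<delta>" by (auto simp: mem_cube)
    then show ?thesis using sub by blast
  qed
  ultimately have "((\<lambda>z. \<eta> (u - z) *\<^sub>R P z) has_integral integral (cube 0 \<delta>) ?f) (cbox a b)"
    by (rule has_integral_on_superset)
  then show ?thesis by (rule integral_unique[symmetric])
qed

text \<open>Both estimates say that a bound valid for every small translate survives averaging. In
  the last one the two points are shifted by the same \<open>w\<close>, so a Lipschitz bound for
  \<open>P\<close> passes to \<open>F\<close> without any extra factor.\<close>

lemma smooth_approximation:
  fixes P :: "'e::euclidean_space \<Rightarrow> 'b::banach"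
  assumes P: "continuous_on UNIV P" and "0 < \<delta>"
  obtains F where "smooth_on UNIV F"
    "\<And>B u. subspace B \<Longrightarrow> closed B \<Longrightarrow> range P \<subseteq> B \<Longrightarrow> F u \<in> B"
    "\<And>u y C. (\<And>w. norm w < \<delta> \<Longrightarrow> norm (P (u - w) - y) \<le> C) \<Longrightarrow> norm (F u - y) \<le> C"
    "\<And>u v C. (\<And>w. norm w < \<delta> \<Longrightarrow> norm (P (u - w) - P (v - w)) \<le> C) \<Longrightarrow> norm (F u - F v) \<le> C"
proof -
  obtain \<eta> :: "'e \<Rightarrow> real" where \<eta>: "\<And>k. Ck_on k UNIV \<eta>" "\<And>w. 0 \<le> \<eta> w"
    "\<And>w. \<delta> \<le> norm w \<Longrightarrow> \<eta> w = 0" "integral (cube 0 \<delta>) \<eta> = 1"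
    using exists_mollifier[OF assms(2)] by blast
  have c\<eta>: "continuous_on S \<eta>" for S
    using Ck_on_imp_continuous_on[OF \<eta>(1)] continuous_on_subset by blast
  define F where "F u = integral (cube 0 \<delta>) (\<lambda>w. \<eta> w *\<^sub>R P (u - w))" for u
  have cP: "continuous_on S (\<lambda>w. P (u - w))" for u S
    by (rule continuous_on_compose2[OF P]) (auto intro: continuous_intros)
  have int: "(\<lambda>w. \<eta> w *\<^sub>R Q w) integrable_on cube 0 \<delta>"
    if "continuous_on UNIV Q" for Q :: "'e \<Rightarrow> 'b"
    using that unfolding cube_def
    by (intro integrable_continuous continuous_intros c\<eta>) (auto intro: continuous_on_subset)
  have bound: "norm (integral (cube 0 \<delta>) (\<lambda>w. \<eta> w *\<^sub>R Q w)) \<le> C"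
    if "continuous_on UNIV Q" "\<And>w. norm w < \<delta> \<Longrightarrow> norm (Q w) \<le> C" for Q :: "'e \<Rightarrow> 'b" and C
  proof -
    have "norm (integral (cube 0 \<delta>) (\<lambda>w. \<eta> w *\<^sub>R Q w)) \<le> integral (cube 0 \<delta>) (\<lambda>w. \<eta> w * C)"
    proof (rule integral_norm_bound_integral[OF int[OF that(1)]])
      show "(\<lambda>w. \<eta> w * C) integrable_on cube 0 \<delta>"
        unfolding cube_def by (intro integrable_continuous continuous_intros c\<eta>)
      show "norm (\<eta> w *\<^sub>R Q w) \<le> \<eta> w * C" for w
        using \<eta>(2,3)[of w] that(2)[of w] by (cases "norm w < \<delta>") (auto intro: mult_left_mono)
    qed
    also have "\<dots> = C" by (simp add: \<eta>(4))
    finally show ?thesis .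
  qed
  show ?thesis
  proof
    show "smooth_on UNIV F"
      unfolding smooth_on_def
    proof (intro allI Ck_on_local)
      fix k and u :: 'e
      \<comment> \<open>One box serves all points within distance 1 of \<open>u\<close>, so the
        fixed-domain form applies near \<open>u\<close>.\<close>
      have "cube x \<delta> \<subseteq> cube u (\<delta> + 1)" if "x \<in> ball u 1" for x
      proof
        fix y assume "y \<in> cube x \<delta>"
        moreover have "\<bar>(x - u) \<bullet> i\<bar> \<le> 1" if "i \<in> Basis" for i
          using Basis_le_norm[OF that, of "x - u"] \<open>x \<in> ball u 1\<close> by (simp add: dist_norm norm_minus_commute)
        ultimately show "y \<in> cube u (\<delta> + 1)"
          unfolding mem_cube inner_diff_left by (smt (verit))
      qed
      then have eq: "integral (cube u (\<delta> + 1)) (\<lambda>z. \<eta> (x - z) *\<^sub>R P z) = F x" if "x \<in> ball u 1" for x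
        unfolding F_def cube_def[of u] using that
        by (intro convolution_commute[OF c\<eta> P \<eta>(3), symmetric]) auto
      have "Ck_on k UNIV (\<lambda>x. integral (cube u (\<delta> + 1)) (\<lambda>z. \<eta> (x - z) *\<^sub>R P z))"
        unfolding cube_def by (intro Ck_on_convolution continuous_on_subset[OF P] \<eta>) auto
      then have "Ck_on k (ball u 1) F"
        by (intro Ck_on_cong[OF open_ball eq Ck_on_subset]) auto
      then show "\<exists>T. open T \<and> u \<in> T \<and> Ck_on k T F" by (intro exI[of _ "ball u 1"]) auto
    qed
    show "F u \<in> B" if "subspace B" "closed B" "range P \<subseteq> B" for B u
      unfolding F_def cube_def
      by (rule integral_in_closed_subspace[OF that(1,2)])
        (use that int[OF cP] in \<open>auto intro: subspace_mul simp: cube_def\<close>)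
    show "norm (F u - y) \<le> C" if "\<And>w. norm w < \<delta> \<Longrightarrow> norm (P (u - w) - y) \<le> C" for u y C
    proof -
      have "integral (cube 0 \<delta>) (\<lambda>w. \<eta> w *\<^sub>R y) = y"
      proof -
        have "\<eta> integrable_on cube 0 \<delta>" unfolding cube_def by (intro integrable_continuous c\<eta>)
        then have "(\<eta> has_integral 1) (cube 0 \<delta>)" using \<eta>(4) integrable_integral by metis
        from has_integral_scaleR_left[OF this, of y] show ?thesis by (simp add: integral_unique)
      qed
      then have "F u - y = integral (cube 0 \<delta>) (\<lambda>w. \<eta> w *\<^sub>R (P (u - w) - y))"
        unfolding F_def scaleR_diff_right
        by (subst integral_diff) (auto intro!: int cP continuous_intros)
      also have "norm \<dots> \<le> C"
        by (rule bound) (auto intro!: continuous_intros cP that)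
      finally show ?thesis .
    qed
    show "norm (F u - F v) \<le> C" if "\<And>w. norm w < \<delta> \<Longrightarrow> norm (P (u - w) - P (v - w)) \<le> C" for u v C
    proof -
      have "F u - F v = integral (cube 0 \<delta>) (\<lambda>w. \<eta> w *\<^sub>R (P (u - w) - P (v - w)))"
        unfolding F_def scaleR_diff_right
        by (subst integral_diff) (auto intro!: int cP)
      also have "norm \<dots> \<le> C"
        by (rule bound) (auto intro!: continuous_intros cP that)
      finally show ?thesis .
    qed
  qed
qed

lemma smooth_bump:
  fixes c :: "'e::euclidean_space"
  assumes "0 \<le> r" "r < R"
  obtains \<beta> :: "'e \<Rightarrow> real" where "smooth_on UNIV \<beta>" "\<And>u. 0 \<le> \<beta> u \<and> \<beta> u \<le> 1"
    "\<And>u. u \<in> cball c r \<Longrightarrow> \<beta> u = 1" "\<And>u. u \<notin> ball c R \<Longrightarrow> \<beta> u = 0"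
proof -
  \<comment> \<open>Thirds of the gap: the ramp \<open>P\<close> is 1 up to radius
    \<open>r + d\<close> and 0 from \<open>r + 2 d\<close> on, and mollifying at scale
    \<open>d\<close> costs \<open>d\<close> at either end.\<close>
  define d where "d = (R - r) / 3"
  have d: "0 < d" "R = r + 3 * d" using assms by (auto simp: d_def field_simps)
  define P where "P z = max 0 (min 1 ((r + 2 * d - dist z c) / d))" for z
  have "continuous_on UNIV P" unfolding P_def
    using d by (intro continuous_intros) auto
  from smooth_approximation[OF this d(1)] obtain \<beta> where \<beta>: "smooth_on UNIV \<beta>"
    "\<And>u y C. (\<And>w. norm w < d \<Longrightarrow> norm (P (u - w) - y) \<le> C) \<Longrightarrow> norm (\<beta> u - y) \<le> C"
    by metis
  have tri: "dist u c \<le> dist (u - w) c + norm w" "dist (u - w) c \<le> dist u c + norm w" for u w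
    using norm_triangle_ineq[of "u - w - c" w] norm_triangle_ineq4[of "u - c" w]
    by (auto simp: dist_norm algebra_simps)
  show ?thesis
  proof
    show "smooth_on UNIV \<beta>" by fact
    show "0 \<le> \<beta> u \<and> \<beta> u \<le> 1" for u
    proof -
      \<comment> \<open>The range condition is phrased as distance at most 1/2 from the constant
        1/2, the shape in which the averaging estimate applies.\<close>
      have "\<bar>max 0 (min 1 t) - 1/2\<bar> \<le> 1/2" for t :: real by (auto simp: max_def min_def abs_if)
      then have "norm (\<beta> u - 1/2) \<le> 1/2" by (intro \<beta>(2)) (simp only: P_def real_norm_def)
      then show ?thesis unfolding real_norm_def abs_le_iff by linarith
    qed
    show "\<beta> u = 1" if "u \<in> cball c r" for u
    proof -
      have "P (u - w) = 1" if "norm w < d" for w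
        using tri(2)[of u w] that \<open>u \<in> cball c r\<close> d by (simp add: P_def dist_commute)
      then have "norm (\<beta> u - 1) \<le> 0" by (intro \<beta>(2)) simp
      then show ?thesis by simp
    qed
    show "\<beta> u = 0" if "u \<notin> ball c R" for u
    proof -
      have "P (u - w) = 0" if "norm w < d" for w
      proof -
        have "r + 2 * d \<le> dist (u - w) c"
          using tri(1)[of u w] that \<open>u \<notin> ball c R\<close> d by (simp add: dist_commute)
        then show ?thesis using d by (simp add: P_def divide_le_0_iff)
      qed
      then have "norm (\<beta> u - 0) \<le> 0" by (intro \<beta>(2)) simp
      then show ?thesis by simp
    qed
  qed
qed

section \<open>Charts and metrics\<close>

abbreviation param :: "('m, 'e) chart \<Rightarrow> 'e \<Rightarrow> 'm" where
  "param c \<equiv> inv_into (fst c) (snd c)"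

text \<open>\<open>cover\<close> selects the first alternative in \<open>smooth_manifold\<close>;
  the discrete one is settled in the final theorem.\<close>

locale compact_riemannian =
  fixes M :: "'m::t2_space set" and \<A> :: "('m, 'e::euclidean_space) chart set"
    and g :: "('m, 'e) chart \<Rightarrow> 'm \<Rightarrow> 'e \<Rightarrow> 'e \<Rightarrow> real"
  assumes manifold: "riemannian_manifold M \<A> g"
    and cover: "M \<subseteq> (\<Union>c\<in>\<A>. fst c)"
    and compact: "compact M" and connected: "connected M"
begin

lemma chart_openin: "c \<in> \<A> \<Longrightarrow> openin (top_of_set M) (fst c)"
  and chart_open: "c \<in> \<A> \<Longrightarrow> open (snd c ` fst c)"
  and chart_homeo: "c \<in> \<A> \<Longrightarrow> homeomorphism (fst c) (snd c ` fst c) (snd c) (param c)"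
  using manifold
  by (auto simp: riemannian_manifold_def smooth_manifold_def is_chart_def split_beta)

lemma chart_subset: "c \<in> \<A> \<Longrightarrow> fst c \<subseteq> M"
  using chart_openin openin_imp_subset by blast

lemma param_chart: "c \<in> \<A> \<Longrightarrow> x \<in> fst c \<Longrightarrow> param c (snd c x) = x"
  using chart_homeo by (auto simp: homeomorphism_def)

lemma param_mem: "u \<in> snd c ` fst c \<Longrightarrow> param c u \<in> fst c"
  by (rule inv_into_into)

lemma chart_param: "u \<in> snd c ` fst c \<Longrightarrow> snd c (param c u) = u"
  by (rule f_inv_into_f)

lemma continuous_on_chart: "c \<in> \<A> \<Longrightarrow> continuous_on (fst c) (snd c)"
  and continuous_on_param: "c \<in> \<A> \<Longrightarrow> continuous_on (snd c ` fst c) (param c)"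
  using chart_homeo by (auto simp: homeomorphism_def)

lemma open_chart_image:
  assumes "c \<in> \<A>" "openin (top_of_set M) V" "V \<subseteq> fst c"
  shows "open (snd c ` V)"
proof -
  have "openin (top_of_set (fst c)) V"
    by (rule openin_subset_trans[OF assms(2,3) chart_subset[OF assms(1)]])
  then show ?thesis
    using homeomorphism_imp_open_map[OF chart_homeo[OF assms(1)]] chart_open[OF assms(1)] openin_open_trans by blast
qed

lemma openin_param_image:
  assumes "c \<in> \<A>" "open V" "V \<subseteq> snd c ` fst c"
  shows "openin (top_of_set M) (param c ` V)"
proof -
  have "openin (top_of_set (snd c ` fst c)) V" using assms(2,3) by (auto intro: open_subset)
  then have "openin (top_of_set (fst c)) (param c ` V)"
    using homeomorphism_imp_open_map[OF homeomorphism_symD[OF chart_homeo[OF assms(1)]]] by blast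
  then show ?thesis using chart_openin[OF assms(1)] openin_trans by blast
qed

lemma exists_chart: "x \<in> M \<Longrightarrow> \<exists>c\<in>\<A>. x \<in> fst c"
  using cover by auto

lemma open_overlap:
  assumes "c \<in> \<A>" "d \<in> \<A>"
  shows "open (snd c ` (fst c \<inter> fst d))"
  using assms by (intro open_chart_image openin_Int chart_openin) auto

lemma Ck_on_transition:
  "c \<in> \<A> \<Longrightarrow> d \<in> \<A> \<Longrightarrow> Ck_on k (snd c ` (fst c \<inter> fst d)) (transition c d)"
  using manifold by (auto simp: riemannian_manifold_def smooth_manifold_def smooth_on_def)

lemma transition_has_derivative:
  assumes "c \<in> \<A>" "d \<in> \<A>" "x \<in> fst c" "x \<in> fst d"
  shows "(transition c d has_derivative frechet_derivative (transition c d) (at (snd c x))) (at (snd c x))"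
  by (rule Ck_on_SucD(1)[OF Ck_on_transition[OF assms(1,2)]]) (use assms in auto)

lemma transition_chart:
  "c \<in> \<A> \<Longrightarrow> x \<in> fst c \<Longrightarrow> transition c d (snd c x) = snd d x"
  by (simp add: transition_def param_chart)

lemma metric_bilinear: "c \<in> \<A> \<Longrightarrow> x \<in> fst c \<Longrightarrow> bilinear (g c x)"
  and metric_pos: "c \<in> \<A> \<Longrightarrow> x \<in> fst c \<Longrightarrow> u \<noteq> 0 \<Longrightarrow> 0 < g c x u u"
  and Ck_on_metric: "c \<in> \<A> \<Longrightarrow> Ck_on k (snd c ` fst c) (\<lambda>y. g c (param c y) u v)"
  using manifold by (auto simp: riemannian_manifold_def riemannian_metric_def smooth_on_def)

lemma metric_transform:
  assumes "c \<in> \<A>" "d \<in> \<A>" "x \<in> fst c" "x \<in> fst d"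
  shows "g c x u v = g d x (frechet_derivative (transition c d) (at (snd c x)) u)
    (frechet_derivative (transition c d) (at (snd c x)) v)"
  using manifold assms unfolding riemannian_manifold_def riemannian_metric_def Let_def by blast

lemma metric_nonneg: "c \<in> \<A> \<Longrightarrow> x \<in> fst c \<Longrightarrow> 0 \<le> g c x u u"
  using metric_pos[of c x u] bilinear_lzero[OF metric_bilinear[of c x], of u] by (cases "u = 0") auto

lemma metric_scaleR:
  assumes "c \<in> \<A>" "x \<in> fst c"
  shows "sqrt (g c x (t *\<^sub>R v) (t *\<^sub>R v)) = \<bar>t\<bar> * sqrt (g c x v v)"
  using bilinear_lmul[OF metric_bilinear[OF assms]] bilinear_rmul[OF metric_bilinear[OF assms]]
  by (simp add: real_sqrt_mult flip: power2_eq_square mult.assoc)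

lemma metric_expand:
  assumes "c \<in> \<A>" "x \<in> fst c"
  shows "g c x u v = (\<Sum>i\<in>Basis. \<Sum>j\<in>Basis. (u \<bullet> i) * (v \<bullet> j) * g c x i j)"
proof -
  note b = metric_bilinear[OF assms]
  have "g c x u v = g c x (\<Sum>i\<in>Basis. (u \<bullet> i) *\<^sub>R i) (\<Sum>j\<in>Basis. (v \<bullet> j) *\<^sub>R j)"
    by (simp only: euclidean_representation)
  also have "\<dots> = (\<Sum>i\<in>Basis. \<Sum>j\<in>Basis. (u \<bullet> i) * (v \<bullet> j) * g c x i j)"
    by (simp only: bilinear_sum[OF b] sum.cartesian_product[symmetric] bilinear_lmul[OF b] bilinear_rmul[OF b]
        real_scaleR_def mult.assoc mult.left_commute)
  finally show ?thesis .
qed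

text \<open>The definition of a metric provides smoothness for fixed vectors only; expansion in the
  basis turns this into joint continuity in point and vector.\<close>

lemma continuous_on_metric:
  assumes "c \<in> \<A>"
  shows "continuous_on (snd c ` fst c \<times> UNIV) (\<lambda>(y, v). g c (param c y) v v)"
proof -
  have 1: "continuous_on (snd c ` fst c \<times> UNIV) (\<lambda>p. g c (param c (fst p)) i j)" for i j
    by (rule continuous_on_compose2[OF Ck_on_imp_continuous_on[OF Ck_on_metric[OF assms]]])
      (auto intro: continuous_intros)
  have "continuous_on (snd c ` fst c \<times> UNIV)
      (\<lambda>p. \<Sum>i\<in>Basis. \<Sum>j\<in>Basis. (snd p \<bullet> i) * (snd p \<bullet> j) * g c (param c (fst p)) i j)"
    by (intro continuous_on_sum continuous_on_mult 1 continuous_intros)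
  then show ?thesis
    by (rule continuous_on_eq) (auto simp: metric_expand[OF assms param_mem])
qed

text \<open>The norm attains a positive minimum on the compact set of pairs of a point of
  \<open>K\<close> and a unit vector; homogeneity extends the bound to all vectors.\<close>

lemma metric_lower_bound:
  assumes c: "c \<in> \<A>" and K: "compact K" "K \<subseteq> snd c ` fst c"
  obtains m where "0 < m" "\<And>u v. u \<in> K \<Longrightarrow> m * norm v \<le> sqrt (g c (param c u) v v)"
proof (cases "K = {}")
  case True
  then show ?thesis using that[of 1] by simp
next
  case False
  let ?S = "K \<times> sphere (0::'e) 1"
  obtain b :: 'e where "b \<in> Basis" using nonempty_Basis by blast
  then have ne: "?S \<noteq> {}" using False by (force simp: dist_norm)
  have cont: "continuous_on ?S (\<lambda>(y, v). sqrt (g c (param c y) v v))"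
    unfolding split_beta using continuous_on_subset[OF continuous_on_metric[OF c], of ?S] K(2)
    by (intro continuous_on_real_sqrt) (auto simp: split_beta)
  have "compact ?S" using K(1) by (intro compact_Times) auto
  from continuous_attains_inf[OF this ne cont] obtain u0 v0 where
    uv: "u0 \<in> K" "norm v0 = 1" "\<And>u v. u \<in> K \<Longrightarrow> norm v = 1 \<Longrightarrow> sqrt (g c (param c u0) v0 v0) \<le> sqrt (g c (param c u) v v)"
    by (force simp: dist_norm)
  show ?thesis
  proof
    have "param c u0 \<in> fst c" using uv(1) K(2) by (auto intro: param_mem)
    then show "0 < sqrt (g c (param c u0) v0 v0)"
      using metric_pos[OF c, of _ v0] uv(2) by fastforce
    fix u v assume u: "u \<in> K"
    then have mem: "param c u \<in> fst c" using K(2) by (auto intro: param_mem)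
    show "sqrt (g c (param c u0) v0 v0) * norm v \<le> sqrt (g c (param c u) v v)"
    proof (cases "v = 0")
      case False
      have "sqrt (g c (param c u0) v0 v0) \<le> sqrt (g c (param c u) (v /\<^sub>R norm v) (v /\<^sub>R norm v))"
        using False by (intro uv(3) u) auto
      also have "\<dots> = sqrt (g c (param c u) v v) / norm v"
        unfolding metric_scaleR[OF c mem] by (simp add: divide_inverse mult.commute)
      finally show ?thesis using False by (simp add: pos_le_divide_eq)
    qed (use metric_nonneg[OF c mem] in auto)
  qed
qed

text \<open>Uniform continuity on unit vectors yields an additive error; choosing it as
  \<open>\<eta> * m\<close>, with \<open>m\<close> the lower bound of the norm on unit vectors,
  makes it a multiplicative one.\<close>

lemma metric_comparison:
  assumes c: "c \<in> \<A>" and K: "compact K" "K \<subseteq> snd c ` fst c" and "0 < \<eta>"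
  obtains \<delta> where "0 < \<delta>" "\<And>u w v. u \<in> K \<Longrightarrow> w \<in> K \<Longrightarrow> dist u w < \<delta> \<Longrightarrow>
    sqrt (g c (param c w) v v) \<le> (1 + \<eta>) * sqrt (g c (param c u) v v)"
proof -
  let ?S = "K \<times> sphere (0::'e) 1" and ?G = "\<lambda>(y, v). sqrt (g c (param c y) v v)"
  obtain m where m: "0 < m" "\<And>u v. u \<in> K \<Longrightarrow> m * norm v \<le> sqrt (g c (param c u) v v)"
    using metric_lower_bound[OF c K] by metis
  have "continuous_on ?S ?G"
    unfolding split_beta using continuous_on_subset[OF continuous_on_metric[OF c], of ?S] K(2)
    by (intro continuous_on_real_sqrt) (auto simp: split_beta)
  moreover have "compact ?S" using K(1) by (intro compact_Times) auto
  ultimately have "uniformly_continuous_on ?S ?G" by (rule compact_uniformly_continuous)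
  moreover have "0 < \<eta> * m" using m(1) assms(4) by simp
  ultimately obtain \<delta> where \<delta>: "0 < \<delta>"
    "\<And>p q. p \<in> ?S \<Longrightarrow> q \<in> ?S \<Longrightarrow> dist q p < \<delta> \<Longrightarrow> dist (?G q) (?G p) < \<eta> * m"
    unfolding uniformly_continuous_on_def by meson
  show ?thesis
  proof
    show "0 < \<delta>" by fact
    fix u w v assume uw: "u \<in> K" "w \<in> K" "dist u w < \<delta>"
    then have mem: "param c u \<in> fst c" "param c w \<in> fst c" using K(2) by (auto intro: param_mem)
    show "sqrt (g c (param c w) v v) \<le> (1 + \<eta>) * sqrt (g c (param c u) v v)"
    proof (cases "v = 0")
      case True
      then show ?thesis
        using bilinear_lzero[OF metric_bilinear[OF c mem(1)]] bilinear_lzero[OF metric_bilinear[OF c mem(2)]] by simp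
    next
      case False
      define n where "n = v /\<^sub>R norm v"
      have n: "norm n = 1" using False by (simp add: n_def)
      have v: "v = norm v *\<^sub>R n" using False by (simp add: n_def)
      have "dist (?G (w, n)) (?G (u, n)) < \<eta> * m"
        using uw n by (intro \<delta>(2)) (auto simp: dist_Pair_Pair dist_commute)
      then have "sqrt (g c (param c w) n n) \<le> sqrt (g c (param c u) n n) + \<eta> * m"
        by (simp add: dist_real_def)
      also have "\<eta> * m \<le> \<eta> * sqrt (g c (param c u) n n)"
        using m(2)[OF uw(1), of n] n assms(4) by simp
      finally have "norm v * sqrt (g c (param c w) n n) \<le> norm v * ((1 + \<eta>) * sqrt (g c (param c u) n n))"
        by (intro mult_left_mono) (auto simp: algebra_simps)
      moreover have "sqrt (g c (param c y) v v) = norm v * sqrt (g c (param c y) n n)" if "param c y \<in> fst c" for y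
        using metric_scaleR[OF c that, of "norm v" n] v by simp
      ultimately show ?thesis using mem by (simp add: mult.left_commute)
    qed
  qed
qed

section \<open>Slopes and curves\<close>

text \<open>The operator norm of the differential of \<open>f\<close> at \<open>x\<close> with respect to the metric is at most
  \<open>C\<close>.  One chart suffices, by the transformation law of the metric (\<open>slope_leI\<close>).\<close>

definition slope_le :: "('m \<Rightarrow> 'b::real_normed_vector) \<Rightarrow> 'm \<Rightarrow> real \<Rightarrow> bool" where
  "slope_le f x C \<longleftrightarrow> (\<forall>c\<in>\<A>. x \<in> fst c \<longrightarrow> (\<exists>D. ((f \<circ> param c) has_derivative D) (at (snd c x)) \<and>
     (\<forall>v. norm (D v) \<le> C * sqrt (g c x v v))))"

lemma slope_leI:
  assumes c: "c \<in> \<A>" "x \<in> fst c" and D: "((f \<circ> param c) has_derivative D) (at (snd c x))"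
    and bnd: "\<And>v. norm (D v) \<le> C * sqrt (g c x v v)"
  shows "slope_le f x C"
  unfolding slope_le_def
proof (intro ballI impI)
  fix d assume d: "d \<in> \<A>" "x \<in> fst d"
  let ?T = "frechet_derivative (transition d c) (at (snd d x))"
  have "((\<lambda>y. (f \<circ> param c) (transition d c y)) has_derivative (\<lambda>v. D (?T v))) (at (snd d x))"
    by (rule has_derivative_compose[OF transition_has_derivative])
      (use c d D in \<open>simp_all add: transition_chart del: o_apply\<close>)
  then have "((f \<circ> param d) has_derivative (\<lambda>v. D (?T v))) (at (snd d x))"
  proof (rule has_derivative_transform_within_open)
    show "open (snd d ` (fst d \<inter> fst c))" using c d by (intro open_overlap)
    show "snd d x \<in> snd d ` (fst d \<inter> fst c)" using c d by auto
    show "(f \<circ> param c) (transition d c y) = (f \<circ> param d) y" if "y \<in> snd d ` (fst d \<inter> fst c)" for y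
      using that c d by (auto simp: transition_chart param_chart)
  qed
  moreover have "norm (D (?T v)) \<le> C * sqrt (g d x v v)" for v
    using bnd[of "?T v"] metric_transform[OF d(1) c(1) d(2) c(2), of v v] by simp
  ultimately show "\<exists>D. ((f \<circ> param d) has_derivative D) (at (snd d x)) \<and> (\<forall>v. norm (D v) \<le> C * sqrt (g d x v v))"
    by blast
qed

lemma slope_leE:
  assumes "slope_le f x C" "c \<in> \<A>" "x \<in> fst c"
  obtains D where "((f \<circ> param c) has_derivative D) (at (snd c x))" "\<And>v. norm (D v) \<le> C * sqrt (g c x v v)"
  using assms unfolding slope_le_def by blast

lemma slope_le_mono:
  assumes "slope_le f x C" "C \<le> C'"
  shows "slope_le f x C'"
  unfolding slope_le_def
proof (intro ballI impI)
  fix c assume c: "c \<in> \<A>" "x \<in> fst c"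
  obtain D where D: "((f \<circ> param c) has_derivative D) (at (snd c x))" "\<And>v. norm (D v) \<le> C * sqrt (g c x v v)"
    using slope_leE[OF assms(1) c] by blast
  have "C * sqrt (g c x v v) \<le> C' * sqrt (g c x v v)" for v
    using assms(2) metric_nonneg[OF c] by (intro mult_right_mono) auto
  with D show "\<exists>D. ((f \<circ> param c) has_derivative D) (at (snd c x)) \<and> (\<forall>v. norm (D v) \<le> C' * sqrt (g c x v v))"
    by (meson order_trans)
qed

lemma slope_le_add:
  assumes "slope_le f x C" "slope_le h x C'"
  shows "slope_le (\<lambda>x. f x + h x) x (C + C')"
  unfolding slope_le_def
proof (intro ballI impI)
  fix c assume c: "c \<in> \<A>" "x \<in> fst c"
  obtain D where D: "((f \<circ> param c) has_derivative D) (at (snd c x))" "\<And>v. norm (D v) \<le> C * sqrt (g c x v v)"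
    using slope_leE[OF assms(1) c] by blast
  obtain E where E: "((h \<circ> param c) has_derivative E) (at (snd c x))" "\<And>v. norm (E v) \<le> C' * sqrt (g c x v v)"
    using slope_leE[OF assms(2) c] by blast
  have "(((\<lambda>x. f x + h x) \<circ> param c) has_derivative (\<lambda>v. D v + E v)) (at (snd c x))"
    using has_derivative_add[OF D(1) E(1)] by (simp add: o_def)
  moreover have "norm (D v + E v) \<le> (C + C') * sqrt (g c x v v)" for v
    using norm_triangle_mono[OF D(2) E(2)] by (simp add: algebra_simps)
  ultimately show "\<exists>D. (((\<lambda>x. f x + h x) \<circ> param c) has_derivative D) (at (snd c x)) \<and>
      (\<forall>v. norm (D v) \<le> (C + C') * sqrt (g c x v v))" by blast
qed

lemma slope_le_const: "slope_le (\<lambda>_. a) x 0"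
  unfolding slope_le_def by (auto intro!: exI[of _ "\<lambda>_. 0"] simp: o_def)

lemma slope_le_sum:
  assumes "\<And>i. i \<in> I \<Longrightarrow> slope_le (f i) x (C i)"
  shows "slope_le (\<lambda>x. \<Sum>i\<in>I. f i x) x (\<Sum>i\<in>I. C i)"
  using assms
  by (induction I rule: infinite_finite_induct) (auto intro: slope_le_const slope_le_add)

lemma slope_le_cong:
  assumes "slope_le f x C" "openin (top_of_set M) V" "x \<in> V" "\<And>y. y \<in> V \<Longrightarrow> f y = h y"
  shows "slope_le h x C"
  unfolding slope_le_def
proof (intro ballI impI)
  fix c assume c: "c \<in> \<A>" "x \<in> fst c"
  obtain D where D: "((f \<circ> param c) has_derivative D) (at (snd c x))" "\<And>v. norm (D v) \<le> C * sqrt (g c x v v)"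
    using slope_leE[OF assms(1) c] by blast
  have "((h \<circ> param c) has_derivative D) (at (snd c x))"
  proof (rule has_derivative_transform_within_open[OF D(1)])
    show "open (snd c ` (fst c \<inter> V))"
      using c assms(2) by (intro open_chart_image openin_Int chart_openin) auto
    show "snd c x \<in> snd c ` (fst c \<inter> V)" using c assms by auto
    show "(f \<circ> param c) y = (h \<circ> param c) y" if "y \<in> snd c ` (fst c \<inter> V)" for y
      using that c assms(4) by (auto simp: param_chart)
  qed
  with D(2) show "\<exists>D. ((h \<circ> param c) has_derivative D) (at (snd c x)) \<and> (\<forall>v. norm (D v) \<le> C * sqrt (g c x v v))"
    by blast
qed

text \<open>The derivative of \<open>a\<close> does not contribute since \<open>f\<close> vanishes at \<open>x\<close>.\<close>

lemma slope_le_scaleR_zero: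
  assumes "slope_le a x B" "slope_le f x C" "f x = 0"
  shows "slope_le (\<lambda>x. a x *\<^sub>R f x) x (\<bar>a x\<bar> * C)"
  unfolding slope_le_def
proof (intro ballI impI)
  fix c assume c: "c \<in> \<A>" "x \<in> fst c"
  obtain E where E: "((a \<circ> param c) has_derivative E) (at (snd c x))"
    using slope_leE[OF assms(1) c] by blast
  obtain D where D: "((f \<circ> param c) has_derivative D) (at (snd c x))" "\<And>v. norm (D v) \<le> C * sqrt (g c x v v)"
    using slope_leE[OF assms(2) c] by blast
  have "(((\<lambda>x. a x *\<^sub>R f x) \<circ> param c) has_derivative (\<lambda>v. a x *\<^sub>R D v)) (at (snd c x))"
    using has_derivative_scaleR[OF E D(1)] c assms(3) by (simp add: o_def param_chart)
  moreover have "norm (a x *\<^sub>R D v) \<le> \<bar>a x\<bar> * C * sqrt (g c x v v)" for v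
    using mult_left_mono[OF D(2)[of v], of "\<bar>a x\<bar>"] by (simp add: mult.assoc)
  ultimately show "\<exists>D. (((\<lambda>x. a x *\<^sub>R f x) \<circ> param c) has_derivative D) (at (snd c x)) \<and>
      (\<forall>v. norm (D v) \<le> \<bar>a x\<bar> * C * sqrt (g c x v v))" by blast
qed

text \<open>Unlike \<open>speed\<close>, this uses one-sided derivatives at the ends of \<open>S\<close>, so that it is continuous on
  the closed pieces of a curve.\<close>

definition speed_within :: "real set \<Rightarrow> (real \<Rightarrow> 'm) \<Rightarrow> real \<Rightarrow> real" where
  "speed_within S \<gamma> t =
     (let c = (SOME c. c \<in> \<A> \<and> \<gamma> t \<in> fst c);
          v = vector_derivative (snd c \<circ> \<gamma>) (at t within S)
      in sqrt (g c (\<gamma> t) v v))"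

section \<open>Speed of curves and the mean value inequality along them\<close>

lemma eventually_curve_in:
  assumes "continuous_on S \<gamma>" "\<gamma> ` S \<subseteq> M" "t \<in> S" "openin (top_of_set M) V" "\<gamma> t \<in> V"
  shows "\<forall>\<^sub>F s in at t within S. \<gamma> s \<in> V"
proof -
  obtain T where T: "open T" "V = M \<inter> T" using assms(4) by (auto simp: openin_open)
  have "(\<gamma> \<longlongrightarrow> \<gamma> t) (at t within S)" using assms(1,3) by (simp add: continuous_on)
  then have "\<forall>\<^sub>F s in at t within S. \<gamma> s \<in> T" using T assms(5) by (auto intro: topological_tendstoD)
  moreover have "\<forall>\<^sub>F s in at t within S. s \<in> S" by (simp add: eventually_at_filter)
  ultimately show ?thesis by eventually_elim (use assms(2) T in auto)
qed

lemma curve_change_chart: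
  assumes \<gamma>: "continuous_on S \<gamma>" "\<gamma> ` S \<subseteq> M" "t \<in> S"
    and c: "c \<in> \<A>" "\<gamma> t \<in> fst c" and d: "d \<in> \<A>" "\<gamma> t \<in> fst d"
    and v: "((snd c \<circ> \<gamma>) has_vector_derivative v) (at t within S)"
  shows "((snd d \<circ> \<gamma>) has_vector_derivative frechet_derivative (transition c d) (at (snd c (\<gamma> t))) v) (at t within S)"
proof -
  let ?T = "frechet_derivative (transition c d) (at (snd c (\<gamma> t)))"
  have T: "(transition c d has_derivative ?T) (at ((snd c \<circ> \<gamma>) t))"
    using transition_has_derivative[OF c(1) d(1) c(2) d(2)] by simp
  have "((\<lambda>s. transition c d ((snd c \<circ> \<gamma>) s)) has_derivative (\<lambda>r. ?T (r *\<^sub>R v))) (at t within S)"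
    by (rule has_derivative_compose[OF v[unfolded has_vector_derivative_def] T])
  then have "((snd d \<circ> \<gamma>) has_derivative (\<lambda>r. ?T (r *\<^sub>R v))) (at t within S)"
  proof (rule has_derivative_transform_eventually)
    have "\<forall>\<^sub>F s in at t within S. \<gamma> s \<in> fst c"
      using eventually_curve_in[OF \<gamma> chart_openin[OF c(1)] c(2)] .
    then show "\<forall>\<^sub>F s in at t within S. transition c d ((snd c \<circ> \<gamma>) s) = (snd d \<circ> \<gamma>) s"
      by eventually_elim (simp add: transition_chart c)
  qed (simp_all add: transition_chart c \<gamma>)
  then show ?thesis
    by (simp add: has_vector_derivative_def linear_scale[OF has_derivative_linear[OF T]])
qed

text \<open>The chart in \<open>speed_within\<close> is an arbitrary choice at each time; the
  transformation law allows any other chart around the point to be used instead.\<close>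

lemma speed_within_eq:
  assumes \<gamma>: "continuous_on S \<gamma>" "\<gamma> ` S \<subseteq> M" "t \<in> S" and nb: "at t within S \<noteq> bot"
    and c: "c \<in> \<A>" "\<gamma> t \<in> fst c"
    and v: "((snd c \<circ> \<gamma>) has_vector_derivative v) (at t within S)"
  shows "speed_within S \<gamma> t = sqrt (g c (\<gamma> t) v v)"
proof -
  define d where "d = (SOME c. c \<in> \<A> \<and> \<gamma> t \<in> fst c)"
  have d: "d \<in> \<A> \<and> \<gamma> t \<in> fst d"
    unfolding d_def by (rule someI[of _ c]) (use c in auto)
  have "vector_derivative (snd d \<circ> \<gamma>) (at t within S) = frechet_derivative (transition c d) (at (snd c (\<gamma> t))) v"
    using d by (intro vector_derivative_within[OF nb] curve_change_chart[OF \<gamma> c _ _ v]) auto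
  then show ?thesis
    using metric_transform[OF c(1) _ c(2), of d v v] d
    by (simp add: speed_within_def Let_def flip: d_def)
qed

lemma speed_within_interior:
  assumes "a < t" "t < b"
  shows "speed_within {a..b} \<gamma> t = speed \<A> g \<gamma> t"
  using assms by (simp add: speed_within_def speed_def at_within_Icc_at)

lemma C1_curveD:
  assumes "C1_curve M \<A> a b \<gamma>"
  shows "continuous_on {a..b} \<gamma>" "\<gamma> ` {a..b} \<subseteq> M"
    and "c \<in> \<A> \<Longrightarrow> \<exists>D. continuous_on {t\<in>{a..b}. \<gamma> t \<in> fst c} D \<and>
        (\<forall>t\<in>{a..b}. \<gamma> t \<in> fst c \<longrightarrow> ((snd c \<circ> \<gamma>) has_vector_derivative D t) (at t within {a..b}))"
  using assms unfolding C1_curve_def split_beta by blast+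

text \<open>The chosen chart may jump with time. Near \<open>t\<close> the speed is therefore
  computed in one fixed chart, where it is the jointly continuous metric applied to the continuous
  velocity \<open>D\<close>.\<close>

lemma continuous_on_speed_within:
  assumes C: "C1_curve M \<A> a b \<gamma>" and "a < b"
  shows "continuous_on {a..b} (speed_within {a..b} \<gamma>)"
proof (unfold continuous_on_eq_continuous_within, intro ballI)
  note \<gamma> = C1_curveD(1,2)[OF C]
  fix t assume t: "t \<in> {a..b}"
  obtain c where c: "c \<in> \<A>" "\<gamma> t \<in> fst c" using exists_chart \<gamma> t by blast
  define N where "N = {s\<in>{a..b}. \<gamma> s \<in> fst c}"
  obtain D where D: "continuous_on N D"
    "\<And>s. s \<in> N \<Longrightarrow> ((snd c \<circ> \<gamma>) has_vector_derivative D s) (at s within {a..b})"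
    using C1_curveD(3)[OF C c(1)] unfolding N_def by blast
  have nb: "at s within {a..b} \<noteq> bot" if "s \<in> {a..b}" for s
    using that assms(2) by (simp add: trivial_limit_within islimpt_Icc)
  have eq: "speed_within {a..b} \<gamma> s = sqrt (g c (param c (snd c (\<gamma> s))) (D s) (D s))" if "s \<in> N" for s
    using that speed_within_eq[OF \<gamma> _ nb c(1) _ D(2)[OF that]] c(1) by (auto simp: N_def param_chart)
  have "continuous_on N (\<lambda>s. (snd c (\<gamma> s), D s))"
    by (intro continuous_on_Pair D(1) continuous_on_compose2[OF continuous_on_chart[OF c(1)]] continuous_on_subset[OF \<gamma>(1)])
      (auto simp: N_def)
  then have "continuous_on N (\<lambda>s. sqrt (case (snd c (\<gamma> s), D s) of (y, v) \<Rightarrow> g c (param c y) v v))"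
    by (intro continuous_on_real_sqrt continuous_on_compose2[OF continuous_on_metric[OF c(1)]]) (auto simp: N_def)
  then have "continuous_on N (speed_within {a..b} \<gamma>)"
    by (rule continuous_on_eq) (simp add: eq)
  then have cw: "continuous (at t within N) (speed_within {a..b} \<gamma>)"
    using t c by (simp add: N_def continuous_on_eq_continuous_within)
  have "\<forall>\<^sub>F s in at t within {a..b}. \<gamma> s \<in> fst c"
    by (rule eventually_curve_in[OF \<gamma> t chart_openin[OF c(1)] c(2)])
  then obtain T where T: "open T" "t \<in> T" "\<And>s. s \<in> T \<Longrightarrow> s \<noteq> t \<Longrightarrow> s \<in> {a..b} \<Longrightarrow> \<gamma> s \<in> fst c"
    unfolding eventually_at_topological by blast
  have "at t within N = at t within {a..b}"
    by (rule at_within_nhd[OF T(2,1)]) (use T(3) in \<open>auto simp: N_def\<close>)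
  with cw show "continuous (at t within {a..b}) (speed_within {a..b} \<gamma>)" by simp
qed

lemma has_integral_speed:
  assumes "C1_curve M \<A> a b \<gamma>" "a < b"
  shows "(speed \<A> g \<gamma> has_integral integral {a..b} (speed_within {a..b} \<gamma>)) {a..b}"
proof (rule has_integral_spike[of "{a, b}"])
  show "(speed_within {a..b} \<gamma> has_integral integral {a..b} (speed_within {a..b} \<gamma>)) {a..b}"
    by (intro integrable_integral integrable_continuous_real continuous_on_speed_within assms)
  show "speed \<A> g \<gamma> t = speed_within {a..b} \<gamma> t" if "t \<in> {a..b} - {a, b}" for t
    using that by (subst speed_within_interior) auto
qed simp

text \<open>The mean value inequality compares the composition of \<open>f\<close> with the curve
  against \<open>L\<close> times the arc length. The derivative of the composition is only
  estimated, never integrated, so the target space can be any normed space.\<close>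

lemma C1_curve_slope_bound:
  fixes f :: "'m \<Rightarrow> 'b::real_normed_vector"
  assumes C: "C1_curve M \<A> a b \<gamma>" and "a < b" and f: "\<And>x. x \<in> M \<Longrightarrow> slope_le f x L"
  shows "norm (f (\<gamma> b) - f (\<gamma> a)) \<le> L * integral {a..b} (speed \<A> g \<gamma>)"
proof -
  note \<gamma> = C1_curveD(1,2)[OF C]
  let ?\<sigma> = "speed_within {a..b} \<gamma>"
  note \<sigma> = continuous_on_speed_within[OF C \<open>a < b\<close>]
  have nb: "at s within {a..b} \<noteq> bot" if "s \<in> {a..b}" for s
    using that assms(2) by (simp add: trivial_limit_within islimpt_Icc)
  have "\<exists>D. ((f \<circ> \<gamma>) has_vector_derivative D) (at t within {a..b}) \<and> norm D \<le> L * ?\<sigma> t" if t: "t \<in> {a..b}" for t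
  proof -
    obtain c where c: "c \<in> \<A>" "\<gamma> t \<in> fst c" using exists_chart \<gamma> t by blast
    obtain v where v: "((snd c \<circ> \<gamma>) has_vector_derivative v) (at t within {a..b})"
      using C1_curveD(3)[OF C c(1)] t c(2) by blast
    obtain D where D: "((f \<circ> param c) has_derivative D) (at (snd c (\<gamma> t)))" "\<And>v. norm (D v) \<le> L * sqrt (g c (\<gamma> t) v v)"
      using slope_leE[OF f c] \<gamma>(2) t by blast
    have "((\<lambda>s. (f \<circ> param c) ((snd c \<circ> \<gamma>) s)) has_derivative (\<lambda>r. D (r *\<^sub>R v))) (at t within {a..b})"
      by (rule has_derivative_compose[OF v[unfolded has_vector_derivative_def]]) (use D(1) in \<open>simp only: o_apply[of "snd c" \<gamma>]\<close>)
    then have "((f \<circ> \<gamma>) has_derivative (\<lambda>r. D (r *\<^sub>R v))) (at t within {a..b})"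
    proof (rule has_derivative_transform_eventually)
      have "\<forall>\<^sub>F s in at t within {a..b}. \<gamma> s \<in> fst c"
        by (rule eventually_curve_in[OF \<gamma> t chart_openin[OF c(1)] c(2)])
      then show "\<forall>\<^sub>F s in at t within {a..b}. (f \<circ> param c) ((snd c \<circ> \<gamma>) s) = (f \<circ> \<gamma>) s"
        by eventually_elim (simp add: param_chart c)
    qed (use t c in \<open>simp_all add: param_chart\<close>)
    then have "((f \<circ> \<gamma>) has_vector_derivative D v) (at t within {a..b})"
      by (simp add: has_vector_derivative_def linear_scale[OF has_derivative_linear[OF D(1)]])
    then show ?thesis
      using D(2)[of v] speed_within_eq[OF \<gamma> t nb[OF t] c v] by auto
  qed
  then obtain F where F: "\<And>t. t \<in> {a..b} \<Longrightarrow> ((f \<circ> \<gamma>) has_vector_derivative F t) (at t within {a..b})"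
    "\<And>t. t \<in> {a..b} \<Longrightarrow> norm (F t) \<le> L * ?\<sigma> t" by metis
  have I: "((\<lambda>t. L * integral {a..t} ?\<sigma>) has_vector_derivative L * ?\<sigma> t) (at t within {a..b})" if "t \<in> {a..b}" for t
    by (rule has_vector_derivative_mult_right[OF integral_has_vector_derivative[OF \<sigma> that]])
  have "norm ((f \<circ> \<gamma>) b - (f \<circ> \<gamma>) a) \<le> L * integral {a..b} ?\<sigma> - L * integral {a..a} ?\<sigma>"
  proof (rule differentiable_bound_general[OF \<open>a < b\<close>])
    show "continuous_on {a..b} (f \<circ> \<gamma>)"
      using F(1) by (rule continuous_on_vector_derivative)
    show "continuous_on {a..b} (\<lambda>t. L * integral {a..t} ?\<sigma>)"
      using I by (rule continuous_on_vector_derivative)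
    show "((f \<circ> \<gamma>) has_vector_derivative F t) (at t)" if "a < t" "t < b" for t
      using F(1)[of t] that by (simp add: at_within_Icc_at)
    show "((\<lambda>t. L * integral {a..t} ?\<sigma>) has_vector_derivative L * ?\<sigma> t) (at t)" if "a < t" "t < b" for t
      using I[of t] that by (simp add: at_within_Icc_at)
    show "norm (F t) \<le> L * ?\<sigma> t" if "a < t" "t < b" for t
      using F(2)[of t] that by simp
  qed
  also have "integral {a..b} ?\<sigma> = integral {a..b} (speed \<A> g \<gamma>)"
    using integral_unique[OF has_integral_speed[OF C \<open>a < b\<close>]] by simp
  finally show ?thesis by simp
qed

lemma piecewise_C1_slope_bound:
  fixes f :: "'m \<Rightarrow> 'b::real_normed_vector"
  assumes "piecewise_C1_curve M \<A> \<gamma>" and f: "\<And>x. x \<in> M \<Longrightarrow> slope_le f x L"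
  shows "norm (f (\<gamma> 1) - f (\<gamma> 0)) \<le> L * curve_length \<A> g \<gamma>"
proof -
  obtain n \<tau> where \<tau>: "\<tau> 0 = 0" "\<tau> n = 1"
    "\<And>i. i < n \<Longrightarrow> \<tau> i < \<tau> (Suc i) \<and> C1_curve M \<A> (\<tau> i) (\<tau> (Suc i)) \<gamma>"
    using assms(1) by (auto simp: piecewise_C1_curve_def)
  \<comment> \<open>Existence of the integral up to \<open>\<tau> k\<close> is carried through the
    induction, since \<open>curve_length\<close> would take the default value 0 for a non-integrable
    speed.\<close>
  have "k \<le> n \<Longrightarrow> 0 \<le> \<tau> k \<and> (\<exists>I. (speed \<A> g \<gamma> has_integral I) {0..\<tau> k} \<and> norm (f (\<gamma> (\<tau> k)) - f (\<gamma> 0)) \<le> L * I)" for k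
  proof (induction k)
    case 0
    then show ?case using \<tau>(1) by (auto intro!: exI[of _ 0] has_integral_refl)
  next
    case (Suc k)
    then obtain I where I: "0 \<le> \<tau> k" "(speed \<A> g \<gamma> has_integral I) {0..\<tau> k}" "norm (f (\<gamma> (\<tau> k)) - f (\<gamma> 0)) \<le> L * I"
      by auto
    have k: "\<tau> k < \<tau> (Suc k)" "C1_curve M \<A> (\<tau> k) (\<tau> (Suc k)) \<gamma>" using \<tau>(3)[of k] Suc.prems by auto
    let ?J = "integral {\<tau> k..\<tau> (Suc k)} (speed \<A> g \<gamma>)"
    have "(speed \<A> g \<gamma> has_integral ?J) {\<tau> k..\<tau> (Suc k)}"
      using has_integral_speed[OF k(2,1)] by (auto intro: integrable_integral)
    then have "(speed \<A> g \<gamma> has_integral (I + ?J)) {0..\<tau> (Suc k)}"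
      using I k by (intro has_integral_combine[of 0 "\<tau> k"]) auto
    moreover have "norm (f (\<gamma> (\<tau> (Suc k))) - f (\<gamma> 0)) \<le> L * (I + ?J)"
      using norm_triangle_mono[OF C1_curve_slope_bound[OF k(2,1) f] I(3)] by (simp add: algebra_simps)
    ultimately show ?case using I(1) k(1) by (intro conjI) auto
  qed
  from this[of n] \<tau>(2) show ?thesis
    by (auto simp: curve_length_def integral_unique)
qed

end

section \<open>Piecewise smooth connectedness\<close>

lemma line_mem_closed_segment:
  fixes u w :: "'e::real_vector"
  assumes "t \<in> {0..1}"
  shows "u + t *\<^sub>R (w - u) \<in> closed_segment u w"
  unfolding closed_segment_def using assms by (auto simp: algebra_simps intro!: exI[of _ t])

context compact_riemannian
begin

lemma chart_segment_derivative:
  assumes c: "c \<in> \<A>" and seg: "closed_segment u w \<subseteq> snd c ` fst c" and t: "t \<in> {0..1}"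
  shows "((snd c \<circ> (\<lambda>t. param c (u + t *\<^sub>R (w - u)))) has_vector_derivative (w - u)) (at t within {0..1})"
proof -
  have "((\<lambda>t. u + t *\<^sub>R (w - u)) has_vector_derivative (w - u)) (at t within {0..1})"
    by (auto intro!: derivative_eq_intros)
  then show ?thesis
  proof (rule has_vector_derivative_transform[rotated 2])
    fix s :: real assume "s \<in> {0..1}"
    then have "u + s *\<^sub>R (w - u) \<in> snd c ` fst c"
      using seg line_mem_closed_segment by blast
    then show "(snd c \<circ> (\<lambda>t. param c (u + t *\<^sub>R (w - u)))) s = u + s *\<^sub>R (w - u)"
      by (simp add: f_inv_into_f)
  qed fact
qed

text \<open>The velocity has to be exhibited in every chart the segment meets; there it is the
  derivative of the transition map in the fixed direction \<open>w - u\<close>, hence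
  continuous.\<close>

lemma C1_chart_segment:
  assumes c: "c \<in> \<A>" and seg: "closed_segment u w \<subseteq> snd c ` fst c"
  shows "C1_curve M \<A> 0 1 (\<lambda>t. param c (u + t *\<^sub>R (w - u)))" (is "C1_curve M \<A> 0 1 ?\<gamma>")
proof -
  have mem: "u + t *\<^sub>R (w - u) \<in> snd c ` fst c" if "t \<in> {0..1}" for t
    using seg line_mem_closed_segment[OF that] by blast
  have cont: "continuous_on {0..1} ?\<gamma>"
    by (rule continuous_on_compose2[OF continuous_on_param[OF c]]) (use mem in \<open>auto intro!: continuous_intros\<close>)
  have sub: "?\<gamma> ` {0..1} \<subseteq> M"
  proof (rule image_subsetI)
    fix t :: real assume "t \<in> {0..1}"
    then show "?\<gamma> t \<in> M" using chart_subset[OF c] param_mem[OF mem] by blast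
  qed
  have "\<exists>D. continuous_on {t\<in>{0..1}. ?\<gamma> t \<in> fst d} D \<and>
      (\<forall>t\<in>{0..1}. ?\<gamma> t \<in> fst d \<longrightarrow> ((snd d \<circ> ?\<gamma>) has_vector_derivative D t) (at t within {0..1}))"
    if d: "d \<in> \<A>" for d
  proof (intro exI conjI ballI impI)
    let ?D = "\<lambda>t. frechet_derivative (transition c d) (at (u + t *\<^sub>R (w - u))) (w - u)"
    have "continuous_on (snd c ` (fst c \<inter> fst d)) (\<lambda>x. frechet_derivative (transition c d) (at x) (w - u))"
      by (rule Ck_on_imp_continuous_on[OF Ck_on_SucD(2)[OF Ck_on_transition[OF c d]]])
    moreover have "u + t *\<^sub>R (w - u) \<in> snd c ` (fst c \<inter> fst d)" if "t \<in> {0..1}" "?\<gamma> t \<in> fst d" for t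
      using mem[OF that(1)] that(2) chart_param[OF mem[OF that(1)]] param_mem[OF mem[OF that(1)]]
      by (intro image_eqI[of _ _ "?\<gamma> t"]) auto
    ultimately show "continuous_on {t\<in>{0..1}. ?\<gamma> t \<in> fst d} ?D"
      by (intro continuous_on_compose2[of "snd c ` (fst c \<inter> fst d)"
          "\<lambda>x. frechet_derivative (transition c d) (at x) (w - u)" _ "\<lambda>t. u + t *\<^sub>R (w - u)"])
        (auto intro!: continuous_intros)
    fix t :: real assume t: "t \<in> {0..1}" "?\<gamma> t \<in> fst d"
    show "((snd d \<circ> ?\<gamma>) has_vector_derivative ?D t) (at t within {0..1})"
      using curve_change_chart[OF cont sub t(1) c param_mem[OF mem[OF t(1)]] d t(2) chart_segment_derivative[OF c seg t(1)]]
      by (simp only: chart_param[OF mem[OF t(1)]])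
  qed
  with cont sub show ?thesis
    unfolding C1_curve_def split_beta by blast
qed

lemma piecewise_C1_chart_segment:
  assumes "c \<in> \<A>" "closed_segment u w \<subseteq> snd c ` fst c"
  shows "piecewise_C1_curve M \<A> (\<lambda>t. param c (u + t *\<^sub>R (w - u)))"
  unfolding piecewise_C1_curve_def
  by (rule exI[of _ 1], rule exI[of _ real]) (use C1_chart_segment[OF assms] in auto)

lemma curve_length_chart_segment:
  assumes c: "c \<in> \<A>" and seg: "closed_segment u w \<subseteq> snd c ` fst c"
    and B: "\<And>z. z \<in> closed_segment u w \<Longrightarrow> sqrt (g c (param c z) (w - u) (w - u)) \<le> B"
  shows "curve_length \<A> g (\<lambda>t. param c (u + t *\<^sub>R (w - u))) \<le> B"
proof -
  let ?\<gamma> = "\<lambda>t. param c (u + t *\<^sub>R (w - u))"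
  note C = C1_chart_segment[OF assms(1,2)]
  have "curve_length \<A> g ?\<gamma> = integral {0..1} (speed_within {0..1} ?\<gamma>)"
    unfolding curve_length_def by (rule integral_unique[OF has_integral_speed[OF C]]) simp
  also have "\<dots> \<le> integral {0..1::real} (\<lambda>_. B)"
  proof (rule Henstock_Kurzweil_Integration.integral_le)
    show "speed_within {0..1} ?\<gamma> integrable_on {0..1}"
      by (intro integrable_continuous_real continuous_on_speed_within C) simp
    fix t :: real assume t: "t \<in> {0..1}"
    have z: "u + t *\<^sub>R (w - u) \<in> closed_segment u w"
      by (rule line_mem_closed_segment[OF t])
    have "speed_within {0..1} ?\<gamma> t = sqrt (g c (?\<gamma> t) (w - u) (w - u))"
      using t z seg by (intro speed_within_eq[OF C1_curveD(1,2)[OF C]] c chart_segment_derivative param_mem)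
        (auto simp: trivial_limit_within islimpt_Icc)
    also have "\<dots> \<le> B" by (rule B[OF z])
    finally show "speed_within {0..1} ?\<gamma> t \<le> B" .
  qed auto
  finally show ?thesis by simp
qed

section \<open>Reparametrising and joining curves\<close>

lemma C1_curve_cong:
  assumes "C1_curve M \<A> a b \<gamma>" and eq: "\<And>t. t \<in> {a..b} \<Longrightarrow> \<gamma>' t = \<gamma> t"
  shows "C1_curve M \<A> a b \<gamma>'"
proof -
  note \<gamma> = C1_curveD[OF assms(1)]
  have "continuous_on {a..b} \<gamma>'" by (rule continuous_on_eq[OF \<gamma>(1)]) (simp add: eq)
  moreover have "\<gamma>' ` {a..b} \<subseteq> M" using \<gamma>(2) eq by auto
  moreover have "\<exists>D. continuous_on {t\<in>{a..b}. \<gamma>' t \<in> fst c} D \<and>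
        (\<forall>t\<in>{a..b}. \<gamma>' t \<in> fst c \<longrightarrow> ((snd c \<circ> \<gamma>') has_vector_derivative D t) (at t within {a..b}))"
    if "c \<in> \<A>" for c
  proof -
    obtain D where D: "continuous_on {t\<in>{a..b}. \<gamma> t \<in> fst c} D"
      "\<forall>t\<in>{a..b}. \<gamma> t \<in> fst c \<longrightarrow> ((snd c \<circ> \<gamma>) has_vector_derivative D t) (at t within {a..b})"
      using \<gamma>(3)[OF \<open>c \<in> \<A>\<close>] by blast
    have set: "{t\<in>{a..b}. \<gamma>' t \<in> fst c} = {t\<in>{a..b}. \<gamma> t \<in> fst c}" using eq by auto
    have "((snd c \<circ> \<gamma>') has_vector_derivative D t) (at t within {a..b})"
      if "t \<in> {a..b}" "\<gamma>' t \<in> fst c" for t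
      by (rule has_vector_derivative_transform[of _ _ _ "snd c \<circ> \<gamma>"]) (use that D(2) eq in auto)
    with D(1) show ?thesis unfolding set by blast
  qed
  ultimately show ?thesis unfolding C1_curve_def split_beta by blast
qed

lemma C1_curve_affine:
  assumes "C1_curve M \<A> (m * a + k) (m * b + k) \<gamma>" and m: "0 < m"
  shows "C1_curve M \<A> a b (\<lambda>t. \<gamma> (m * t + k))"
proof -
  note \<gamma> = C1_curveD[OF assms(1)]
  let ?h = "\<lambda>t. m * t + k" and ?S = "{m * a + k..m * b + k}"
  have h: "?h ` {a..b} \<subseteq> ?S" using m by auto
  have "continuous_on {a..b} (\<lambda>t. \<gamma> (?h t))"
    by (rule continuous_on_compose2[OF \<gamma>(1) _ h]) (intro continuous_intros)
  moreover have "(\<lambda>t. \<gamma> (?h t)) ` {a..b} \<subseteq> M" using \<gamma>(2) h by blast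
  moreover have "\<exists>D. continuous_on {t\<in>{a..b}. \<gamma> (?h t) \<in> fst c} D \<and>
      (\<forall>t\<in>{a..b}. \<gamma> (?h t) \<in> fst c \<longrightarrow> ((snd c \<circ> (\<lambda>t. \<gamma> (?h t))) has_vector_derivative D t) (at t within {a..b}))"
    if "c \<in> \<A>" for c
  proof -
    obtain D where D: "continuous_on {t\<in>?S. \<gamma> t \<in> fst c} D"
      "\<forall>t\<in>?S. \<gamma> t \<in> fst c \<longrightarrow> ((snd c \<circ> \<gamma>) has_vector_derivative D t) (at t within ?S)"
      using \<gamma>(3)[OF \<open>c \<in> \<A>\<close>] by blast
    have "continuous_on {t\<in>{a..b}. \<gamma> (?h t) \<in> fst c} (\<lambda>t. D (?h t))"
    proof (rule continuous_on_compose2[OF D(1)])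
      show "?h ` {t\<in>{a..b}. \<gamma> (?h t) \<in> fst c} \<subseteq> {t\<in>?S. \<gamma> t \<in> fst c}" using h by blast
    qed (intro continuous_intros)
    then have "continuous_on {t\<in>{a..b}. \<gamma> (?h t) \<in> fst c} (\<lambda>t. m *\<^sub>R D (?h t))"
      by (intro continuous_intros)
    moreover have "((snd c \<circ> (\<lambda>t. \<gamma> (?h t))) has_vector_derivative m *\<^sub>R D (?h t)) (at t within {a..b})"
      if "t \<in> {a..b}" "\<gamma> (?h t) \<in> fst c" for t
    proof -
      have "(?h has_vector_derivative m) (at t within {a..b})"
        by (auto intro!: derivative_eq_intros)
      moreover have "((snd c \<circ> \<gamma>) has_vector_derivative D (?h t)) (at (?h t) within ?h ` {a..b})"
      proof (rule has_vector_derivative_within_subset[OF _ h])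
        have "?h t \<in> ?S" using h that(1) by blast
        then show "((snd c \<circ> \<gamma>) has_vector_derivative D (?h t)) (at (?h t) within ?S)"
          using D(2) that(2) by blast
      qed
      ultimately have "((snd c \<circ> \<gamma>) \<circ> ?h has_vector_derivative m *\<^sub>R D (?h t)) (at t within {a..b})"
        by (rule vector_diff_chain_within)
      then show ?thesis by (simp add: o_def)
    qed
    ultimately show ?thesis by blast
  qed
  ultimately show ?thesis unfolding C1_curve_def split_beta by blast
qed

lemma partition_mono:
  fixes \<tau> :: "nat \<Rightarrow> real"
  assumes "\<And>i. i < n \<Longrightarrow> \<tau> i < \<tau> (Suc i)" "i \<le> j" "j \<le> n"
  shows "\<tau> i \<le> \<tau> j"
  using assms(2,3)
proof (induction j rule: dec_induct)
  case (step j)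
  then show ?case using assms(1)[of j] by simp
qed simp

lemma piecewise_C1_curve_join:
  assumes "piecewise_C1_curve M \<A> \<gamma>1" "piecewise_C1_curve M \<A> \<gamma>2" and eq: "\<gamma>1 1 = \<gamma>2 0"
  shows "piecewise_C1_curve M \<A> (\<lambda>t. if t \<le> 1/2 then \<gamma>1 (2 * t) else \<gamma>2 (2 * t - 1))"
    (is "piecewise_C1_curve M \<A> ?\<gamma>")
proof -
  obtain n \<tau> where \<tau>: "\<tau> 0 = 0" "\<tau> n = 1"
    "\<And>i. i < n \<Longrightarrow> \<tau> i < \<tau> (Suc i)" "\<And>i. i < n \<Longrightarrow> C1_curve M \<A> (\<tau> i) (\<tau> (Suc i)) \<gamma>1"
    using assms(1) by (auto simp: piecewise_C1_curve_def)
  obtain n' \<tau>' where \<tau>': "\<tau>' 0 = 0" "\<tau>' n' = 1"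
    "\<And>i. i < n' \<Longrightarrow> \<tau>' i < \<tau>' (Suc i)" "\<And>i. i < n' \<Longrightarrow> C1_curve M \<A> (\<tau>' i) (\<tau>' (Suc i)) \<gamma>2"
    using assms(2) by (auto simp: piecewise_C1_curve_def)
  \<comment> \<open>The first partition is squeezed into \<open>[0, 1/2]\<close>, the second into
    \<open>[1/2, 1]\<close>; both formulas give 1/2 at index \<open>n\<close>.\<close>
  define \<sigma> where "\<sigma> i = (if i \<le> n then \<tau> i / 2 else (1 + \<tau>' (i - n)) / 2)" for i
  have \<sigma>2: "\<sigma> i = (1 + \<tau>' (i - n)) / 2" if "n \<le> i" for i
    using that \<tau>(2) \<tau>'(1) by (auto simp: \<sigma>_def)
  have "\<sigma> i < \<sigma> (Suc i) \<and> C1_curve M \<A> (\<sigma> i) (\<sigma> (Suc i)) ?\<gamma>" if i: "i < n + n'" for i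
  proof (cases "i < n")
    case True
    then have s: "\<sigma> i = \<tau> i / 2" "\<sigma> (Suc i) = \<tau> (Suc i) / 2" by (auto simp: \<sigma>_def)
    have "\<tau> (Suc i) \<le> 1" using partition_mono[of n \<tau> "Suc i" n] \<tau>(2,3) True by simp
    moreover have "C1_curve M \<A> (\<sigma> i) (\<sigma> (Suc i)) (\<lambda>t. \<gamma>1 (2 * t + 0))"
    proof -
      have e: "2 * \<sigma> i + 0 = \<tau> i" "2 * \<sigma> (Suc i) + 0 = \<tau> (Suc i)" using s by auto
      show ?thesis by (rule C1_curve_affine, unfold e, rule \<tau>(4)[OF True]) simp
    qed
    ultimately show ?thesis
      using \<tau>(3)[OF True] by (auto intro: C1_curve_cong simp: s)
  next
    case False
    define j where "j = i - n"
    have j: "j < n'" "i - n = j" "Suc i - n = Suc j" using False i by (auto simp: j_def)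
    have s: "\<sigma> i = (1 + \<tau>' j) / 2" "\<sigma> (Suc i) = (1 + \<tau>' (Suc j)) / 2"
      using False j by (auto simp: \<sigma>2)
    have "0 \<le> \<tau>' j" using partition_mono[of n' \<tau>' 0 j] \<tau>'(1,3) j by simp
    then have ge: "1/2 \<le> \<sigma> i" by (simp add: s)
    have C: "C1_curve M \<A> (\<sigma> i) (\<sigma> (Suc i)) (\<lambda>t. \<gamma>2 (2 * t + - 1))"
    proof -
      have e: "2 * \<sigma> i + - 1 = \<tau>' j" "2 * \<sigma> (Suc i) + - 1 = \<tau>' (Suc j)" using s by auto
      show ?thesis by (rule C1_curve_affine, unfold e, rule \<tau>'(4)[OF j(1)]) simp
    qed
    \<comment> \<open>At \<open>t = 1/2\<close> the conditional selects the first curve, and the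
      matching endpoints make it agree with the second.\<close>
    have eq2: "?\<gamma> t = \<gamma>2 (2 * t + - 1)" if "1/2 \<le> t" for t
    proof (cases "t = 1/2")
      case True
      show ?thesis unfolding True using eq by simp
    qed (use that in simp)
    have "C1_curve M \<A> (\<sigma> i) (\<sigma> (Suc i)) ?\<gamma>"
      by (rule C1_curve_cong[OF C], rule eq2) (use ge in auto)
    then show ?thesis using \<tau>'(3)[OF j(1)] by (simp add: s)
  qed
  moreover have "\<sigma> 0 = 0" "\<sigma> (n + n') = 1" using \<tau>(1) \<tau>'(2) by (auto simp: \<sigma>_def[of 0] \<sigma>2)
  ultimately show ?thesis unfolding piecewise_C1_curve_def by blast
qed

lemma chart_ball:
  assumes "x \<in> M" "openin (top_of_set M) W" "x \<in> W"
  obtains c r where "c \<in> \<A>" "x \<in> fst c" "0 < r" "cball (snd c x) r \<subseteq> snd c ` (fst c \<inter> W)"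
proof -
  obtain c where c: "c \<in> \<A>" "x \<in> fst c" using exists_chart[OF assms(1)] by blast
  have "open (snd c ` (fst c \<inter> W))" using c assms by (intro open_chart_image openin_Int chart_openin) auto
  moreover have "snd c x \<in> snd c ` (fst c \<inter> W)" using c assms by auto
  ultimately show ?thesis using that[OF c] open_contains_cball by blast
qed

text \<open>The infimum defining the distance must range over a nonempty set before lower bounds can
  be proved. Chart balls are reachable from their centres along segments, so the classes of mutually
  reachable points are open.\<close>

lemma exists_piecewise_C1_curve:
  assumes "x \<in> M" "y \<in> M"
  shows "\<exists>\<gamma>. piecewise_C1_curve M \<A> \<gamma> \<and> \<gamma> 0 = x \<and> \<gamma> 1 = y"
proof -
  define P where "P x y \<longleftrightarrow> (\<exists>\<gamma>. piecewise_C1_curve M \<A> \<gamma> \<and> \<gamma> 0 = x \<and> \<gamma> 1 = y)" for x y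
  have trans: "P x z" if "P x y" "P y z" for x y z
  proof -
    obtain \<gamma>1 \<gamma>2 where "piecewise_C1_curve M \<A> \<gamma>1" "\<gamma>1 0 = x" "\<gamma>1 1 = y"
      "piecewise_C1_curve M \<A> \<gamma>2" "\<gamma>2 0 = y" "\<gamma>2 1 = z"
      using \<open>P x y\<close> \<open>P y z\<close> unfolding P_def by blast
    then show ?thesis unfolding P_def
      by (intro exI[of _ "\<lambda>t. if t \<le> 1/2 then \<gamma>1 (2 * t) else \<gamma>2 (2 * t - 1)"] conjI piecewise_C1_curve_join)
        simp_all
  qed
  have seg: "P (param c u) (param c w)" if "c \<in> \<A>" "closed_segment u w \<subseteq> snd c ` fst c" for c u w
    unfolding P_def using piecewise_C1_chart_segment[OF that]
    by (intro exI[of _ "\<lambda>t. param c (u + t *\<^sub>R (w - u))"]) auto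
  \<comment> \<open>Reachability is required in both directions, which makes the relation symmetric
    without reversing curves.\<close>
  have "P x y \<and> P y x"
  proof (rule connected_equivalence_relation[OF connected assms, of "\<lambda>x y. P x y \<and> P y x"])
    fix a assume a: "a \<in> M"
    obtain c r where c: "c \<in> \<A>" "a \<in> fst c" "0 < r" "cball (snd c a) r \<subseteq> snd c ` (fst c \<inter> M)"
      by (rule chart_ball[OF a openin_subtopology_self a])
    have sub: "ball (snd c a) r \<subseteq> snd c ` fst c" using c(4) ball_subset_cball by blast
    have "P a (param c u) \<and> P (param c u) a" if "u \<in> ball (snd c a) r" for u
    proof -
      have "closed_segment (snd c a) u \<subseteq> ball (snd c a) r"
        using that c(3) by (intro closed_segment_subset) auto
      then show ?thesis
        using seg[OF c(1), of "snd c a" u] seg[OF c(1), of u "snd c a"] sub c(1,2)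
        by (auto simp: param_chart closed_segment_commute)
    qed
    moreover have "a \<in> param c ` ball (snd c a) r"
      using c by (intro image_eqI[of _ _ "snd c a"]) (auto simp: param_chart)
    ultimately show "\<exists>T. openin (top_of_set M) T \<and> a \<in> T \<and> (\<forall>x\<in>T. P a x \<and> P x a)"
      using openin_param_image[OF c(1) open_ball sub] by blast
  next
    fix u v w
    show "P v u \<and> P u v" if "P u v \<and> P v u" using that by simp
    show "P u w \<and> P w u" if "P u v \<and> P v u" "P v w \<and> P w v"
      using that trans[of u v w] trans[of w v u] by simp
  qed
  then show ?thesis by (simp add: P_def)
qed

section \<open>The geodesic distance\<close>

lemma speed_nonneg: "\<gamma> t \<in> M \<Longrightarrow> 0 \<le> speed \<A> g \<gamma> t"
proof -
  assume "\<gamma> t \<in> M"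
  then obtain c where "c \<in> \<A> \<and> \<gamma> t \<in> fst c" using exists_chart by blast
  then have "(SOME c. c \<in> \<A> \<and> \<gamma> t \<in> fst c) \<in> \<A> \<and> \<gamma> t \<in> fst (SOME c. c \<in> \<A> \<and> \<gamma> t \<in> fst c)"
    by (rule someI)
  then show ?thesis unfolding speed_def Let_def by (intro real_sqrt_ge_zero metric_nonneg) auto
qed

lemma piecewise_C1_curve_image:
  assumes "piecewise_C1_curve M \<A> \<gamma>" "t \<in> {0..1}"
  shows "\<gamma> t \<in> M"
proof -
  obtain n \<tau> where \<tau>: "\<tau> 0 = 0" "\<tau> n = 1" "\<And>i. i < n \<Longrightarrow> C1_curve M \<A> (\<tau> i) (\<tau> (Suc i)) \<gamma>"
    using assms(1) by (auto simp: piecewise_C1_curve_def)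
  have *: "k \<le> n \<Longrightarrow> 0 < k \<Longrightarrow> t \<in> {0..\<tau> k} \<Longrightarrow> \<gamma> t \<in> M" for k
  proof (induction k)
    case (Suc k)
    have *: "\<gamma> ` {\<tau> k..\<tau> (Suc k)} \<subseteq> M" using \<tau>(3)[of k] Suc.prems C1_curveD(2) by auto
    show ?case
    proof (cases "\<tau> k \<le> t")
      case True then show ?thesis using * Suc.prems by auto
    next
      case False
      then have "0 < k" using \<tau>(1) Suc.prems by (cases k) auto
      then show ?thesis using Suc False by auto
    qed
  qed simp
  have "0 < n" using \<tau>(1,2) by (cases n) auto
  then show ?thesis using *[of n] assms(2) \<tau>(2) by simp
qed

text \<open>This bounds the set of lengths from below, as the infimum requires. The second case
  rests on the value 0 that \<open>integral\<close> has for non-integrable functions.\<close>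

lemma curve_length_nonneg:
  assumes "piecewise_C1_curve M \<A> \<gamma>"
  shows "0 \<le> curve_length \<A> g \<gamma>"
proof (cases "speed \<A> g \<gamma> integrable_on {0..1}")
  case True
  then show ?thesis unfolding curve_length_def
    by (rule integral_nonneg) (intro speed_nonneg piecewise_C1_curve_image[OF assms])
qed (simp add: curve_length_def not_integrable_integral)

lemma geodesic_dist_le:
  assumes "piecewise_C1_curve M \<A> \<gamma>"
  shows "geodesic_dist M \<A> g (\<gamma> 0) (\<gamma> 1) \<le> curve_length \<A> g \<gamma>"
  unfolding geodesic_dist_def
  by (rule cInf_lower) (use assms in \<open>auto intro!: bdd_belowI[of _ 0] curve_length_nonneg\<close>)

text \<open>The source of upper bounds for the distance: it turns a Lipschitz condition on
  \<open>p\<close> into an estimate in coordinates.\<close>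

lemma geodesic_dist_chart_segment:
  assumes "c \<in> \<A>" "closed_segment u w \<subseteq> snd c ` fst c"
    and "\<And>z. z \<in> closed_segment u w \<Longrightarrow> sqrt (g c (param c z) (w - u) (w - u)) \<le> B"
  shows "geodesic_dist M \<A> g (param c u) (param c w) \<le> B"
  using geodesic_dist_le[OF piecewise_C1_chart_segment[OF assms(1,2)]] curve_length_chart_segment[OF assms] by simp

text \<open>The slope bound is integrated along each admissible curve before the infimum is taken.
  Read for a fixed \<open>f\<close>, it bounds the distance from below.\<close>

lemma slope_le_lipschitz:
  fixes f :: "'m \<Rightarrow> 'b::real_normed_vector"
  assumes "\<And>x. x \<in> M \<Longrightarrow> slope_le f x L" "0 < L" "x \<in> M" "y \<in> M"
  shows "norm (f x - f y) \<le> L * geodesic_dist M \<A> g x y"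
proof -
  have "norm (f x - f y) / L \<le> geodesic_dist M \<A> g x y"
    unfolding geodesic_dist_def
  proof (rule cInf_greatest)
    show "{curve_length \<A> g \<gamma> |\<gamma>. piecewise_C1_curve M \<A> \<gamma> \<and> \<gamma> 0 = x \<and> \<gamma> 1 = y} \<noteq> {}"
      using exists_piecewise_C1_curve[OF assms(3,4)] by blast
    fix l assume "l \<in> {curve_length \<A> g \<gamma> |\<gamma>. piecewise_C1_curve M \<A> \<gamma> \<and> \<gamma> 0 = x \<and> \<gamma> 1 = y}"
    then obtain \<gamma> where "piecewise_C1_curve M \<A> \<gamma>" "\<gamma> 0 = x" "\<gamma> 1 = y" "l = curve_length \<A> g \<gamma>" by blast
    then show "norm (f x - f y) / L \<le> l"
      using piecewise_C1_slope_bound[of \<gamma> f L] assms(1,2) by (simp add: norm_minus_commute field_simps)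
  qed
  then show ?thesis using assms(2) by (simp add: field_simps)
qed

section \<open>Smooth functions on the manifold\<close>

definition smooth_fun :: "('m \<Rightarrow> 'b::real_normed_vector) \<Rightarrow> bool" where
  "smooth_fun f \<longleftrightarrow> (\<forall>c\<in>\<A>. smooth_on (snd c ` fst c) (f \<circ> param c))"

lemma smooth_fun_Ck: "smooth_fun f \<longleftrightarrow> (\<forall>c\<in>\<A>. \<forall>k. Ck_on k (snd c ` fst c) (\<lambda>u. f (param c u)))"
  by (simp add: smooth_fun_def smooth_on_def o_def)

lemma smooth_fun_sum: "(\<And>i. i \<in> I \<Longrightarrow> smooth_fun (f i)) \<Longrightarrow> smooth_fun (\<lambda>x. \<Sum>i\<in>I. f i x)"
  unfolding smooth_fun_Ck by (intro ballI allI Ck_on_sum chart_open) auto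

lemma smooth_fun_scaleR: "smooth_fun a \<Longrightarrow> smooth_fun f \<Longrightarrow> smooth_fun (\<lambda>x. a x *\<^sub>R f x)"
  unfolding smooth_fun_Ck by (intro ballI allI Ck_on_scaleR chart_open) auto

lemma smooth_fun_inverse:
  assumes "smooth_fun a" "\<And>x. x \<in> M \<Longrightarrow> a x \<noteq> (0::real)"
  shows "smooth_fun (\<lambda>x. inverse (a x))"
  unfolding smooth_fun_Ck
proof (intro ballI allI Ck_on_inverse chart_open)
  fix c k u assume c: "c \<in> \<A>"
  show "Ck_on k (snd c ` fst c) (\<lambda>u. a (param c u))" using assms(1) c unfolding smooth_fun_Ck by blast
  show "a (param c u) \<noteq> 0" if "u \<in> snd c ` fst c"
    using chart_subset[OF c] param_mem[OF that] by (intro assms(2)) auto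
qed

lemma continuous_on_smooth_fun:
  assumes "smooth_fun f"
  shows "continuous_on M f"
proof (unfold continuous_on_eq_continuous_within, intro ballI)
  fix x assume "x \<in> M"
  then obtain c where c: "c \<in> \<A>" "x \<in> fst c" using exists_chart by blast
  obtain T where T: "open T" "fst c = M \<inter> T" using chart_openin[OF c(1)] by (auto simp: openin_open)
  have "continuous_on (snd c ` fst c) (\<lambda>u. f (param c u))"
    using assms c(1) Ck_on_imp_continuous_on unfolding smooth_fun_Ck by blast
  then have "continuous_on (fst c) (\<lambda>y. f (param c (snd c y)))"
    by (rule continuous_on_compose2[OF _ continuous_on_chart[OF c(1)]]) simp
  then have "continuous_on (fst c) f" by (rule continuous_on_eq) (simp add: param_chart c(1))
  then have "continuous (at x within fst c) f" using c(2) by (simp add: continuous_on_eq_continuous_within)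
  moreover have "at x within fst c = at x within M"
    by (rule at_within_nhd[of _ T]) (use c T in auto)
  ultimately show "continuous (at x within M) f" by simp
qed

section \<open>Extension by zero, and slopes on a compact manifold\<close>

definition extend_by_zero :: "('m, 'e) chart \<Rightarrow> ('e \<Rightarrow> 'b::real_normed_vector) \<Rightarrow> 'm \<Rightarrow> 'b" where
  "extend_by_zero c h x = (if x \<in> fst c then h (snd c x) else 0)"

lemma extend_by_zero_param: "c \<in> \<A> \<Longrightarrow> u \<in> snd c ` fst c \<Longrightarrow> extend_by_zero c h (param c u) = h u"
  by (simp add: extend_by_zero_def param_mem chart_param)

lemma openin_diff_param_image:
  assumes "c \<in> \<A>" "compact K" "K \<subseteq> snd c ` fst c"
  shows "openin (top_of_set M) (M - param c ` K)"
proof -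
  have "compact (param c ` K)"
    using assms continuous_on_param by (blast intro: compact_continuous_image continuous_on_subset)
  then have "open (- (param c ` K))" using compact_imp_closed by auto
  then show ?thesis by (simp add: Diff_eq openin_open_Int)
qed

lemma extend_by_zero_outside:
  assumes "c \<in> \<A>" "\<And>u. u \<notin> K \<Longrightarrow> h u = 0" "x \<notin> param c ` K"
  shows "extend_by_zero c h x = 0"
  using assms param_chart[of c x] by (auto simp: extend_by_zero_def) (metis image_eqI)

text \<open>Two open sets cover \<open>M\<close>: the chart domain, where the function is
  \<open>h\<close> after a transition map, and the complement of the image of \<open>K\<close>,
  where it is 0. The second is open because a compact subset of a Hausdorff space is closed.\<close>

lemma smooth_fun_extend_by_zero:
  assumes c: "c \<in> \<A>" and h: "smooth_on UNIV h" and K: "compact K" "K \<subseteq> snd c ` fst c"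
    and supp: "\<And>u. u \<notin> K \<Longrightarrow> h u = 0"
  shows "smooth_fun (extend_by_zero c h)"
  unfolding smooth_fun_Ck
proof (intro ballI allI Ck_on_local)
  fix d k u assume d: "d \<in> \<A>" and u: "u \<in> snd d ` fst d"
  show "\<exists>T. open T \<and> u \<in> T \<and> Ck_on k T (\<lambda>u. extend_by_zero c h (param d u))"
  proof (cases "param d u \<in> fst c")
    case True
    let ?T = "snd d ` (fst d \<inter> fst c)"
    have T: "open ?T" by (rule open_overlap[OF d c])
    have "Ck_on k ?T (\<lambda>u. h (transition d c u))"
      by (rule Ck_on_compose[OF T open_UNIV _ Ck_on_transition[OF d c]]) (use h in \<open>auto simp: smooth_on_def\<close>)
    then have "Ck_on k ?T (\<lambda>u. extend_by_zero c h (param d u))"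
      by (rule Ck_on_cong[OF T, rotated])
        (use d in \<open>auto simp: extend_by_zero_def transition_chart param_chart\<close>)
    moreover have "u \<in> ?T" using True u param_mem[OF u] chart_param[OF u] by (intro image_eqI[of _ _ "param d u"]) auto
    ultimately show ?thesis using T by blast
  next
    case False
    let ?T = "snd d ` (fst d \<inter> (M - param c ` K))"
    have T: "open ?T"
      using d by (intro open_chart_image openin_Int chart_openin openin_diff_param_image c K) auto
    have "Ck_on k ?T (\<lambda>u. extend_by_zero c h (param d u))"
      by (rule Ck_on_cong[OF T _ Ck_on_const[of _ _ 0]])
        (use d extend_by_zero_outside[OF c supp] in \<open>auto simp: param_chart\<close>)
    moreover have "u \<in> ?T"
    proof (intro image_eqI[of _ _ "param d u"])
      have "param c ` K \<subseteq> fst c" using K(2) by (auto intro: param_mem)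
      then show "param d u \<in> fst d \<inter> (M - param c ` K)"
        using False param_mem[OF u] chart_subset[OF d] by auto
    qed (simp add: chart_param[OF u])
    ultimately show ?thesis using T by blast
  qed
qed

lemma finite_subcover:
  assumes "\<And>x. x \<in> M \<Longrightarrow> openin (top_of_set M) (V x) \<and> x \<in> V x"
  obtains X where "X \<subseteq> M" "finite X" "M \<subseteq> (\<Union>x\<in>X. V x)"
proof -
  have "\<exists>D\<subseteq>V ` M. finite D \<and> M \<subseteq> \<Union>D"
    using compact unfolding compact_eq_openin_cover
    by (elim allE[of _ "V ` M"]) (use assms in blast)
  then show ?thesis using finite_subset_image that by metis
qed

text \<open>On a compact chart ball the partial derivatives are bounded by \<open>B\<close> and the
  metric is at least \<open>m\<close> times the Euclidean norm, so the slope is at most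
  \<open>B / m\<close>; finitely many such balls cover \<open>M\<close>.\<close>

lemma smooth_fun_slope_le:
  assumes f: "smooth_fun f"
  obtains C where "0 < C" "\<And>x. x \<in> M \<Longrightarrow> slope_le f x C"
proof -
  have "\<exists>V C. openin (top_of_set M) V \<and> x \<in> V \<and> (\<forall>y\<in>V. slope_le f y C)" if x: "x \<in> M" for x
  proof -
    obtain c r where c: "c \<in> \<A>" "x \<in> fst c" "0 < r" "cball (snd c x) r \<subseteq> snd c ` (fst c \<inter> M)"
      by (rule chart_ball[OF x openin_subtopology_self x])
    let ?K = "cball (snd c x) r"
    have K: "?K \<subseteq> snd c ` fst c" using c(4) by auto
    obtain m where m: "0 < m" "\<And>u v. u \<in> ?K \<Longrightarrow> m * norm v \<le> sqrt (g c (param c u) v v)"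
      using metric_lower_bound[OF c(1) compact_cball K] by metis
    let ?D = "\<lambda>u. frechet_derivative (f \<circ> param c) (at u)"
    have C1: "Ck_on (Suc 0) (snd c ` fst c) (f \<circ> param c)"
      using f c(1) unfolding smooth_fun_def smooth_on_def by blast
    have "continuous_on ?K (\<lambda>u. \<Sum>i\<in>Basis. norm (?D u i))"
      by (intro continuous_on_sum continuous_on_norm continuous_on_subset[OF _ K]
          Ck_on_imp_continuous_on[OF Ck_on_SucD(2)[OF C1]])
    then have "bounded ((\<lambda>u. \<Sum>i\<in>Basis. norm (?D u i)) ` ?K)"
      by (intro compact_imp_bounded compact_continuous_image) auto
    then obtain B where B0: "\<forall>s\<in>(\<lambda>u. \<Sum>i\<in>Basis. norm (?D u i)) ` ?K. \<bar>s\<bar> \<le> B"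
      unfolding bounded_real by blast
    have B: "(\<Sum>i\<in>Basis. norm (?D u i)) \<le> B" if "u \<in> ?K" for u
      by (rule abs_le_D1[OF bspec[OF B0 imageI[OF that]]])
    have "slope_le f (param c u) (B / m)" if u: "u \<in> ?K" for u
    proof (rule slope_leI[OF c(1)])
      have us: "u \<in> snd c ` fst c" using u K by blast
      then show "param c u \<in> fst c" by (rule param_mem)
      show D: "((f \<circ> param c) has_derivative ?D u) (at (snd c (param c u)))"
        using Ck_on_SucD(1)[OF C1 us] by (simp add: chart_param[OF us])
      fix v
      have lin: "linear (?D u)" using D by (rule has_derivative_linear)
      have "norm (?D u v) = norm (\<Sum>i\<in>Basis. (v \<bullet> i) *\<^sub>R ?D u i)"
        by (subst (1) euclidean_representation[of v, symmetric])
          (simp only: linear_sum[OF lin] linear_scale[OF lin])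
      also have "\<dots> \<le> (\<Sum>i\<in>Basis. norm v * norm (?D u i))"
        by (intro order_trans[OF norm_sum] sum_mono) (auto intro: mult_right_mono Basis_le_norm)
      also have "\<dots> \<le> norm v * B"
        using B[OF u] by (simp add: mult_left_mono flip: sum_distrib_left)
      also have "\<dots> = (B / m) * (m * norm v)" using m(1) by simp
      also have "\<dots> \<le> (B / m) * sqrt (g c (param c u) v v)"
      proof (intro mult_left_mono m(2) u)
        have "0 \<le> B" by (rule order_trans[OF sum_nonneg B[OF u]]) simp
        then show "0 \<le> B / m" using m(1) by simp
      qed
      finally show "norm (?D u v) \<le> (B / m) * sqrt (g c (param c u) v v)" .
    qed
    moreover have "openin (top_of_set M) (param c ` ball (snd c x) r)"
      using K by (intro openin_param_image c) (auto simp: subset_iff)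
    moreover have "x \<in> param c ` ball (snd c x) r"
      using c by (intro image_eqI[of _ _ "snd c x"]) (auto simp: param_chart)
    ultimately show ?thesis
      by (intro exI[of _ "param c ` ball (snd c x) r"] exI[of _ "B / m"]) auto
  qed
  then obtain V C where VC: "\<And>x. x \<in> M \<Longrightarrow> openin (top_of_set M) (V x) \<and> x \<in> V x"
    "\<And>x y. x \<in> M \<Longrightarrow> y \<in> V x \<Longrightarrow> slope_le f y (C x)"
    by metis
  obtain X where X: "X \<subseteq> M" "finite X" "M \<subseteq> (\<Union>x\<in>X. V x)"
    using finite_subcover[OF VC(1)] by blast
  show ?thesis
  proof
    \<comment> \<open>Inserting 1 makes the bound positive and the maximum meaningful even if
      \<open>X\<close> is empty.\<close>
    show "0 < Max (insert 1 (C ` X))" using X(2) by (simp add: Max_gr_iff)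
    fix y assume "y \<in> M"
    then obtain x where x: "x \<in> X" "y \<in> V x" using X(3) by blast
    have "C x \<le> Max (insert 1 (C ` X))" using X(2) x(1) by (intro Max_ge) auto
    then show "slope_le f y (Max (insert 1 (C ` X)))"
      using VC(2)[of x y] x X(1) slope_le_mono by blast
  qed
qed

text \<open>Needed because the quotient in the Lipschitz constant is \<open>0\<close> where the distance is \<open>0\<close>.
  A bump function separating the two points is Lipschitz.\<close>

lemma geodesic_dist_pos:
  assumes "x \<in> M" "y \<in> M" "x \<noteq> y"
  shows "0 < geodesic_dist M \<A> g x y"
proof -
  have "openin (top_of_set M) (M \<inter> - {y})" by (intro openin_open_Int) auto
  then obtain c r where c: "c \<in> \<A>" "x \<in> fst c" "0 < r" "cball (snd c x) r \<subseteq> snd c ` (fst c \<inter> (M \<inter> - {y}))"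
    using chart_ball[OF assms(1)] assms by blast
  \<comment> \<open>Inner radius 0: the bump has to equal 1 only at \<open>x\<close> itself.\<close>
  obtain \<beta> :: "'e \<Rightarrow> real" where \<beta>: "smooth_on UNIV \<beta>" "\<And>u. u \<in> cball (snd c x) 0 \<Longrightarrow> \<beta> u = 1"
    "\<And>u. u \<notin> ball (snd c x) r \<Longrightarrow> \<beta> u = 0"
    using smooth_bump[of 0 r "snd c x"] c(3) by (metis order_refl)
  let ?h = "extend_by_zero c \<beta>"
  have "smooth_fun ?h"
    by (rule smooth_fun_extend_by_zero[OF c(1) \<beta>(1) compact_cball[of "snd c x" r]]) (use c(4) \<beta>(3) in auto)
  then obtain C where C: "0 < C" "\<And>z. z \<in> M \<Longrightarrow> slope_le ?h z C" using smooth_fun_slope_le by blast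
  have "y \<notin> param c ` cball (snd c x) r"
  proof
    assume "y \<in> param c ` cball (snd c x) r"
    then obtain z where "z \<in> fst c" "z \<noteq> y" "y = param c (snd c z)" using c(4) by blast
    then show False using param_chart[OF c(1)] by auto
  qed
  then have "?h y = 0" by (intro extend_by_zero_outside[OF c(1), of "cball (snd c x) r"]) (use \<beta>(3) in auto)
  moreover have "?h x = 1" using c(2) \<beta>(2) by (simp add: extend_by_zero_def)
  ultimately have "1 \<le> C * geodesic_dist M \<A> g x y"
    using slope_le_lipschitz[OF C(2,1) assms(1,2)] by simp
  then show ?thesis using C(1) by (smt (verit) mult_nonneg_nonpos)
qed

end

section \<open>Smooth approximation on the manifold\<close>

text \<open>One-sided difference quotients in the direction \<open>v\<close> bound the derivative
  there. This converts the increment estimate for a mollified function into an estimate of its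
  differential.\<close>

lemma has_derivative_norm_le:
  assumes D: "(F has_derivative D) (at z)" and "0 < t0"
    and le: "\<And>t. 0 < t \<Longrightarrow> t < t0 \<Longrightarrow> norm (F (z + t *\<^sub>R v) - F z) \<le> t * K"
  shows "norm (D v) \<le> K"
proof (rule field_le_epsilon)
  fix e :: real assume "0 < e"
  \<comment> \<open>Adding 1 keeps the denominator positive when \<open>v = 0\<close>.\<close>
  define e' where "e' = e / (norm v + 1)"
  have v1: "0 < norm v + 1" by (simp add: add_nonneg_pos)
  have e': "0 < e'" "e' * norm v \<le> e"
    using \<open>0 < e\<close> v1 by (auto simp: e'_def field_simps)
  obtain d where d: "0 < d" "\<And>y. norm (y - z) < d \<Longrightarrow> norm (F y - F z - D (y - z)) \<le> e' * norm (y - z)"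
    using D e'(1) unfolding has_derivative_at_alt by blast
  define t where "t = min (t0 / 2) (d / (2 * (norm v + 1)))"
  have t: "0 < t" "t < t0" using assms(2) d(1) v1 by (auto simp: t_def)
  have "t * norm v \<le> d / (2 * (norm v + 1)) * (norm v + 1)"
    using t(1) by (intro mult_mono) (auto simp: t_def d(1) less_imp_le)
  also have "\<dots> = d / 2"
  proof -
    have "norm v + 1 \<noteq> 0" using v1 by linarith
    then show ?thesis unfolding divide_divide_eq_left'[symmetric] by (metis nonzero_divide_eq_eq divide_divide_eq_left mult.commute)
  qed
  also have "\<dots> < d" using d(1) by simp
  finally have "norm (F (z + t *\<^sub>R v) - F z - D (t *\<^sub>R v)) \<le> e' * (t * norm v)"
    using d(2)[of "z + t *\<^sub>R v"] t(1) by simp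
  then have "norm (D (t *\<^sub>R v)) \<le> t * K + e' * (t * norm v)"
    using le[OF t] norm_triangle_sub[of "D (t *\<^sub>R v)" "F (z + t *\<^sub>R v) - F z"]
    by (simp add: norm_minus_commute)
  then have "t * norm (D v) \<le> t * (K + e' * norm v)"
    using t(1) by (simp add: linear_scale[OF has_derivative_linear[OF D]] algebra_simps)
  then have "norm (D v) \<le> K + e' * norm v" using t(1) by simp
  then show "norm (D v) \<le> K + e" using e'(2) by simp
qed

context compact_riemannian
begin

text \<open>An increment of \<open>F\<close> averages increments of \<open>P\<close> between equally
  shifted points. Each of these is at most \<open>L\<close> times the length of the chart segment
  joining the points, and along it the metric exceeds the metric at \<open>z\<close> by at most the
  factor \<open>1 + \<eta>\<close>. The function \<open>F\<close> does not depend on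
  \<open>L\<close>.\<close>

lemma local_mollification:
  fixes p :: "'m \<Rightarrow> 'b::banach"
  assumes p: "continuous_on M p" and B: "subspace B" "closed B" "p ` M \<subseteq> B" and "0 < \<eta>"
    and c: "c \<in> \<A>" and "0 < r" and sub: "cube u (4 * r) \<subseteq> snd c ` fst c"
  obtains F where "smooth_on UNIV F" "\<And>z. F z \<in> B"
    "\<And>z. z \<in> ball u (3 * r) \<Longrightarrow> norm (F z - p (param c z)) \<le> \<eta>"
    "\<And>L z D v. 0 \<le> L \<Longrightarrow> (\<And>x y. x \<in> M \<Longrightarrow> y \<in> M \<Longrightarrow> norm (p x - p y) \<le> L * geodesic_dist M \<A> g x y) \<Longrightarrow>
      z \<in> ball u (3 * r) \<Longrightarrow> (F has_derivative D) (at z) \<Longrightarrow>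
      norm (D v) \<le> L * (1 + \<eta>) * sqrt (g c (param c z) v v)"
proof -
  let ?K = "cube u (4 * r)"
  have ball: "ball u (4 * r) \<subseteq> ?K" using ball_subset_cube ball_subset_cball by blast
  have mem: "param c z \<in> M" if "z \<in> ?K" for z
    using param_mem[OF subsetD[OF sub that]] chart_subset[OF c] by blast
  have cp: "continuous_on ?K (\<lambda>z. p (param c z))"
    by (rule continuous_on_compose2[OF p continuous_on_subset[OF continuous_on_param[OF c] sub]])
      (use mem in auto)
  \<comment> \<open>Mollification needs a function on the whole space. The extension clamps the
    argument to the cube, so it stays continuous and takes no values outside
    \<open>B\<close>.\<close>
  define P where "P = ext_cont (\<lambda>z. p (param c z)) (u - (4 * r) *\<^sub>R One) (u + (4 * r) *\<^sub>R One)"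
  have P: "continuous_on UNIV P"
    unfolding P_def using cp by (intro continuous_on_ext_cont) (simp add: cube_def)
  have Peq: "P z = p (param c z)" if "z \<in> ?K" for z
    using that unfolding P_def cube_def by simp
  have "P z \<in> B" for z
  proof -
    have "clamp (u - (4 * r) *\<^sub>R One) (u + (4 * r) *\<^sub>R One) z \<in> ?K"
      unfolding cube_def using \<open>0 < r\<close> by (intro clamp_in_interval) (simp add: inner_diff_left inner_add_left)
    then show ?thesis unfolding P_def ext_cont_def using B(3) mem by auto
  qed
  then have PB: "range P \<subseteq> B" by blast
  have "uniformly_continuous_on ?K (\<lambda>z. p (param c z))"
    by (rule compact_uniformly_continuous[OF cp compact_cube])
  then obtain \<delta>1 where \<delta>1: "0 < \<delta>1"
    "\<And>x y. x \<in> ?K \<Longrightarrow> y \<in> ?K \<Longrightarrow> dist y x < \<delta>1 \<Longrightarrow> dist (p (param c y)) (p (param c x)) < \<eta>"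
    using \<open>0 < \<eta>\<close> unfolding uniformly_continuous_on_def by meson
  obtain \<delta>2 where \<delta>2: "0 < \<delta>2" "\<And>x y v. x \<in> ?K \<Longrightarrow> y \<in> ?K \<Longrightarrow> dist x y < \<delta>2 \<Longrightarrow>
      sqrt (g c (param c y) v v) \<le> (1 + \<eta>) * sqrt (g c (param c x) v v)"
    using metric_comparison[OF c compact_cube sub \<open>0 < \<eta>\<close>] by metis
  \<comment> \<open>The points \<open>z - w\<close> and \<open>z + t v - w\<close> lie within
    \<open>2 \<delta>\<close> of \<open>z\<close>, being displaced by at most two vectors shorter
    than \<delta>. Hence the halves: \<open>2 \<delta> \<le> r\<close> keeps them inside the cube,
    and \<open>2 \<delta> \<le> \<delta>2\<close> lets the metrics be compared.\<close>
  define \<delta> where "\<delta> = min (r / 2) (min \<delta>1 (\<delta>2 / 2))"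
  have \<delta>: "0 < \<delta>" "\<delta> \<le> r / 2" "\<delta> \<le> \<delta>1" "2 * \<delta> \<le> \<delta>2"
    using \<open>0 < r\<close> \<delta>1(1) \<delta>2(1) by (auto simp: \<delta>_def min_def)
  obtain F where F: "smooth_on UNIV F"
    "\<And>B z. subspace B \<Longrightarrow> closed B \<Longrightarrow> range P \<subseteq> B \<Longrightarrow> F z \<in> B"
    "\<And>z y C. (\<And>w. norm w < \<delta> \<Longrightarrow> norm (P (z - w) - y) \<le> C) \<Longrightarrow> norm (F z - y) \<le> C"
    "\<And>z z' C. (\<And>w. norm w < \<delta> \<Longrightarrow> norm (P (z - w) - P (z' - w)) \<le> C) \<Longrightarrow> norm (F z - F z') \<le> C"
    using smooth_approximation[OF P \<delta>(1)] by metis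
  have near: "y \<in> ball u (4 * r)" if "z \<in> ball u (3 * r)" "dist z y < 2 * \<delta>" for y z
    using that \<delta>(2) dist_triangle[of u y z] by simp
  show ?thesis
  proof
    show "smooth_on UNIV F" by fact
    show "F z \<in> B" for z by (rule F(2)[OF B(1,2) PB])
    show "norm (F z - p (param c z)) \<le> \<eta>" if z: "z \<in> ball u (3 * r)" for z
    proof (rule F(3))
      fix w :: 'e assume w: "norm w < \<delta>"
      then have "z - w \<in> ?K" "z \<in> ?K"
        using near[OF z, of "z - w"] near[OF z, of z] \<delta>(1) ball by (auto simp: dist_norm)
      then show "norm (P (z - w) - p (param c z)) \<le> \<eta>"
        using \<delta>1(2)[of z "z - w"] w \<delta>(3) by (simp add: Peq dist_norm)
    qed
    fix L z D v
    assume L: "0 \<le> L" and lip: "\<And>x y. x \<in> M \<Longrightarrow> y \<in> M \<Longrightarrow> norm (p x - p y) \<le> L * geodesic_dist M \<A> g x y"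
      and z: "z \<in> ball u (3 * r)" and D: "(F has_derivative D) (at z)"
    let ?G = "sqrt (g c (param c z) v v)"
    have zK: "z \<in> ?K" using near[OF z, of z] \<delta>(1) ball by auto
    show "norm (D v) \<le> L * (1 + \<eta>) * ?G"
    proof (rule has_derivative_norm_le[OF D])
      have v1: "0 < norm v + 1" by (simp add: add_nonneg_pos)
      then show "0 < \<delta> / (norm v + 1)" using \<delta>(1) by simp
      fix t assume t: "0 < t" "t < \<delta> / (norm v + 1)"
      then have "t * (norm v + 1) < \<delta>" using v1 by (simp add: field_simps)
      then have tv: "t * norm v < \<delta>" using t(1) by (simp add: algebra_simps)
      show "norm (F (z + t *\<^sub>R v) - F z) \<le> t * (L * (1 + \<eta>) * ?G)"
      proof (rule F(4))
        fix w :: 'e assume w: "norm w < \<delta>"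
        let ?a = "z + t *\<^sub>R v - w" and ?b = "z - w"
        have "dist z ?a \<le> t * norm v + norm w"
          using norm_triangle_ineq4[of w "t *\<^sub>R v"] t(1) by (simp add: dist_norm algebra_simps)
        then have ab: "?a \<in> ball z (2 * \<delta>)" "?b \<in> ball z (2 * \<delta>)" using w tv \<delta>(1) by (auto simp: dist_norm)
        then have "closed_segment ?b ?a \<subseteq> ball z (2 * \<delta>)" by (intro closed_segment_subset) auto
        then have segK: "y \<in> ?K" "dist z y < \<delta>2" if "y \<in> closed_segment ?b ?a" for y
          using that near[OF z] ball \<delta>(4) by (auto simp: subset_iff)
        have "geodesic_dist M \<A> g (param c ?b) (param c ?a) \<le> t * ((1 + \<eta>) * ?G)"
        proof (rule geodesic_dist_chart_segment[OF c])
          show "closed_segment ?b ?a \<subseteq> snd c ` fst c" using segK(1) sub by blast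
          fix y assume y: "y \<in> closed_segment ?b ?a"
          have mem: "param c y \<in> fst c" by (rule param_mem[OF subsetD[OF sub segK(1)[OF y]]])
          have "sqrt (g c (param c y) (?a - ?b) (?a - ?b)) = t * sqrt (g c (param c y) v v)"
            using metric_scaleR[OF c mem, of t v] t(1) by simp
          also have "\<dots> \<le> t * ((1 + \<eta>) * ?G)"
            using t(1) \<delta>2(2)[OF zK segK[OF y]] by (intro mult_left_mono) auto
          finally show "sqrt (g c (param c y) (?a - ?b) (?a - ?b)) \<le> t * ((1 + \<eta>) * ?G)" .
        qed
        then have "L * geodesic_dist M \<A> g (param c ?b) (param c ?a) \<le> L * (t * ((1 + \<eta>) * ?G))"
          using L by (rule mult_left_mono)
        moreover have "norm (P ?a - P ?b) \<le> L * geodesic_dist M \<A> g (param c ?b) (param c ?a)"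
          using lip[OF mem mem, of ?b ?a] segK(1)[of ?a] segK(1)[of ?b] by (simp add: Peq norm_minus_commute)
        ultimately show "norm (P ?a - P ?b) \<le> t * (L * (1 + \<eta>) * ?G)"
          by (simp add: mult.left_commute mult.assoc)
      qed
    qed
  qed
qed

text \<open>The radii are nested with room to spare: the bump is 1 up to \<open>r\<close> and
  supported in \<open>2 r\<close>, local mollification is controlled up to \<open>3 r\<close>, and
  the cube of half-side \<open>4 r\<close> still lies in the chart.\<close>

lemma exists_chart_bump:
  assumes "x \<in> M"
  shows "\<exists>c r \<beta>. c \<in> \<A> \<and> x \<in> fst c \<and> 0 < r \<and> cube (snd c x) (4 * r) \<subseteq> snd c ` fst c \<and>
    smooth_on UNIV (\<beta> :: 'e \<Rightarrow> real) \<and> (\<forall>u. 0 \<le> \<beta> u) \<and>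
    (\<forall>u\<in>cball (snd c x) r. \<beta> u = 1) \<and> (\<forall>u. u \<notin> cball (snd c x) (2 * r) \<longrightarrow> \<beta> u = 0)"
proof -
  obtain c R where c: "c \<in> \<A>" "x \<in> fst c" "0 < R" "cball (snd c x) R \<subseteq> snd c ` (fst c \<inter> M)"
    by (rule chart_ball[OF assms openin_subtopology_self assms])
  \<comment> \<open>A cube of half-side \<open>4 r\<close> lies in the Euclidean ball of radius
    \<open>DIM('e) * 4 r = R\<close>.\<close>
  define r where "r = R / (4 * real DIM('e))"
  have r: "0 < r" using c(3) by (simp add: r_def)
  have "cube (snd c x) (4 * r) \<subseteq> cball (snd c x) (real DIM('e) * (4 * r))" by (rule cube_subset_cball)
  also have "real DIM('e) * (4 * r) = R" by (simp add: r_def)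
  finally have "cube (snd c x) (4 * r) \<subseteq> snd c ` fst c" using c(4) by blast
  moreover obtain \<beta> :: "'e \<Rightarrow> real" where \<beta>: "smooth_on UNIV \<beta>" "\<And>u. 0 \<le> \<beta> u \<and> \<beta> u \<le> 1"
    "\<And>u. u \<in> cball (snd c x) r \<Longrightarrow> \<beta> u = 1" "\<And>u. u \<notin> ball (snd c x) (2 * r) \<Longrightarrow> \<beta> u = 0"
    using smooth_bump[of r "2 * r" "snd c x"] r by auto
  moreover have "\<beta> u = 0" if "u \<notin> cball (snd c x) (2 * r)" for u
    using that by (intro \<beta>(4)) auto
  ultimately show ?thesis using c(1,2) r by blast
qed

text \<open>The slope bound is stated as an implication so that the same function also serves when
  \<open>p\<close> is not Lipschitz.\<close>

lemma smooth_fun_approximation: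
  fixes p :: "'m \<Rightarrow> 'b::banach"
  assumes p: "continuous_on M p" and B: "subspace B" "closed B" "p ` M \<subseteq> B" and "0 < \<eta>" and L: "0 \<le> L"
  obtains f where "smooth_fun f" "f ` M \<subseteq> B" "\<forall>x\<in>M. norm (f x - p x) \<le> \<eta>"
    "(\<forall>x\<in>M. \<forall>y\<in>M. norm (p x - p y) \<le> L * geodesic_dist M \<A> g x y) \<longrightarrow> (\<forall>x\<in>M. slope_le f x (L + \<eta>))"
proof -
  have "\<forall>x\<in>M. \<exists>c r \<beta>. c \<in> \<A> \<and> x \<in> fst c \<and> 0 < r \<and> cube (snd c x) (4 * r) \<subseteq> snd c ` fst c \<and>
    smooth_on UNIV (\<beta> :: 'e \<Rightarrow> real) \<and> (\<forall>u. 0 \<le> \<beta> u) \<and>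
    (\<forall>u\<in>cball (snd c x) r. \<beta> u = 1) \<and> (\<forall>u. u \<notin> cball (snd c x) (2 * r) \<longrightarrow> \<beta> u = 0)"
    using exists_chart_bump by blast
  then obtain c r and \<beta> :: "'m \<Rightarrow> 'e \<Rightarrow> real" where "\<forall>x\<in>M. c x \<in> \<A> \<and> x \<in> fst (c x) \<and> 0 < r x \<and>
    cube (snd (c x) x) (4 * r x) \<subseteq> snd (c x) ` fst (c x) \<and> smooth_on UNIV (\<beta> x) \<and> (\<forall>u. 0 \<le> \<beta> x u) \<and>
    (\<forall>u\<in>cball (snd (c x) x) (r x). \<beta> x u = 1) \<and> (\<forall>u. u \<notin> cball (snd (c x) x) (2 * r x) \<longrightarrow> \<beta> x u = 0)"
    unfolding bchoice_iff by blast
  then have c: "c x \<in> \<A>" "x \<in> fst (c x)" "0 < r x" "cube (snd (c x) x) (4 * r x) \<subseteq> snd (c x) ` fst (c x)"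
    and \<beta>: "smooth_on UNIV (\<beta> x)" "0 \<le> \<beta> x u" "u \<in> cball (snd (c x) x) (r x) \<Longrightarrow> \<beta> x u = 1"
      "u \<notin> cball (snd (c x) x) (2 * r x) \<Longrightarrow> \<beta> x u = 0" if "x \<in> M" for x u
    using that by blast+
  define ctr where "ctr x = snd (c x) x" for x
  define K where "K x = cball (ctr x) (2 * r x)" for x
  have cK: "compact (K x)" for x by (simp add: K_def)
  have K: "K x \<subseteq> snd (c x) ` fst (c x)" if "x \<in> M" for x
  proof -
    have "K x \<subseteq> cball (ctr x) (4 * r x)" using c(3)[OF that] by (auto simp: K_def)
    also have "\<dots> \<subseteq> cube (ctr x) (4 * r x)" by (rule ball_subset_cube)
    also have "\<dots> \<subseteq> snd (c x) ` fst (c x)" unfolding ctr_def by (rule c(4)[OF that])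
    finally show ?thesis .
  qed
  have "openin (top_of_set M) (param (c x) ` ball (ctr x) (r x)) \<and> x \<in> param (c x) ` ball (ctr x) (r x)" if x: "x \<in> M" for x
  proof
    have "ball (ctr x) (r x) \<subseteq> K x" using c(3)[OF x] by (auto simp: K_def)
    then show "openin (top_of_set M) (param (c x) ` ball (ctr x) (r x))"
      using K[OF x] by (intro openin_param_image c x) auto
    show "x \<in> param (c x) ` ball (ctr x) (r x)"
      using c[OF x] by (intro image_eqI[of _ _ "ctr x"]) (auto simp: ctr_def param_chart)
  qed
  then obtain X where X: "X \<subseteq> M" "finite X" "M \<subseteq> (\<Union>x\<in>X. param (c x) ` ball (ctr x) (r x))"
    by (rule finite_subcover)
  define \<psi> where "\<psi> x = extend_by_zero (c x) (\<beta> x)" for x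
  have \<psi>: "smooth_fun (\<psi> x)" if "x \<in> M" for x
    unfolding \<psi>_def
    by (rule smooth_fun_extend_by_zero[OF c(1)[OF that] \<beta>(1)[OF that] cK K[OF that]])
      (use \<beta>(4)[OF that] in \<open>simp add: K_def ctr_def\<close>)
  have \<psi>0: "0 \<le> \<psi> x y" if "x \<in> M" for x y
    using \<beta>(2)[OF that] by (simp add: \<psi>_def extend_by_zero_def)
  define s where "s y = (\<Sum>x\<in>X. \<psi> x y)" for y
  have s1: "1 \<le> s y" if "y \<in> M" for y
  proof -
    obtain x u where x: "x \<in> X" "u \<in> ball (ctr x) (r x)" "y = param (c x) u" using X(3) \<open>y \<in> M\<close> by blast
    have xM: "x \<in> M" using x(1) X(1) by blast
    have "u \<in> K x" using x(2) c(3)[OF xM] by (auto simp: K_def)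
    then have "\<psi> x y = \<beta> x u" unfolding \<psi>_def x(3) using K[OF xM] by (intro extend_by_zero_param c xM) auto
    also have "\<dots> = 1" using x(2) by (intro \<beta>(3)[OF xM]) (simp add: ctr_def)
    finally have "1 = \<psi> x y" by simp
    also have "\<dots> \<le> s y" unfolding s_def using X(1) by (intro member_le_sum x X \<psi>0) auto
    finally show ?thesis .
  qed
  have "\<forall>x\<in>X. \<exists>C. 0 < C \<and> (\<forall>y\<in>M. slope_le (\<psi> x) y C)"
    using smooth_fun_slope_le[OF \<psi>] X(1) by (metis subsetD)
  then obtain C' where C': "\<And>x. x \<in> X \<Longrightarrow> 0 < C' x" "\<And>x y. x \<in> X \<Longrightarrow> y \<in> M \<Longrightarrow> slope_le (\<psi> x) y (C' x)"
    by metis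
  define C where "C = (\<Sum>x\<in>X. C' x)"
  have C0: "0 \<le> C" unfolding C_def using C'(1) by (intro sum_nonneg) (simp add: less_imp_le)
  have C: "slope_le (\<psi> x) y C" if "x \<in> X" "y \<in> M" for x y
    unfolding C_def by (rule slope_le_mono[OF C'(2)[OF that]], rule member_le_sum)
      (use that X(2) C'(1) in \<open>auto simp: less_imp_le\<close>)
  have ss: "smooth_fun s" unfolding s_def[abs_def] using X(1) by (intro smooth_fun_sum \<psi>) auto
  then have inv_s: "smooth_fun (\<lambda>y. inverse (s y))" using s1 by (intro smooth_fun_inverse) force+
  obtain C2 where C2: "\<And>y. y \<in> M \<Longrightarrow> slope_le (\<lambda>y. inverse (s y)) y C2" using smooth_fun_slope_le[OF inv_s] by blast
  \<comment> \<open>\<open>N\<close> gathers the coefficients of the local error \<theta> in the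
    final slope: \<open>L\<close> from the distortion of the metric, and \<open>2 C\<close> for each
    summand from the derivatives of the bumps. The extra 1 ensures
    \<open>\<theta> \<le> \<eta>\<close>.\<close>
  define N where "N = L + 2 * C * real (card X) + 1"
  define \<theta> where "\<theta> = \<eta> / N"
  have N: "1 \<le> N" using L C0 by (simp add: N_def)
  have \<theta>: "0 < \<theta>" "\<theta> \<le> \<eta>" "\<theta> * (L + 2 * C * real (card X)) \<le> \<eta>"
  proof -
    show "0 < \<theta>" using N \<open>0 < \<eta>\<close> by (simp add: \<theta>_def)
    then have "\<theta> * 1 \<le> \<theta> * N" "\<theta> * (L + 2 * C * real (card X)) \<le> \<theta> * N" using N by (auto simp: N_def)
    moreover have "\<theta> * N = \<eta>" using N by (simp add: \<theta>_def)
    ultimately show "\<theta> \<le> \<eta>" "\<theta> * (L + 2 * C * real (card X)) \<le> \<eta>" by auto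
  qed
  have "\<forall>x\<in>M. \<exists>F. smooth_on UNIV F \<and> (\<forall>z. F z \<in> B) \<and>
      (\<forall>z\<in>ball (ctr x) (3 * r x). norm (F z - p (param (c x) z)) \<le> \<theta>) \<and>
      ((\<forall>x\<in>M. \<forall>y\<in>M. norm (p x - p y) \<le> L * geodesic_dist M \<A> g x y) \<longrightarrow>
        (\<forall>z\<in>ball (ctr x) (3 * r x). \<forall>D v. (F has_derivative D) (at z) \<longrightarrow>
          norm (D v) \<le> L * (1 + \<theta>) * sqrt (g (c x) (param (c x) z) v v)))"
  proof
    fix x assume x: "x \<in> M"
    from local_mollification[OF p B \<theta>(1) c(1)[OF x] c(3)[OF x], of "ctr x"] c(4)[OF x]
    obtain F where "smooth_on UNIV F" "\<And>z. F z \<in> B"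
      "\<And>z. z \<in> ball (ctr x) (3 * r x) \<Longrightarrow> norm (F z - p (param (c x) z)) \<le> \<theta>"
      "\<And>L z D v. 0 \<le> L \<Longrightarrow> (\<And>x y. x \<in> M \<Longrightarrow> y \<in> M \<Longrightarrow> norm (p x - p y) \<le> L * geodesic_dist M \<A> g x y) \<Longrightarrow>
        z \<in> ball (ctr x) (3 * r x) \<Longrightarrow> (F has_derivative D) (at z) \<Longrightarrow>
        norm (D v) \<le> L * (1 + \<theta>) * sqrt (g (c x) (param (c x) z) v v)"
      unfolding ctr_def by metis
    with L show "\<exists>F. smooth_on UNIV F \<and> (\<forall>z. F z \<in> B) \<and>
      (\<forall>z\<in>ball (ctr x) (3 * r x). norm (F z - p (param (c x) z)) \<le> \<theta>) \<and>
      ((\<forall>x\<in>M. \<forall>y\<in>M. norm (p x - p y) \<le> L * geodesic_dist M \<A> g x y) \<longrightarrow>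
        (\<forall>z\<in>ball (ctr x) (3 * r x). \<forall>D v. (F has_derivative D) (at z) \<longrightarrow>
          norm (D v) \<le> L * (1 + \<theta>) * sqrt (g (c x) (param (c x) z) v v)))"
      by (intro exI[of _ F]) blast
  qed
  then obtain F where "\<forall>x\<in>M. smooth_on UNIV (F x) \<and> (\<forall>z. F x z \<in> B) \<and>
      (\<forall>z\<in>ball (ctr x) (3 * r x). norm (F x z - p (param (c x) z)) \<le> \<theta>) \<and>
      ((\<forall>x\<in>M. \<forall>y\<in>M. norm (p x - p y) \<le> L * geodesic_dist M \<A> g x y) \<longrightarrow>
        (\<forall>z\<in>ball (ctr x) (3 * r x). \<forall>D v. (F x has_derivative D) (at z) \<longrightarrow>
          norm (D v) \<le> L * (1 + \<theta>) * sqrt (g (c x) (param (c x) z) v v)))"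
    unfolding bchoice_iff by blast
  then have F: "smooth_on UNIV (F x)" "F x z \<in> B"
      "z \<in> ball (ctr x) (3 * r x) \<Longrightarrow> norm (F x z - p (param (c x) z)) \<le> \<theta>"
    and DF: "(\<And>x y. x \<in> M \<Longrightarrow> y \<in> M \<Longrightarrow> norm (p x - p y) \<le> L * geodesic_dist M \<A> g x y) \<Longrightarrow>
        z \<in> ball (ctr x) (3 * r x) \<Longrightarrow> (F x has_derivative D) (at z) \<Longrightarrow>
          norm (D v) \<le> L * (1 + \<theta>) * sqrt (g (c x) (param (c x) z) v v)" if "x \<in> M" for x z D v
    using that by blast+
  define G where "G x = extend_by_zero (c x) (\<lambda>u. \<beta> x u *\<^sub>R F x u)" for x
  have G\<psi>: "G x y = \<psi> x y *\<^sub>R F x (snd (c x) y)" for x y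
    by (simp add: G_def \<psi>_def extend_by_zero_def)
  have \<psi>z: "\<psi> x y = 0" if "x \<in> M" "y \<notin> param (c x) ` K x" for x y
    unfolding \<psi>_def
    by (rule extend_by_zero_outside[OF c(1)[OF that(1)] _ that(2)])
      (use \<beta>(4)[OF that(1)] in \<open>simp add: K_def ctr_def\<close>)
  have sG: "smooth_fun (G x)" if "x \<in> M" for x
    unfolding G_def
  proof (rule smooth_fun_extend_by_zero[OF c(1)[OF that] _ cK K[OF that]])
    show "smooth_on UNIV (\<lambda>u. \<beta> x u *\<^sub>R F x u)"
      using \<beta>(1)[OF that] F(1)[OF that] unfolding smooth_on_def by (auto intro: Ck_on_scaleR)
    show "\<beta> x u *\<^sub>R F x u = 0" if "u \<notin> K x" for u
      using that \<beta>(4)[OF \<open>x \<in> M\<close>, of u] by (simp add: K_def ctr_def)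
  qed
  define f where "f y = inverse (s y) *\<^sub>R (\<Sum>x\<in>X. G x y)" for y
  have inK: "y \<in> fst (c x) \<and> snd (c x) y \<in> ball (ctr x) (3 * r x)" if x: "x \<in> M" and y: "y \<in> param (c x) ` K x" for x y
  proof -
    obtain u where u: "u \<in> K x" "y = param (c x) u" using y by blast
    then have "u \<in> snd (c x) ` fst (c x)" using K[OF x] by blast
    then show ?thesis
      using u c(3)[OF x] by (auto simp: param_mem chart_param K_def)
  qed
  have close: "norm (f y - p y) \<le> \<theta>" if y: "y \<in> M" for y
  proof -
    have s: "0 < s y" using s1[OF y] by simp
    \<comment> \<open>The weights \<open>\<psi> x y / s y\<close> sum to 1, so
      \<open>f y - p y\<close> is an average of local errors.\<close>
    have "f y - p y = inverse (s y) *\<^sub>R (\<Sum>x\<in>X. G x y - \<psi> x y *\<^sub>R p y)"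
      using s by (simp add: f_def sum_subtractf s_def scaleR_diff_right flip: scaleR_sum_left)
    also have "norm \<dots> \<le> inverse (s y) * (\<Sum>x\<in>X. \<psi> x y * \<theta>)"
      unfolding norm_scaleR
    proof (intro mult_mono order_trans[OF norm_sum] sum_mono)
      fix x assume "x \<in> X"
      then have x: "x \<in> M" using X(1) by blast
      show "norm (G x y - \<psi> x y *\<^sub>R p y) \<le> \<psi> x y * \<theta>"
      proof (cases "y \<in> param (c x) ` K x")
        case True
        have "norm (G x y - \<psi> x y *\<^sub>R p y) = \<psi> x y * norm (F x (snd (c x) y) - p y)"
          using \<psi>0[OF x, of y] by (simp add: G\<psi> flip: scaleR_diff_right)
        also have "\<dots> \<le> \<psi> x y * \<theta>"
          using F(3)[OF x, of "snd (c x) y"] inK[OF x True] c(1)[OF x] \<psi>0[OF x, of y]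
          by (intro mult_left_mono) (auto simp: param_chart)
        finally show ?thesis .
      qed (simp add: \<psi>z[OF x] G\<psi>)
    qed (use s in auto)
    also have "\<dots> = \<theta>" using s by (simp add: s_def flip: sum_distrib_right)
    finally show ?thesis .
  qed
  show ?thesis
  proof
    show "smooth_fun f"
      unfolding f_def[abs_def] using X(1) by (intro smooth_fun_scaleR inv_s smooth_fun_sum sG) auto
    show "f ` M \<subseteq> B"
      unfolding f_def using F(2) X(1) subspace_0[OF B(1)]
      by (auto intro!: subspace_mul[OF B(1)] subspace_sum[OF B(1)] simp: G\<psi>)
    show "\<forall>y\<in>M. norm (f y - p y) \<le> \<eta>" using close \<theta>(2) by force
    show "(\<forall>x\<in>M. \<forall>y\<in>M. norm (p x - p y) \<le> L * geodesic_dist M \<A> g x y) \<longrightarrow> (\<forall>x\<in>M. slope_le f x (L + \<eta>))"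
    proof (intro impI ballI)
      fix y assume "\<forall>x\<in>M. \<forall>y\<in>M. norm (p x - p y) \<le> L * geodesic_dist M \<A> g x y" and y: "y \<in> M"
      then have lip: "\<And>x y. x \<in> M \<Longrightarrow> y \<in> M \<Longrightarrow> norm (p x - p y) \<le> L * geodesic_dist M \<A> g x y"
        by blast
      have s: "0 < s y" using s1[OF y] by simp
      text \<open>The terms of \<open>s (f - f y)\<close>, so that the derivative of \<open>\<psi> x\<close> meets a small factor at \<open>y\<close>.\<close>
      define T where "T x z = G x z - \<psi> x z *\<^sub>R f y" for x z
      have T: "slope_le (T x) y (\<psi> x y * (L * (1 + \<theta>)) + C * (2 * \<theta>))" if xX: "x \<in> X" for x
      \<comment> \<open>Either the mollification estimates hold at \<open>y\<close>, or
        \<open>y\<close> lies off the compact support of \<open>\<psi> x\<close>, near which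
        \<open>T x\<close> vanishes identically; by \<open>inK\<close> there is no third
        case.\<close>
      proof (cases "y \<in> fst (c x) \<and> snd (c x) y \<in> ball (ctr x) (3 * r x)")
        case True
        have x: "x \<in> M" using xX X(1) by blast
        let ?u = "snd (c x) y" and ?S = "snd (c x) ` fst (c x)"
        have yp: "param (c x) ?u = y" using True c(1)[OF x] by (simp add: param_chart)
        obtain E where E: "((\<psi> x \<circ> param (c x)) has_derivative E) (at ?u)" "\<And>v. norm (E v) \<le> C * sqrt (g (c x) y v v)"
          using slope_leE[OF C[OF xX y] c(1)[OF x]] True by blast
        have "Ck_on (Suc 0) UNIV (F x)" using F(1)[OF x] unfolding smooth_on_def by blast
        then have D: "(F x has_derivative frechet_derivative (F x) (at ?u)) (at ?u)" (is "(_ has_derivative ?D) _")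
          by (rule Ck_on_SucD) simp
        show ?thesis
        proof (rule slope_leI[OF c(1)[OF x]])
          show "y \<in> fst (c x)" using True by simp
          have "((\<lambda>z. (\<psi> x \<circ> param (c x)) z *\<^sub>R (F x z - f y)) has_derivative
              (\<lambda>v. (\<psi> x \<circ> param (c x)) ?u *\<^sub>R (?D v - 0) + E v *\<^sub>R (F x ?u - f y))) (at ?u)"
            by (intro has_derivative_scaleR E(1) has_derivative_diff D has_derivative_const)
          then have "((T x \<circ> param (c x)) has_derivative
              (\<lambda>v. (\<psi> x \<circ> param (c x)) ?u *\<^sub>R (?D v - 0) + E v *\<^sub>R (F x ?u - f y))) (at ?u)"
            by (rule has_derivative_transform_within_open[OF _ chart_open[OF c(1)[OF x]]])
              (use True in \<open>auto simp: T_def G\<psi> chart_param scaleR_diff_right\<close>)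
          then show "((T x \<circ> param (c x)) has_derivative
              (\<lambda>v. \<psi> x y *\<^sub>R ?D v + E v *\<^sub>R (F x ?u - f y))) (at ?u)"
            by (simp only: o_apply yp diff_0_right)
          fix v
          have "norm (F x ?u - f y) \<le> norm (F x ?u - p y) + norm (f y - p y)"
            using norm_triangle_ineq4[of "F x ?u - p y" "f y - p y"] by simp
          also have "\<dots> \<le> 2 * \<theta>"
            using F(3)[OF x, of ?u] close[OF y] True by (simp add: yp)
          finally have 1: "norm (F x ?u - f y) \<le> 2 * \<theta>" .
          have "norm (?D v) \<le> L * (1 + \<theta>) * sqrt (g (c x) y v v)"
            using DF[OF x lip, of ?u ?D v] True D by (simp add: yp)
          then have "norm (\<psi> x y *\<^sub>R ?D v) \<le> \<psi> x y * (L * (1 + \<theta>) * sqrt (g (c x) y v v))"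
            using \<psi>0[OF x, of y] by (simp add: mult_left_mono)
          moreover have "norm (E v *\<^sub>R (F x ?u - f y)) \<le> C * sqrt (g (c x) y v v) * (2 * \<theta>)"
            unfolding norm_scaleR using E(2)[of v] 1 C0 metric_nonneg[OF c(1)[OF x]] True
            by (intro mult_mono) auto
          ultimately show "norm (\<psi> x y *\<^sub>R ?D v + E v *\<^sub>R (F x ?u - f y))
              \<le> (\<psi> x y * (L * (1 + \<theta>)) + C * (2 * \<theta>)) * sqrt (g (c x) y v v)"
            using norm_triangle_mono by (fastforce simp: algebra_simps)
        qed
      next
        case False
        have x: "x \<in> M" using xX X(1) by blast
        have "slope_le (T x) y 0"
        proof (rule slope_le_cong[OF slope_le_const[of 0]])
          show "openin (top_of_set M) (M - param (c x) ` K x)"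
            by (rule openin_diff_param_image[OF c(1)[OF x] cK K[OF x]])
          show "y \<in> M - param (c x) ` K x" using False inK[OF x] y by blast
          show "0 = T x z" if "z \<in> M - param (c x) ` K x" for z
            using that by (simp add: T_def G\<psi> \<psi>z[OF x])
        qed
        then show ?thesis
          by (rule slope_le_mono) (use \<psi>0[OF x, of y] L \<theta>(1) C0 in simp)
      qed
      define Q where "Q = (\<Sum>x\<in>X. \<psi> x y * (L * (1 + \<theta>)) + C * (2 * \<theta>))"
      have fT: "s z *\<^sub>R (f z - f y) = (\<Sum>x\<in>X. T x z)" if "z \<in> M" for z
      proof -
        have "0 < s z" using s1[OF that] by simp
        then have "s z *\<^sub>R f z = (\<Sum>x\<in>X. G x z)" by (simp add: f_def)
        then show ?thesis by (simp add: T_def sum_subtractf scaleR_diff_right s_def scaleR_sum_left)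
      qed
      have "slope_le (\<lambda>z. \<Sum>x\<in>X. T x z) y Q"
        unfolding Q_def by (rule slope_le_sum[OF T])
      \<comment> \<open>This zero at \<open>y\<close> keeps the slope \<open>C2\<close> of the
        normalising factor out of the bound.\<close>
      moreover have "(\<Sum>x\<in>X. T x y) = 0" using fT[OF y] by simp
      ultimately have "slope_le (\<lambda>z. inverse (s z) *\<^sub>R (\<Sum>x\<in>X. T x z)) y (\<bar>inverse (s y)\<bar> * Q)"
        by (rule slope_le_scaleR_zero[OF C2[OF y]])
      then have "slope_le (\<lambda>z. f z - f y) y (\<bar>inverse (s y)\<bar> * Q)"
      proof (rule slope_le_cong[OF _ openin_subtopology_self y])
        fix z assume z: "z \<in> M"
        then have "s z \<noteq> 0" using s1 by force
        then show "inverse (s z) *\<^sub>R (\<Sum>x\<in>X. T x z) = f z - f y" using fT[OF z] by (metis scaleR_left_imp_eq right_inverse scaleR_scaleR scaleR_one)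
      qed
      from slope_le_add[OF this slope_le_const[of "f y"]]
      have "slope_le f y (\<bar>inverse (s y)\<bar> * Q)" by simp
      moreover have "\<bar>inverse (s y)\<bar> * Q \<le> L + \<eta>"
      proof -
        \<comment> \<open>The weights sum to \<open>s y\<close>, which the normalisation cancels
          exactly, so the main term is \<open>L * (1 + \<theta>)\<close>; in the error term
          \<open>inverse (s y)\<close> is simply at most 1.\<close>
        have "Q = s y * (L * (1 + \<theta>)) + real (card X) * (C * (2 * \<theta>))"
          by (simp add: Q_def sum.distrib s_def flip: sum_distrib_right)
        then have "\<bar>inverse (s y)\<bar> * Q = L * (1 + \<theta>) + inverse (s y) * (real (card X) * (C * (2 * \<theta>)))"
          using s by (simp add: algebra_simps)
        also have "\<dots> \<le> L * (1 + \<theta>) + 1 * (real (card X) * (C * (2 * \<theta>)))"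
          using s1[OF y] C0 \<theta>(1) by (intro add_left_mono mult_right_mono) (auto simp: inverse_le_1_iff)
        also have "\<dots> = L + \<theta> * (L + 2 * C * real (card X))" by (simp add: algebra_simps)
        finally show ?thesis using \<theta>(3) by linarith
      qed
      ultimately show "slope_le f y (L + \<eta>)" by (rule slope_le_mono)
    qed
  qed
qed

end

section \<open>Smooth projections\<close>

context compact_riemannian
begin

text \<open>The constant function 0 has slope at most 1, and the Lipschitz bound then reads
  \<open>0 \<le> 1 * geodesic_dist M \<A> g x y\<close>.\<close>

lemma geodesic_dist_nonneg:
  assumes "x \<in> M" "y \<in> M"
  shows "0 \<le> geodesic_dist M \<A> g x y"
  using slope_le_lipschitz[of "\<lambda>_. 0::real" 1 x y] slope_le_mono[OF slope_le_const[of "0::real"], of 1] assms by simp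

lemma lipschitz_const_le:
  assumes "\<And>x y. x \<in> M \<Longrightarrow> y \<in> M \<Longrightarrow> norm (f x - f y) \<le> C * geodesic_dist M \<A> g x y"
  shows "lipschitz_const M \<A> g f \<le> ennreal C"
  unfolding lipschitz_const_def
  by (rule SUP_least) (auto intro!: ennreal_leI simp: pos_divide_le_eq geodesic_dist_pos assms)

lemma lipschitz_constD:
  assumes "lipschitz_const M \<A> g f = ennreal L" "0 \<le> L" "x \<in> M" "y \<in> M"
  shows "norm (f x - f y) \<le> L * geodesic_dist M \<A> g x y"
proof (cases "x = y")
  case True
  then show ?thesis using geodesic_dist_nonneg[OF assms(3,4)] assms(2) by simp
next
  case False
  have "ennreal (norm (f x - f y) / geodesic_dist M \<A> g x y) \<le> lipschitz_const M \<A> g f"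
    unfolding lipschitz_const_def by (rule SUP_upper2[of "(x, y)"]) (use assms False in auto)
  then have "norm (f x - f y) / geodesic_dist M \<A> g x y \<le> L"
    using assms(1,2) by (simp add: ennreal_le_iff)
  then show ?thesis using geodesic_dist_pos[OF assms(3,4) False] by (simp add: pos_divide_le_eq)
qed

text \<open>The bound with an unspecified \<open>C\<close> serves the case of infinite
  \<open>L(p)\<close>, the implication the finite one.\<close>

lemma smooth_projection_approximation:
  fixes p :: "'m \<Rightarrow> 'a::cstar_algebra"
  assumes A: "real_cstar_subring A" and p: "p \<in> continuous_maps M A" "projection_on M p"
    and "0 < \<epsilon>" and L: "0 \<le> L"
  obtains q C where "q \<in> smooth_maps M \<A> A" "projection_on M q" "\<forall>x\<in>M. norm (p x - q x) \<le> \<epsilon>"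
    "\<forall>x\<in>M. \<forall>y\<in>M. norm (q x - q y) \<le> C * geodesic_dist M \<A> g x y"
    "(\<forall>x\<in>M. \<forall>y\<in>M. norm (p x - p y) \<le> L * geodesic_dist M \<A> g x y) \<longrightarrow>
      (\<forall>x\<in>M. \<forall>y\<in>M. norm (q x - q y) \<le> (L + \<epsilon>) * geodesic_dist M \<A> g x y)"
proof -
  \<comment> \<open>The self-adjoint part of \<open>A\<close> is a closed real subspace, so
    mollification and gluing do not leave it.\<close>
  let ?B = "{a \<in> A. star a = a}" and ?\<rho> = "geodesic_dist M \<A> g"
  \<comment> \<open>The bound 1/100 secures all smallness conditions: 5/4 for
    \<open>norm (f x)\<close>, \<open>4 \<eta> \<le> 1/16\<close> for the defect and
    \<open>12 \<eta> \<le> 1/8\<close> for \<open>m\<close>. The second entry reflects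
    \<open>29 = 1 + 28\<close>, from \<open>p\<close> to \<open>f\<close> and from \<open>f\<close>
    to \<open>q\<close>. The third is \<open>L\<eta>\<close> solved for \<eta>, with
    \<open>24 = 2 * 12\<close>.\<close>
  define \<eta> where "\<eta> = min (1/100) (min (\<epsilon> / 29) (\<epsilon> / (1 + 24 * (L + \<epsilon>))))"
  have pos: "0 < 1 + 24 * (L + \<epsilon>)" using assms by simp
  have "0 < \<epsilon> / (1 + 24 * (L + \<epsilon>))" using pos \<open>0 < \<epsilon>\<close> by simp
  then have \<eta>: "0 < \<eta>" "\<eta> \<le> 1/100" "29 * \<eta> \<le> \<epsilon>" "\<eta> \<le> \<epsilon> / (1 + 24 * (L + \<epsilon>))"
  proof -
    have "\<eta> \<le> \<epsilon> / 29" unfolding \<eta>_def by (rule order_trans[OF min.cobounded2 min.cobounded1])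
    then show "29 * \<eta> \<le> \<epsilon>" by simp
    show "\<eta> \<le> 1/100" unfolding \<eta>_def by (rule min.cobounded1)
    show "\<eta> \<le> \<epsilon> / (1 + 24 * (L + \<epsilon>))"
      unfolding \<eta>_def by (rule order_trans[OF min.cobounded2 min.cobounded2])
  qed (use \<open>0 < \<epsilon>\<close> in \<open>simp add: \<eta>_def\<close>)
  have L\<eta>: "L + \<eta> \<le> (1 - 24 * \<eta>) * (L + \<epsilon>)"
    using \<eta>(4) pos by (simp add: pos_le_divide_eq algebra_simps)
  have A': "subspace A" "closed A" using A by (auto simp: real_cstar_subring_def)
  have B: "subspace ?B" "closed ?B"
  proof -
    have "subspace {a::'a. star a = a}"
      by (auto simp: subspace_def star_add star_scaleR) (metis scaleR_zero_left star_scaleR)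
    from subspace_inter[OF A'(1) this] show "subspace ?B" by (simp add: Int_def)
    show "closed ?B"
      using closed_Int[OF A'(2) closed_selfadjoint] by (simp add: Int_def)
  qed
  have pM: "p x \<in> A" "is_projection (p x)" if "x \<in> M" for x
    using p that by (auto simp: continuous_maps_def projection_on_def)
  have pB: "p ` M \<subseteq> ?B" using pM by (auto simp: is_projection_def)
  have cp: "continuous_on M p" using p(1) by (simp add: continuous_maps_def)
  obtain f where f: "smooth_fun f" "f ` M \<subseteq> ?B" "\<forall>x\<in>M. norm (f x - p x) \<le> \<eta>"
    "(\<forall>x\<in>M. \<forall>y\<in>M. norm (p x - p y) \<le> L * ?\<rho> x y) \<longrightarrow> (\<forall>x\<in>M. slope_le f x (L + \<eta>))"
    by (rule smooth_fun_approximation[OF cp B pB \<eta>(1) L])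
  have fB: "f x \<in> A" "star (f x) = f x" if "x \<in> M" for x using f(2) that by auto
  have nf: "norm (f x) \<le> 5/4" if "x \<in> M" for x
    using norm_triangle_sub[of "f x" "p x"] bspec[OF f(3) that] \<eta>(2) norm_projection_le_1[OF pM(2)[OF that]] by simp
  have defect: "norm (f x * f x - f x) \<le> 4 * \<eta>" if x: "x \<in> M" for x
  proof -
    let ?d = "f x - p x"
    \<comment> \<open>The defect of \<open>p x\<close> is 0, so every term contains
      \<open>?d\<close>; the coefficients \<open>5/4 + 1 + 1\<close> are rounded up to 4.\<close>
    have "f x * f x - f x = ?d * f x + p x * ?d - ?d"
      using pM(2)[OF x] by (simp add: is_projection_def algebra_simps)
    also have "norm \<dots> \<le> norm (?d * f x + p x * ?d) + norm ?d" by (rule norm_triangle_ineq4)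
    also have "\<dots> \<le> norm (?d * f x) + norm (p x * ?d) + norm ?d"
      by (intro add_right_mono norm_triangle_ineq)
    also have "\<dots> \<le> norm ?d * (5/4) + 1 * norm ?d + norm ?d"
      using nf[OF x] norm_projection_le_1[OF pM(2)[OF x]]
      by (intro add_mono order_refl order_trans[OF norm_mult_ineq] mult_mono) auto
    also have "\<dots> \<le> 4 * norm ?d" by simp
    finally show ?thesis using bspec[OF f(3) x] by simp
  qed
  \<comment> \<open>The values are chosen point by point with no regard to continuity; smoothness is
    recovered afterwards by \<open>Ck_on_commuting_projection\<close>.\<close>
  have "\<forall>x\<in>M. \<exists>q. q \<in> A \<and> is_projection q \<and> q * f x = f x * q \<and> norm (q - f x) \<le> 7 * norm (f x * f x - f x)"
  proof
    fix x assume x: "x \<in> M"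
    have "norm (f x * f x - f x) \<le> 1/16" using defect[OF x] \<eta>(2) by simp
    from near_projection[OF A fB[OF x] nf[OF x] this]
    show "\<exists>q. q \<in> A \<and> is_projection q \<and> q * f x = f x * q \<and> norm (q - f x) \<le> 7 * norm (f x * f x - f x)"
      by blast
  qed
  then obtain q where "\<forall>x\<in>M. q x \<in> A \<and> is_projection (q x) \<and> q x * f x = f x * q x \<and>
      norm (q x - f x) \<le> 7 * norm (f x * f x - f x)"
    unfolding bchoice_iff by blast
  then have q: "q x \<in> A" "is_projection (q x)" "q x * f x = f x * q x" "norm (q x - f x) \<le> 28 * \<eta>" if "x \<in> M" for x
    using that defect[OF that] by fastforce+
  have m: "norm (q x + f x - 2 *\<^sub>R (f x * q x)) \<le> 12 * \<eta>" if x: "x \<in> M" for x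
  proof -
    \<comment> \<open>Since \<open>\<eta> \<le> 1/100\<close>, the square
      \<open>784 \<eta>^2\<close> is at most \<open>8 \<eta>\<close>; adding the defect
      \<open>4 \<eta>\<close> gives \<open>12 \<eta>\<close>.\<close>
    have "(norm (q x - f x))\<^sup>2 \<le> (28 * \<eta>)\<^sup>2" using q(4)[OF x] by (intro power_mono) auto
    also have "\<dots> = 784 * \<eta> * \<eta>" by (simp add: power2_eq_square)
    also have "\<dots> \<le> 8 * \<eta>" using \<eta>(1,2) by (intro mult_right_mono) auto
    finally show ?thesis
      using symmetry_defect_norm_le[OF q(2,3)[OF x]] defect[OF x] by simp
  qed
  have qf: "(1 - 24 * \<eta>) * norm (q x - q y) \<le> norm (f x - f y)" if "x \<in> M" "y \<in> M" for x y
    using norm_projection_diff_le[of "q y" "q x" "f y" "f x" "12 * \<eta>"] q m that by simp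
  have sq: "smooth_fun q"
    unfolding smooth_fun_Ck
  proof (intro ballI allI)
    fix c k assume c: "c \<in> \<A>"
    have mem: "param c u \<in> M" if "u \<in> snd c ` fst c" for u
      using chart_subset[OF c] param_mem[OF that] by blast
    show "Ck_on k (snd c ` fst c) (\<lambda>u. q (param c u))"
    proof (rule Ck_on_commuting_projection[OF chart_open[OF c], where f = "\<lambda>u. f (param c u)"])
      show "Ck_on k (snd c ` fst c) (\<lambda>u. f (param c u))"
        using f(1) c unfolding smooth_fun_Ck by blast
      fix u assume "u \<in> snd c ` fst c"
      note u = mem[OF this]
      show "is_projection (q (param c u))" by (rule q(2)[OF u])
      show "q (param c u) * f (param c u) = f (param c u) * q (param c u)" by (rule q(3)[OF u])
      show "norm (q (param c u) + f (param c u) - 2 *\<^sub>R (f (param c u) * q (param c u))) \<le> 1/8"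
        using m[OF u] \<eta>(2) by simp
    qed
  qed
  obtain C where C: "0 < C" "\<And>x. x \<in> M \<Longrightarrow> slope_le f x C" using smooth_fun_slope_le[OF f(1)] by blast
  show ?thesis
  proof
    have "continuous_on M q" by (rule continuous_on_smooth_fun[OF sq])
    then show "q \<in> smooth_maps M \<A> A"
      using sq q(1) by (auto simp: smooth_maps_def continuous_maps_def smooth_fun_def)
    show "projection_on M q" using q(2) by (simp add: projection_on_def)
    show "\<forall>x\<in>M. norm (p x - q x) \<le> \<epsilon>"
    proof
      fix x assume x: "x \<in> M"
      show "norm (p x - q x) \<le> \<epsilon>"
        using norm_triangle_ineq[of "p x - f x" "f x - q x"] bspec[OF f(3) x] q(4)[OF x] \<eta>(3)
        by (simp add: norm_minus_commute)
    qed
    show "\<forall>x\<in>M. \<forall>y\<in>M. norm (q x - q y) \<le> (2 * C) * ?\<rho> x y"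
    proof (intro ballI)
      fix x y assume xy: "x \<in> M" "y \<in> M"
      have "(1/2) * norm (q x - q y) \<le> (1 - 24 * \<eta>) * norm (q x - q y)"
        using \<eta>(2) by (intro mult_right_mono) auto
      also have "\<dots> \<le> C * ?\<rho> x y"
        using qf[OF xy] slope_le_lipschitz[OF C(2,1) xy] by simp
      finally show "norm (q x - q y) \<le> (2 * C) * ?\<rho> x y" by simp
    qed
    show "(\<forall>x\<in>M. \<forall>y\<in>M. norm (p x - p y) \<le> L * ?\<rho> x y) \<longrightarrow>
      (\<forall>x\<in>M. \<forall>y\<in>M. norm (q x - q y) \<le> (L + \<epsilon>) * ?\<rho> x y)"
    proof (intro impI ballI)
      fix x y assume "\<forall>x\<in>M. \<forall>y\<in>M. norm (p x - p y) \<le> L * ?\<rho> x y"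
        and xy: "x \<in> M" "y \<in> M"
      then have slope: "slope_le f z (L + \<eta>)" if "z \<in> M" for z
        using that f(4) by blast
      have "0 < L + \<eta>" using L \<eta>(1) by simp
      have "(1 - 24 * \<eta>) * norm (q x - q y) \<le> (L + \<eta>) * ?\<rho> x y"
        using qf[OF xy] slope_le_lipschitz[OF slope \<open>0 < L + \<eta>\<close> xy] by simp
      also have "\<dots> \<le> (1 - 24 * \<eta>) * (L + \<epsilon>) * ?\<rho> x y"
        by (rule mult_right_mono[OF L\<eta> geodesic_dist_nonneg[OF xy]])
      finally have "(1 - 24 * \<eta>) * norm (q x - q y) \<le> (1 - 24 * \<eta>) * ((L + \<epsilon>) * ?\<rho> x y)"
        by (simp only: mult.assoc)
      then show "norm (q x - q y) \<le> (L + \<epsilon>) * ?\<rho> x y"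
        by (rule mult_left_le_imp_le) (use \<eta>(2) in simp)
    qed
  qed
qed

end

theorem theorem1p1:
  fixes M :: "'m::t2_space set"
    and \<A> :: "('m, 'e::euclidean_space) chart set"
    and g :: "('m, 'e) chart \<Rightarrow> 'm \<Rightarrow> 'e \<Rightarrow> 'e \<Rightarrow> real"
    and A :: "'a::cstar_algebra set"
    and p :: "'m \<Rightarrow> 'a"
    and \<epsilon> :: real
  assumes "riemannian_manifold M \<A> g" and "compact M" and "connected M"
    and "real_cstar_subring A"
    and "p \<in> continuous_maps M A" and "projection_on M p"
    and "\<epsilon> > 0"
  shows "\<exists>q. q \<in> smooth_maps M \<A> A \<and> projection_on M q \<and>
           sup_norm M (\<lambda>x. p x - q x) < ennreal \<epsilon> \<and>
           lipschitz_const M \<A> g q < lipschitz_const M \<A> g p + ennreal \<epsilon>"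
proof (cases "M \<subseteq> (\<Union>c\<in>\<A>. fst c)")
  case True
  interpret compact_riemannian M \<A> g
    by unfold_locales (use True assms in auto)
  \<comment> \<open>For an infinite Lipschitz constant this is the default value 0, and only the
    bound by \<open>C\<close> is used then.\<close>
  define L where "L = enn2real (lipschitz_const M \<A> g p)"
  have L: "0 \<le> L" by (simp add: L_def)
  \<comment> \<open>Half of \<epsilon> turns the non-strict estimates into strict
    inequalities.\<close>
  have "0 < \<epsilon> / 2" using \<open>\<epsilon> > 0\<close> by simp
  then obtain q C where q: "q \<in> smooth_maps M \<A> A" "projection_on M q"
    "\<forall>x\<in>M. norm (p x - q x) \<le> \<epsilon> / 2"
    "\<forall>x\<in>M. \<forall>y\<in>M. norm (q x - q y) \<le> C * geodesic_dist M \<A> g x y"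
    "(\<forall>x\<in>M. \<forall>y\<in>M. norm (p x - p y) \<le> L * geodesic_dist M \<A> g x y) \<longrightarrow>
      (\<forall>x\<in>M. \<forall>y\<in>M. norm (q x - q y) \<le> (L + \<epsilon> / 2) * geodesic_dist M \<A> g x y)"
    by (rule smooth_projection_approximation[OF assms(4-6) _ L])
  have "sup_norm M (\<lambda>x. p x - q x) \<le> ennreal (\<epsilon> / 2)"
    unfolding sup_norm_def by (intro SUP_least ennreal_leI bspec[OF q(3)])
  also have "\<dots> < ennreal \<epsilon>" using \<open>\<epsilon> > 0\<close> by (intro ennreal_lessI) auto
  finally have "sup_norm M (\<lambda>x. p x - q x) < ennreal \<epsilon>" .
  moreover have "lipschitz_const M \<A> g q < lipschitz_const M \<A> g p + ennreal \<epsilon>"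
  proof (cases "lipschitz_const M \<A> g p = top")
    case True
    have "lipschitz_const M \<A> g q \<le> ennreal C" by (rule lipschitz_const_le) (use q(4) in blast)
    also have "\<dots> < top" by simp
    finally show ?thesis by (simp add: True)
  next
    case False
    then have eq: "lipschitz_const M \<A> g p = ennreal L"
      by (simp add: L_def less_top)
    have "lipschitz_const M \<A> g q \<le> ennreal (L + \<epsilon> / 2)"
      by (rule lipschitz_const_le) (use q(5) lipschitz_constD[OF eq L] in blast)
    also have "\<dots> < ennreal (L + \<epsilon>)" using \<open>\<epsilon> > 0\<close> L by (intro ennreal_lessI) auto
    also have "\<dots> = lipschitz_const M \<A> g p + ennreal \<epsilon>" using \<open>\<epsilon> > 0\<close> L by (simp add: eq)
    finally show ?thesis .
  qed
  ultimately show ?thesis using q(1,2) by blast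
next
  case False
  \<comment> \<open>In the discrete alternative every point is clopen, so a connected
    \<open>M\<close> is a single point. There \<open>p\<close> itself is smooth, because the atlas
    is empty, and its Lipschitz constant is a supremum over no pairs, hence 0.\<close>
  then have \<A>: "\<A> = {}" and discrete: "\<And>x. x \<in> M \<Longrightarrow> openin (top_of_set M) {x}"
    using assms(1) by (auto simp: riemannian_manifold_def smooth_manifold_def)
  have single: "M = {x}" if "x \<in> M" for x
  proof -
    have "closedin (top_of_set M) {x}" using that by (intro closed_subset) auto
    then show ?thesis
      using assms(3) discrete[OF that] unfolding connected_clopen by blast
  qed
  have empty: "{(x, y). x \<in> M \<and> y \<in> M \<and> x \<noteq> y} = {}" using single by blast
  have "lipschitz_const M \<A> g p = 0" unfolding lipschitz_const_def empty by (simp add: bot_ennreal)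
  moreover have "sup_norm M (\<lambda>x. p x - p x) \<le> 0" unfolding sup_norm_def by (intro SUP_least) simp
  moreover have "p \<in> smooth_maps M \<A> A" using assms(5) by (simp add: smooth_maps_def \<A>)
  ultimately show ?thesis
    using assms(6,7) by (intro exI[of _ p]) (auto simp: order_le_less_trans)
qed

end
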